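(* Let $X>0$ be a random variable with moments of Gamma type, with associated meromorphic function $F$, let $Y=\log X$, and let $\gamma$, $\gamma'$, $\varkappa$, $\nu_F$, $c_\ell(\cdot)$ be as in the context. Suppose that $\gamma>0$. (i) If $\gamma'<0$, then, for all $x>0$, $$f_X(x)=\sum_{\rho>0}\ \sum_{\ell=0}^{\nu_F(\rho)-1}\frac{(-1)^{\ell+1}c_{\ell+1}(\rho)}{\ell!}\,x^{-\rho-1}\log^\ell x,\qquad(1)$$ summing over all poles $\rho>0$ of $F$. In particular, if $F$ has only simple poles, $$f_X(x)=\sum_{\rho>0}-\operatorname{Res}_\rho(F)\,x^{-\rho-1}.\qquad(2)$$ (ii) If $\gamma'>0$ and there is an infinite number of poles $\rho>0$ of $F$, all simple, then the sum in (2) diverges for all $x>0$. (iii) If $\gamma'=0$, then (1) holds for $x>e^{\varkappa}$; hence (2) holds for $x>e^{\varkappa}$ provided all poles are simple. However, at least provided that there is an infinite number of poles $\rho>0$ of $F$ and all such poles are simple, the sum in (2) diverges for $0<x<e^{\varkappa}$. Corresponding results for $f_Y(y)$ are obtained by replacing $x^{-\rho-1}$ by $e^{-\rho y}$ and $\log^\ell x$ by $y^\ell$; the cut-offs in (iii) become $y>\varkappa$ and $y<\varkappa$.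
   Context: A positive random variable $X$ has moments of Gamma type if there exist integers $J,K\ge0$ and real constants $C$, $D>0$, $a_j\ne0$, $b_j$ ($1\le j\le J$), $a'_k\neq0$, $b'_k$ ($1\le k\le K$) such that $$\mathbb E\,X^s=F(s):=C D^s\,\frac{\prod_{j=1}^J\Gamma(a_js+b_j)}{\prod_{k=1}^K\Gamma(a'_ks+b'_k)}$$ for all real $s$ in some interval of positive length. $F$ is regarded as a meromorphic function on $\mathbb C$ (removable singularities removed); all its poles are real. Define $\gamma=\sum_{j}|a_j|-\sum_{k}|a'_k|$, $\gamma'=\sum_j a_j-\sum_k a'_k$, $\varkappa=\sum_j a_j\log|a_j|-\sum_k a'_k\log|a'_k|+\log D$. For a pole $s_0$ of $F$, $\nu_F(s_0)\ge1$ denotes its order, and $c_\ell(s_0)$ are the coefficients of the singular part of the Laurent expansion: $F(s)=\sum_{\ell=1}^{\nu_F(s_0)}c_\ell(s_0)(s-s_0)^{-\ell}+O(1)$ as $s\to s_0$; in particular $c_1(s_0)=\operatorname{Res}_{s_0}(F)$. When $\gamma>0$, $X$ and $Y$ are absolutely continuous with densities continuous on $(0,\infty)$ and $\mathbb R$, respectively; $f_X$ and $f_Y$ denote these.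
   Formalization: Sums over poles are limits of sums over ρ≤R, R→∞ at any fixed positive distance from poles; "diverges" means no such limit. Termwise (i) fails, e.g. F=Γ(1-αs)Γ(1-βs) with β/α extremely well approximable. Agrees with ordinary convergence if poles are separated. *)

theory Defs
  imports "HOL-Probability.Probability" "HOL-Complex_Analysis.Complex_Analysis"
begin

section \<open>Moments of Gamma type\<close>

text \<open>
  The Gamma quotient is formed pointwise with Isabelle's totalised operations (\<open>Gamma\<close> is \<open>0\<close> at
  its poles, and \<open>x / 0 = 0\<close>); \<open>remove_sings\<close> then gives the meromorphic function with removable
  singularities removed. Its value at an actual pole is \<open>0\<close>, which is irrelevant below.
\<close>

definition gamma_type_fun ::
  "real \<Rightarrow> real \<Rightarrow> nat \<Rightarrow> (nat \<Rightarrow> real) \<Rightarrow> (nat \<Rightarrow> real) \<Rightarrow> nat \<Rightarrow> (nat \<Rightarrow> real) \<Rightarrow> (nat \<Rightarrow> real)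
    \<Rightarrow> complex \<Rightarrow> complex" where
  "gamma_type_fun C D J a b K a' b' = remove_sings (\<lambda>s.
     of_real C * of_real D powr s *
     ((\<Prod>j=1..J. Gamma (of_real (a j) * s + of_real (b j))) /
      (\<Prod>k=1..K. Gamma (of_real (a' k) * s + of_real (b' k)))))"

definition moments_of_gamma_type ::
  "'w measure \<Rightarrow> ('w \<Rightarrow> real) \<Rightarrow> real \<Rightarrow> real \<Rightarrow> nat \<Rightarrow> (nat \<Rightarrow> real) \<Rightarrow> (nat \<Rightarrow> real)
    \<Rightarrow> nat \<Rightarrow> (nat \<Rightarrow> real) \<Rightarrow> (nat \<Rightarrow> real) \<Rightarrow> bool" where
  "moments_of_gamma_type M X C D J a b K a' b' \<longleftrightarrow>
     D > 0 \<and> (\<forall>j\<in>{1..J}. a j \<noteq> 0) \<and> (\<forall>k\<in>{1..K}. a' k \<noteq> 0) \<and>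
     (\<exists>l u. l < u \<and> (\<forall>s\<in>{l<..<u}.
        integrable M (\<lambda>\<omega>. X \<omega> powr s) \<and>
        of_real (integral\<^sup>L M (\<lambda>\<omega>. X \<omega> powr s)) = gamma_type_fun C D J a b K a' b' (of_real s)))"

definition gamma_param :: "nat \<Rightarrow> (nat \<Rightarrow> real) \<Rightarrow> nat \<Rightarrow> (nat \<Rightarrow> real) \<Rightarrow> real" where
  "gamma_param J a K a' = (\<Sum>j=1..J. \<bar>a j\<bar>) - (\<Sum>k=1..K. \<bar>a' k\<bar>)"

definition gamma'_param :: "nat \<Rightarrow> (nat \<Rightarrow> real) \<Rightarrow> nat \<Rightarrow> (nat \<Rightarrow> real) \<Rightarrow> real" where
  "gamma'_param J a K a' = (\<Sum>j=1..J. a j) - (\<Sum>k=1..K. a' k)"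

definition kappa_param :: "real \<Rightarrow> nat \<Rightarrow> (nat \<Rightarrow> real) \<Rightarrow> nat \<Rightarrow> (nat \<Rightarrow> real) \<Rightarrow> real" where
  "kappa_param D J a K a' =
     (\<Sum>j=1..J. a j * ln \<bar>a j\<bar>) - (\<Sum>k=1..K. a' k * ln \<bar>a' k\<bar>) + ln D"

text \<open>
  \<open>f\<close> is a density of \<open>Z\<close> that is continuous on \<open>A\<close>. Nonnegativity is required separately because
  the coercion to \<^typ>\<open>ennreal\<close> truncates negative values to \<open>0\<close>.
\<close>

definition continuous_density_on ::
  "'w measure \<Rightarrow> ('w \<Rightarrow> real) \<Rightarrow> real set \<Rightarrow> (real \<Rightarrow> real) \<Rightarrow> bool" where
  "continuous_density_on M Z A f \<longleftrightarrow>
     distributed M lborel Z (\<lambda>x. ennreal (f x)) \<and> (\<forall>x. 0 \<le> f x) \<and> continuous_on A f"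


section \<open>Poles\<close>

definition pos_poles :: "(complex \<Rightarrow> complex) \<Rightarrow> real set" where
  "pos_poles F = {\<rho>. \<rho> > 0 \<and> is_pole F (of_real \<rho>)}"

definition pole_order :: "(complex \<Rightarrow> complex) \<Rightarrow> complex \<Rightarrow> nat" where
  "pole_order F s = nat (- zorder F s)"

definition singular_coeff :: "(complex \<Rightarrow> complex) \<Rightarrow> nat \<Rightarrow> complex \<Rightarrow> complex" where
  "singular_coeff F l s = fls_nth (laurent_expansion F s) (- int l)"


section \<open>Summation over the poles\<close>

text \<open>
  A sum over all positive poles is the limit of the sums over the poles in \<open>(0, R]\<close> as
  \<open>R \<longlongrightarrow> \<infinity>\<close>, where \<open>R\<close> stays at least some fixed distance away from the poles (the limit has to
  exist and be the same for every such distance \<open>\<delta>\<close>). This is the sense in which residue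
  expansions obtained by shifting a contour converge, and term-by-term convergence cannot be
  expected in general: for \<open>X = E\<^sub>1 powr (-\<alpha>) * E\<^sub>2 powr (-\<beta>)\<close> with independent standard exponential
  \<open>E\<^sub>1\<close>, \<open>E\<^sub>2\<close>, we have \<open>F(s) = Gamma (1 - \<alpha> s) Gamma (1 - \<beta> s)\<close> with \<open>\<gamma> = \<alpha> + \<beta> = -\<gamma>'\<close>; if \<open>\<beta>/\<alpha>\<close> is a
  Liouville number that is approximated by rationals fast enough, all poles are simple but some
  poles \<open>m/\<alpha>\<close>, \<open>n/\<beta>\<close> are so close to each other that the individual residue terms (which almost
  cancel in pairs) are unbounded for every \<open>x\<close>.

  The convention agrees with ordinary convergence of the series over the poles in increasing
  order whenever the distances between distinct poles are bounded below
  (\<open>tendsto_cutoffs_separated\<close>). In general it is implied by ordinary convergence, with the same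
  value (\<open>tendsto_cutoffs\<close>), so that divergence in this sense implies ordinary divergence.
  The limit is unique since suitable truncation points always exist (\<open>cutoffs_gamma_type_fun\<close>).
\<close>

definition cutoffs :: "real set \<Rightarrow> real filter" where
  "cutoffs P = (SUP \<delta>\<in>{0<..}. inf at_top (principal {R. \<forall>\<rho>\<in>P. \<delta> \<le> \<bar>R - \<rho>\<bar>}))"

definition has_pole_sum :: "(real \<Rightarrow> complex) \<Rightarrow> real set \<Rightarrow> complex \<Rightarrow> bool" where
  "has_pole_sum t P S \<longleftrightarrow> ((\<lambda>R. \<Sum>\<rho>\<in>{\<rho>\<in>P. \<rho> \<le> R}. t \<rho>) \<longlongrightarrow> S) (cutoffs P)"

definition pole_sum_diverges :: "(real \<Rightarrow> complex) \<Rightarrow> real set \<Rightarrow> bool" where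
  "pole_sum_diverges t P \<longleftrightarrow> \<not> (\<exists>S. has_pole_sum t P S)"

lemma eventually_cutoffs_iff:
  "eventually Q (cutoffs P) \<longleftrightarrow>
     (\<forall>\<delta>>0. \<exists>N. \<forall>R\<ge>N. (\<forall>\<rho>\<in>P. \<delta> \<le> \<bar>R - \<rho>\<bar>) \<longrightarrow> Q R)"
  unfolding cutoffs_def eventually_Sup
  by (auto simp: eventually_inf_principal eventually_at_top_linorder)

lemma cutoffs_le_at_top: "cutoffs P \<le> at_top"
  by (rule filter_leI) (auto simp: eventually_cutoffs_iff eventually_at_top_linorder)

lemma tendsto_cutoffs:
  assumes "((\<lambda>R. \<Sum>\<rho>\<in>{\<rho>\<in>P. \<rho> \<le> R}. t \<rho>) \<longlongrightarrow> S) at_top"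
  shows   "has_pole_sum t P S"
  unfolding has_pole_sum_def using filterlim_mono[OF assms order.refl cutoffs_le_at_top] .

lemma tendsto_cutoffs_separated:
  assumes d: "d > 0" "\<And>\<rho> \<sigma>. \<rho> \<in> P \<Longrightarrow> \<sigma> \<in> P \<Longrightarrow> \<rho> \<noteq> \<sigma> \<Longrightarrow> d \<le> \<bar>\<rho> - \<sigma>\<bar>"
  shows "has_pole_sum t P S \<longleftrightarrow> ((\<lambda>R. \<Sum>\<rho>\<in>{\<rho>\<in>P. \<rho> \<le> R}. t \<rho>) \<longlongrightarrow> S) at_top"
proof
  let ?s = "\<lambda>R. \<Sum>\<rho>\<in>{\<rho>\<in>P. \<rho> \<le> R}. t \<rho>"
  assume lim: "has_pole_sum t P S"
  show "(?s \<longlongrightarrow> S) at_top"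
  proof (rule tendstoI)
    fix e :: real assume "e > 0"
    with lim have "eventually (\<lambda>R. dist (?s R) S < e) (cutoffs P)"
      unfolding has_pole_sum_def by (rule tendstoD)
    then obtain N where N: "\<And>R. R \<ge> N \<Longrightarrow> \<forall>\<rho>\<in>P. d/4 \<le> \<bar>R - \<rho>\<bar> \<Longrightarrow> dist (?s R) S < e"
      using d(1) unfolding eventually_cutoffs_iff by (metis zero_less_divide_iff zero_less_numeral)
    have "dist (?s R) S < e" if R: "R \<ge> N + d" for R
    proof (cases "\<forall>\<rho>\<in>P. d/4 \<le> \<bar>R - \<rho>\<bar>")
      case True
      thus ?thesis using N[of R] R d(1) by auto
    next
      case False
      then obtain \<rho> where \<rho>: "\<rho> \<in> P" "\<bar>R - \<rho>\<bar> < d/4" by (auto simp: not_le)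
      define R' where "R' = (if \<rho> \<le> R then \<rho> + d/4 else \<rho> - d/4)"
      have "{\<sigma>\<in>P. \<sigma> \<le> R'} = {\<sigma>\<in>P. \<sigma> \<le> R}"
      proof (intro Collect_cong conj_cong refl)
        fix \<sigma> assume \<sigma>: "\<sigma> \<in> P"
        show "\<sigma> \<le> R' \<longleftrightarrow> \<sigma> \<le> R"
        proof (cases "\<sigma> = \<rho>")
          case True thus ?thesis using d(1) by (auto simp: R'_def)
        next
          case False
          hence "d \<le> \<bar>\<rho> - \<sigma>\<bar>" using d(2) \<rho>(1) \<sigma> by auto
          hence "d \<le> \<rho> - \<sigma> \<or> d \<le> \<sigma> - \<rho>" by (auto simp: abs_if split: if_splits)
          moreover have "R - \<rho> < d/4" "\<rho> - R < d/4" using \<rho>(2) by linarith+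
          ultimately show ?thesis using d(1) unfolding R'_def by (cases "\<rho> \<le> R") auto
        qed
      qed
      moreover have "\<forall>\<sigma>\<in>P. d/4 \<le> \<bar>R' - \<sigma>\<bar>"
      proof
        fix \<sigma> assume \<sigma>: "\<sigma> \<in> P"
        show "d/4 \<le> \<bar>R' - \<sigma>\<bar>"
        proof (cases "\<sigma> = \<rho>")
          case True thus ?thesis using d(1) by (auto simp: R'_def)
        next
          case False
          hence "d \<le> \<bar>\<rho> - \<sigma>\<bar>" using d(2) \<rho>(1) \<sigma> by auto
          moreover have "R' = \<rho> + d/4 \<or> R' = \<rho> - d/4" by (simp add: R'_def)
          ultimately show ?thesis using d(1) by linarith
        qed
      qed
      moreover have "R' \<ge> N" using R \<rho>(2) d(1) by (auto simp: R'_def)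
      ultimately show ?thesis using N[of R'] by simp
    qed
    thus "eventually (\<lambda>R. dist (?s R) S < e) at_top"
      unfolding eventually_at_top_linorder by blast
  qed
qed (rule tendsto_cutoffs)

lemma is_pole_gamma_type_fun:
  assumes D: "D > 0" and pole: "is_pole (gamma_type_fun C D J a b K a' b') s"
  shows   "\<exists>j\<in>{1..J}. of_real (a j) * s + of_real (b j) \<in> \<int>\<^sub>\<le>\<^sub>0"
proof (rule ccontr)
  assume *: "\<not> ?thesis"
  let ?G = "\<lambda>s::complex. of_real C * of_real D powr s *
     ((\<Prod>j=1..J. Gamma (of_real (a j) * s + of_real (b j))) /
      (\<Prod>k=1..K. Gamma (of_real (a' k) * s + of_real (b' k))))"
  let ?H = "\<lambda>s::complex. of_real C * of_real D powr s *
     ((\<Prod>j=1..J. Gamma (of_real (a j) * s + of_real (b j))) *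
      (\<Prod>k=1..K. rGamma (of_real (a' k) * s + of_real (b' k))))"
  have GH: "?G = ?H"
    by (simp add: rGamma_inverse_Gamma divide_inverse prod_inversef[symmetric] o_def)
  have "?H analytic_on {s}"
    using * D by (intro analytic_intros) (auto simp: complex_nonpos_Reals_iff)
  hence an: "?G analytic_on {s}" by (simp only: GH)
  have "(gamma_type_fun C D J a b K a' b') analytic_on {s}"
    unfolding gamma_type_fun_def by (rule remove_sings_analytic_on[OF an])
  hence "\<not> is_pole (gamma_type_fun C D J a b K a' b') s"
    using analytic_at_imp_no_pole by blast
  with pole show False by contradiction
qed

lemma card_ints_between:
  assumes "(u::real) \<le> v"
  shows "finite {k::int. u \<le> k \<and> k \<le> v}" "real (card {k::int. u \<le> k \<and> k \<le> v}) \<le> v - u + 1"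
proof -
  have eq: "{k::int. u \<le> k \<and> k \<le> v} = {\<lceil>u\<rceil>..\<lfloor>v\<rfloor>}"
    by (auto simp: ceiling_le_iff le_floor_iff)
  show "finite {k::int. u \<le> k \<and> k \<le> v}" unfolding eq by simp
  show "real (card {k::int. u \<le> k \<and> k \<le> v}) \<le> v - u + 1"
    unfolding eq using assms by simp linarith
qed

lemma pos_poles_between:
  fixes C D :: real and J K :: nat and a b a' b' :: "nat \<Rightarrow> real"
  assumes D: "D > 0" and a: "\<And>j. j \<in> {1..J} \<Longrightarrow> a j \<noteq> 0"
  defines "P \<equiv> pos_poles (gamma_type_fun C D J a b K a' b')"
  assumes L: "L \<ge> 0"
  shows "finite (P \<inter> {x..x+L})"
    and "real (card (P \<inter> {x..x+L})) \<le> (\<Sum>j=1..J. L * \<bar>a j\<bar> + 1)"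
proof -
  define B where "B j = {\<rho>\<in>{x..x+L}. a j * \<rho> + b j \<in> \<int>}" for j
  have B: "finite (B j) \<and> real (card (B j)) \<le> L * \<bar>a j\<bar> + 1" if j: "j \<in> {1..J}" for j
  proof -
    define u where "u = (if a j > 0 then a j * x + b j else a j * (x + L) + b j)"
    define v where "v = u + L * \<bar>a j\<bar>"
    let ?I = "{k::int. u \<le> k \<and> k \<le> v}"
    have uv: "u \<le> v" using L by (simp add: v_def)
    have inj: "inj_on (\<lambda>\<rho>. \<lfloor>a j * \<rho> + b j\<rfloor>) (B j)"
      using a[OF j] by (auto simp: inj_on_def B_def elim!: Ints_cases)
        (metis add_right_cancel floor_of_int mult_cancel_left)
    have sub: "(\<lambda>\<rho>. \<lfloor>a j * \<rho> + b j\<rfloor>) ` B j \<subseteq> ?I"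
    proof
      fix k assume "k \<in> (\<lambda>\<rho>. \<lfloor>a j * \<rho> + b j\<rfloor>) ` B j"
      then obtain \<rho> where \<rho>: "x \<le> \<rho>" "\<rho> \<le> x + L" "a j * \<rho> + b j = of_int k"
        by (auto simp: B_def elim!: Ints_cases)
      show "k \<in> ?I"
      proof (cases "a j > 0")
        case True
        hence "a j * x \<le> a j * \<rho>" "a j * \<rho> \<le> a j * (x + L)"
          using \<rho>(1,2) by (auto intro!: mult_left_mono)
        moreover have "u = a j * x + b j" "v = a j * (x + L) + b j"
          using True by (simp_all add: u_def v_def algebra_simps)
        ultimately show ?thesis using \<rho>(3) unfolding mem_Collect_eq by linarith
      next
        case False
        hence "a j * x \<ge> a j * \<rho>" "a j * \<rho> \<ge> a j * (x + L)"
          using \<rho>(1,2) by (auto intro!: mult_left_mono_neg)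
        moreover have "u = a j * (x + L) + b j" "v = a j * x + b j"
          using False by (simp_all add: u_def v_def algebra_simps)
        ultimately show ?thesis using \<rho>(3) unfolding mem_Collect_eq by linarith
      qed
    qed
    have "finite (B j)"
      using inj sub card_ints_between(1)[OF uv] by (rule inj_on_finite)
    moreover have "card (B j) \<le> card ?I"
      using inj sub card_ints_between(1)[OF uv] by (rule card_inj_on_le)
    ultimately show ?thesis using card_ints_between(2)[OF uv] by (simp add: v_def)
  qed
  have sub: "P \<inter> {x..x+L} \<subseteq> (\<Union>j\<in>{1..J}. B j)"
  proof
    fix \<rho> assume \<rho>: "\<rho> \<in> P \<inter> {x..x+L}"
    then obtain j where j: "j \<in> {1..J}" "of_real (a j) * of_real \<rho> + of_real (b j) \<in> (\<int>\<^sub>\<le>\<^sub>0 :: complex set)"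
      using is_pole_gamma_type_fun[OF D] by (force simp: P_def pos_poles_def)
    from j(2) have "of_real (a j * \<rho> + b j) \<in> (\<int> :: complex set)"
      using nonpos_Ints_Int by simp
    hence "a j * \<rho> + b j \<in> \<int>"
      by (subst (asm) of_real_in_Ints_iff)
    with \<rho> j(1) show "\<rho> \<in> (\<Union>j\<in>{1..J}. B j)" by (auto simp: B_def)
  qed
  have fin: "finite (\<Union>j\<in>{1..J}. B j)" using B by auto
  show "finite (P \<inter> {x..x+L})" using sub fin by (rule finite_subset)
  have "card (P \<inter> {x..x+L}) \<le> card (\<Union>j\<in>{1..J}. B j)" using sub fin by (intro card_mono)
  also have "\<dots> \<le> (\<Sum>j=1..J. card (B j))" by (rule card_UN_le) auto
  finally have "real (card (P \<inter> {x..x+L})) \<le> (\<Sum>j=1..J. real (card (B j)))"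
    by (metis of_nat_le_iff of_nat_sum)
  also have "\<dots> \<le> (\<Sum>j=1..J. L * \<bar>a j\<bar> + 1)" using B by (intro sum_mono) auto
  finally show "real (card (P \<inter> {x..x+L})) \<le> (\<Sum>j=1..J. L * \<bar>a j\<bar> + 1)" .
qed

lemma finite_pos_poles_le:
  assumes "D > 0" "\<And>j. j \<in> {1..J} \<Longrightarrow> a j \<noteq> 0"
  shows   "finite {\<rho> \<in> pos_poles (gamma_type_fun C D J a b K a' b'). \<rho> \<le> R}"
proof -
  have "finite (pos_poles (gamma_type_fun C D J a b K a' b') \<inter> {0..0 + \<bar>R\<bar>})"
    using assms by (intro pos_poles_between) auto
  thus ?thesis by (rule rev_finite_subset) (auto simp: pos_poles_def)
qed

lemma cutoffs_gamma_type_fun: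
  assumes D: "D > 0" and a: "\<And>j. j \<in> {1..J} \<Longrightarrow> a j \<noteq> 0"
  shows "cutoffs (pos_poles (gamma_type_fun C D J a b K a' b')) \<noteq> bot"
proof -
  define P where "P = pos_poles (gamma_type_fun C D J a b K a' b')"
  define m where "m = (\<Sum>j=1..J. 3 * \<bar>a j\<bar> + 1)"
  have m: "m \<ge> 0" unfolding m_def by (intro sum_nonneg) auto
  define \<delta> where "\<delta> = 1 / (2 * m + 2)"
  have \<delta>: "\<delta> > 0" "\<delta> \<le> 1" "2 * \<delta> * m < 1"
    using m by (auto simp: \<delta>_def field_simps)
  have ex: "\<exists>R\<in>{N..N+1}. \<forall>\<rho>\<in>P. \<delta> \<le> \<bar>R - \<rho>\<bar>" for N
  proof (rule ccontr)
    assume neg: "\<not> ?thesis"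
    define S where "S = P \<inter> {N-1..N-1+3}"
    have S: "finite S" "real (card S) \<le> m"
      unfolding S_def m_def P_def by (intro pos_poles_between D a; simp)+
    have "{N..N+1} \<subseteq> (\<Union>\<rho>\<in>S. {\<rho>-\<delta>..\<rho>+\<delta>})"
    proof
      fix R assume R: "R \<in> {N..N+1}"
      with neg obtain \<rho> where "\<rho> \<in> P" "\<bar>R - \<rho>\<bar> < \<delta>" by (meson not_le)
      with R \<delta>(2) show "R \<in> (\<Union>\<rho>\<in>S. {\<rho>-\<delta>..\<rho>+\<delta>})"
        by (intro UN_I[of \<rho>]) (auto simp: S_def abs_if split: if_splits)
    qed
    hence "measure lborel {N..N+1} \<le> measure lborel (\<Union>\<rho>\<in>S. {\<rho>-\<delta>..\<rho>+\<delta>})"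
      using S(1) by (intro measure_mono_fmeasurable fmeasurable.finite_UN)
        (auto simp: fmeasurable_def emeasure_lborel_Icc_eq)
    also have "\<dots> \<le> (\<Sum>\<rho>\<in>S. measure lborel {\<rho>-\<delta>..\<rho>+\<delta>})"
      using S(1) by (intro measure_UNION_le) auto
    also have "\<dots> = real (card S) * (2 * \<delta>)" using \<delta>(1) by simp
    also have "\<dots> \<le> m * (2 * \<delta>)" using S(2) \<delta>(1) by (intro mult_right_mono) auto
    also have "\<dots> < 1" using \<delta>(3) by (simp add: mult_ac)
    finally show False by simp
  qed
  have "\<not> eventually (\<lambda>_. False) (cutoffs P)"
  proof
    assume "eventually (\<lambda>_. False) (cutoffs P)"
    then obtain N where "\<And>R. R \<ge> N \<Longrightarrow> \<not> (\<forall>\<rho>\<in>P. \<delta> \<le> \<bar>R - \<rho>\<bar>)"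
      using \<delta>(1) unfolding eventually_cutoffs_iff by blast
    with ex[of N] show False by auto
  qed
  thus ?thesis unfolding P_def trivial_limit_def .
qed


section \<open>The terms of the series\<close>

definition fX_pole_term :: "(complex \<Rightarrow> complex) \<Rightarrow> real \<Rightarrow> real \<Rightarrow> complex" where
  "fX_pole_term F x \<rho> =
     (\<Sum>l<pole_order F (of_real \<rho>).
        (-1) ^ (l + 1) * singular_coeff F (l + 1) (of_real \<rho>) / fact l *
        of_real (x powr (- \<rho> - 1)) * of_real (ln x ^ l))"

definition fX_residue_term :: "(complex \<Rightarrow> complex) \<Rightarrow> real \<Rightarrow> real \<Rightarrow> complex" where
  "fX_residue_term F x \<rho> = - residue F (of_real \<rho>) * of_real (x powr (- \<rho> - 1))"

definition fY_pole_term :: "(complex \<Rightarrow> complex) \<Rightarrow> real \<Rightarrow> real \<Rightarrow> complex" where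
  "fY_pole_term F y \<rho> =
     (\<Sum>l<pole_order F (of_real \<rho>).
        (-1) ^ (l + 1) * singular_coeff F (l + 1) (of_real \<rho>) / fact l *
        of_real (exp (- \<rho> * y)) * of_real (y ^ l))"

definition fY_residue_term :: "(complex \<Rightarrow> complex) \<Rightarrow> real \<Rightarrow> real \<Rightarrow> complex" where
  "fY_residue_term F y \<rho> = - residue F (of_real \<rho>) * of_real (exp (- \<rho> * y))"

end

theory Submission
  imports Defs "HOL-Real_Asymp.Real_Asymp"
begin

text \<open>
  The density of \<open>Y = ln X\<close> is recovered from \<open>F\<close> on a vertical line by Fourier inversion, since
  \<open>|F(\<sigma> + i t)|\<close> decays like \<open>exp (-\<pi> \<gamma> |t| / 2)\<close>; moving the line to \<open>Re s = R\<close> picks up the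
  residues of \<open>F(s) exp (-s y)\<close>. By Stirling's formula and the reflection formula, the integral over
  the line \<open>Re s = R\<close>, away from the poles, is \<open>exp (\<gamma>' (R ln R - R) + (\<kappa> - y) R)\<close> up to powers of
  \<open>R\<close>, which tends to \<open>0\<close> in the cases of convergence.

  For divergence, write \<open>F = H T\<close> with a regular factor \<open>H\<close> of the size just described and an almost
  periodic quotient \<open>T\<close> of sines. Individual residues are no use for truncation points that avoid the
  poles, as nearby poles may cancel. Instead, fix one pole \<open>\<rho>\<close> and almost periods \<open>\<tau>\<close> given by
  Dirichlet's theorem: the residues of \<open>F(s) exp (-s y)\<close> in a small circle around \<open>\<rho> + \<tau>\<close>
  sum up to a nonzero constant times \<open>H(\<rho> + \<tau>) exp (-\<tau> y)\<close>, asymptotically, and this is unbounded.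
\<close>

section \<open>Stirling's formula\<close>

text \<open>Three obstacles shape the estimates. The line Re s = R has to be bounded uniformly in R
  and Im s. For \<open>\<gamma>' \<le> 0\<close> the bound Re (s Ln s) \<ge> R ln R - (pi/2) |Im s|
  suffices: its loss combines with the growth of the sines to exactly the decay in Im s known from a
  fixed line. This bound requires distance from every lattice on which some a_j s + b_j is an
  integer, whereas a truncation point is only known to avoid the poles, some lattice points being
  cancelled by zeros; so R is replaced by a point less than \<delta> further right, which changes no
  partial sum. For divergence, several lattices may pass close to \<rho> + \<tau> without meeting
  there. A circle enclosing this cluster must have a radius that is large against the error of the
  almost period, since cotangents on it are as large as the inverse radius, and small against 1 / ln
  \<tau>, since only then Gamma (x + v) / Gamma (x) is close to 1 on it. Both are possible because
  Dirichlet's theorem bounds \<tau> by a power of the inverse error.\<close>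

definition gamma_main :: "complex \<Rightarrow> complex" where
  "gamma_main z = exp ((z - 1/2) * Ln z - z)"

text \<open>The term of Gudermann's series: a logarithm of
  \<open>gamma_main (z + 1) / (z * gamma_main z)\<close>. Summed over z, z + 1, ... it measures how
  far \<open>gamma_main\<close> is from satisfying the recurrence of Gamma.\<close>

definition stirling_mu :: "complex \<Rightarrow> complex" where
  "stirling_mu z = (z + 1/2) * (Ln (z + 1) - Ln z) - 1"

lemma Ln_1_plus_approx_quadratic:
  assumes "norm (w::complex) \<le> 1/2"
  shows "norm (Ln (1 + w) - (w - w^2/2)) \<le> 8 * norm w ^ 3"
proof -
  define f :: "nat \<Rightarrow> complex \<Rightarrow> complex" where
    "f = (\<lambda>i x. if i = 0 then Ln (1 + x) else if i = 1 then 1/(1+x) else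
           if i = 2 then -1/(1+x)^2 else 2/(1+x)^3)"
  have nz: "1 + x \<noteq> 0 \<and> norm (1 + x) \<ge> 1/2 \<and> 1 + x \<notin> \<real>\<^sub>\<le>\<^sub>0" if "x \<in> cball 0 (1/2)" for x :: complex
  proof -
    have "norm x \<le> 1/2" using that by simp
    moreover have "norm (1::complex) \<le> norm (1 + x) + norm x"
      using norm_triangle_ineq4[of "1+x" x] by simp
    ultimately have n: "norm (1 + x) \<ge> 1/2" by simp
    have "Re x \<ge> -1/2" using \<open>norm x \<le> 1/2\<close> abs_Re_le_cmod[of x] by linarith
    hence "Re (1 + x) > 0" by simp
    hence "1 + x \<notin> \<real>\<^sub>\<le>\<^sub>0" by (auto simp: complex_nonpos_Reals_iff)
    with n show ?thesis by auto
  qed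
  have "norm (f 0 w - (\<Sum>i\<le>2. f i 0 * (w - 0) ^ i / fact i)) \<le> 16 * norm (w - 0) ^ Suc 2 / fact 2"
  proof (rule complex_Taylor[of "cball 0 (1/2)"])
    show "convex (cball (0::complex) (1/2))" by simp
    fix i :: nat and x :: complex assume x: "x \<in> cball 0 (1/2)" and "i \<le> 2"
    then consider "i = 0" | "i = 1" | "i = 2" by linarith
    thus "(f i has_field_derivative f (Suc i) x) (at x within cball 0 (1/2))"
    proof cases
      case 1
      have "((\<lambda>x. Ln (1 + x)) has_field_derivative 1/(1+x)) (at x within cball 0 (1/2))"
        using nz[OF x] by (auto intro!: derivative_eq_intros simp: field_simps)
      thus ?thesis using 1 by (simp add: f_def)
    next
      case 2
      have "((\<lambda>x. 1/(1 + x)) has_field_derivative -1/(1+x)^2) (at x within cball 0 (1/2))"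
        using nz[OF x] by (auto intro!: derivative_eq_intros simp: power2_eq_square field_simps)
      thus ?thesis using 2 by (simp add: f_def)
    next
      case 3
      have "((\<lambda>x. -1/(1 + x)^2) has_field_derivative 2/(1+x)^3) (at x within cball 0 (1/2))"
        using nz[OF x] by (auto intro!: derivative_eq_intros simp: power2_eq_square power3_eq_cube divide_simps)
      thus ?thesis using 3 by (simp add: f_def numeral_3_eq_3)
    qed
  next
    fix x :: complex assume x: "x \<in> cball 0 (1/2)"
    \<comment> \<open>The third derivative 2 / (1 + x)^3 is at most 16 on the disc, and the
      remainder in \<open>complex_Taylor\<close> is divided by 2! only; this is the origin of the
      constant 8.\<close>
    have "(1/2)^3 \<le> norm (1 + x)^3" using nz[OF x] by (intro power_mono) auto
    hence "1/8 \<le> norm (1 + x)^3" by (simp add: power3_eq_cube)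
    hence "2 / norm (1 + x)^3 \<le> 2 / (1/8)" by (intro divide_left_mono) auto
    moreover have "norm (f (Suc 2) x) = 2 / norm (1 + x)^3" by (simp add: f_def norm_divide norm_power)
    ultimately show "norm (f (Suc 2) x) \<le> 16" by simp
  qed (use assms in auto)
  moreover have "(\<Sum>i\<le>2. f i 0 * (w - 0) ^ i / fact i) = w - w^2/2"
    by (simp add: f_def numeral_2_eq_2)
  ultimately show ?thesis by (simp add: f_def eval_nat_numeral)
qed

text \<open>Both points lie in the right half-plane, so their arguments differ by less than pi and
  no multiple of 2 pi i can appear.\<close>

lemma Ln_add_eq:
  assumes "Re z > 0" "Re (z + h) > 0"
  shows "Ln (z + h) = Ln z + Ln (1 + h / z)"
proof -
  have nz: "z \<noteq> 0" "z + h \<noteq> 0" using assms by (auto simp del: plus_complex.sel)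
  have eq: "1 + h / z = (z + h) / z" using nz by (simp add: field_simps)
  have "\<bar>Im (Ln (z + h))\<bar> < pi/2" "\<bar>Im (Ln z)\<bar> < pi/2"
    using assms Re_Ln_pos_lt_imp nz by (auto simp: Re_Ln_pos_lt)
  hence "Ln ((z + h) / z) = Ln (z + h) - Ln z"
    using nz by (intro Ln_unique) (auto simp: exp_diff abs_if split: if_splits)
  thus ?thesis unfolding eq by simp
qed

text \<open>With w = 1 / z one has (z + 1/2) (w - w^2/2) = 1 - w^2/4: the shift 1/2 in
  \<open>gamma_main\<close> is what removes the term of order 1 / z. The remaining quadratic decay
  makes the series over z + k converge.\<close>

lemma stirling_mu_bound:
  assumes "Re z \<ge> 2"
  shows "norm (stirling_mu z) \<le> 11 / (norm z)^2"
proof -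
  define w where "w = 1 / z"
  have z: "z \<noteq> 0" "norm z \<ge> 2" using assms complex_Re_le_cmod[of z] by auto
  have w: "norm w \<le> 1/2" "z * w = 1" "norm z * norm w = 1"
    using z by (auto simp: w_def norm_divide field_simps)
  define g where "g = Ln (1 + w) - (w - w^2/2)"
  have g: "norm g \<le> 8 * norm w ^ 3" unfolding g_def using w by (intro Ln_1_plus_approx_quadratic)
  have "Ln (z + 1) - Ln z = g + (w - w^2/2)"
    using Ln_add_eq[of z 1] assms by (simp add: g_def w_def)
  hence "stirling_mu z = (z + 1/2) * (g + (w - w^2/2)) - 1" by (simp add: stirling_mu_def)
  also have "\<dots> = (z + 1/2) * g + (z * w) + (1 - z * w) * w / 2 - w^2/4 - 1"
    by (simp add: field_simps power2_eq_square)
  also have "\<dots> = (z + 1/2) * g - w^2/4" using w by simp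
  finally have "norm (stirling_mu z) \<le> norm ((z + 1/2) * g) + norm (w^2/4)"
    by (simp only: norm_triangle_ineq4)
  also have "norm ((z + 1/2) * g) \<le> (norm z + 1/2) * (8 * norm w ^ 3)"
    unfolding norm_mult using norm_triangle_ineq[of z "1/2"] by (intro mult_mono g) auto
  also have "(norm z + 1/2) * (8 * norm w ^ 3) = 8 * (norm z * norm w) * norm w ^ 2 + 4 * norm w * norm w ^ 2"
    by (simp add: power2_eq_square power3_eq_cube algebra_simps)
  \<comment> \<open>The cubic error contributes 8 + 2 and the quadratic term 1/4; 11 is their sum
    rounded up.\<close>
  also have "\<dots> \<le> 8 * norm w ^ 2 + 2 * norm w ^ 2"
    using w by (intro add_mono mult_right_mono) auto
  finally have "norm (stirling_mu z) \<le> 11 * norm w ^ 2"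
    using zero_le_power2[of "norm w"] unfolding norm_divide norm_power norm_numeral by linarith
  thus ?thesis by (simp add: w_def norm_divide power_divide)
qed

lemma sum_inverse_squares_bound:
  assumes "(x::real) \<ge> 2"
  shows "(\<Sum>k<n. 1 / (x + real k)^2) \<le> 2 / x"
proof -
  have "(\<Sum>k<n. 1 / (x + real k)^2) \<le> (\<Sum>k<n. 1/(x + real k - 1) - 1/(x + real (Suc k) - 1))"
  proof (intro sum_mono)
    fix k
    have "x + real k > 1" using assms by simp
    hence "1/(x + real k - 1) - 1/(x + real (Suc k) - 1) = 1 / ((x + real k) * (x + real k - 1))"
      by (simp add: field_simps)
    moreover have "1 / (x + real k)^2 \<le> 1 / ((x + real k) * (x + real k - 1))"
      using \<open>x + real k > 1\<close> unfolding power2_eq_square by (intro divide_left_mono mult_left_mono mult_pos_pos) auto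
    ultimately show "1 / (x + real k)^2 \<le> 1/(x + real k - 1) - 1/(x + real (Suc k) - 1)" by simp
  qed
  also have "\<dots> = 1/(x - 1) - 1/(x + real n - 1)"
    by (subst sum_lessThan_telescope') simp
  also have "\<dots> \<le> 1/(x - 1)" using assms by simp
  also have "\<dots> \<le> 2 / x" using assms by (simp add: field_simps)
  finally show ?thesis .
qed

text \<open>Bounding |z + k| from below by Re z + k yields an error that depends on Re z alone,
  hence is uniform along vertical lines.\<close>

lemma stirling_mu_summable:
  assumes "Re z \<ge> 2"
  shows "summable (\<lambda>k. stirling_mu (z + of_nat k))" "norm (\<Sum>k. stirling_mu (z + of_nat k)) \<le> 22 / Re z"
proof -
  have b: "norm (stirling_mu (z + of_nat k)) \<le> 11 * (1 / (Re z + real k)^2)" for k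
  proof -
    have "norm (stirling_mu (z + of_nat k)) \<le> 11 / norm (z + of_nat k) ^ 2"
      using assms by (intro stirling_mu_bound) auto
    also have "\<dots> \<le> 11 / (Re z + real k) ^ 2"
      using assms complex_Re_le_cmod[of "z + of_nat k"] by (intro divide_left_mono power_mono mult_pos_pos) auto
    finally show ?thesis by simp
  qed
  have s: "(\<Sum>k<n. norm (stirling_mu (z + of_nat k))) \<le> 22 / Re z" for n
  proof -
    have "(\<Sum>k<n. norm (stirling_mu (z + of_nat k))) \<le> (\<Sum>k<n. 11 * (1 / (Re z + real k)^2))"
      by (intro sum_mono b)
    also have "\<dots> \<le> 11 * (2 / Re z)"
      unfolding sum_distrib_left[symmetric] using assms by (intro mult_left_mono sum_inverse_squares_bound) auto
    finally show ?thesis by simp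
  qed
  have *: "summable (\<lambda>k. norm (stirling_mu (z + of_nat k)))"
    by (rule summableI_nonneg_bounded[OF _ s]) auto
  thus "summable (\<lambda>k. stirling_mu (z + of_nat k))" by (rule summable_norm_cancel)
  show "norm (\<Sum>k. stirling_mu (z + of_nat k)) \<le> 22 / Re z"
    using summable_norm[OF *] suminf_le_const[OF * s] by simp
qed

lemma gamma_main_nonzero [simp]: "gamma_main z \<noteq> 0"
  by (simp add: gamma_main_def)

lemma gamma_main_plus1:
  assumes "Re z \<ge> 2"
  shows "gamma_main (z + 1) = z * gamma_main z * exp (stirling_mu z)"
proof -
  have "z \<noteq> 0" using assms by auto
  hence "z = exp (Ln z)" by simp
  hence "z * gamma_main z * exp (stirling_mu z) = exp (Ln z + ((z - 1/2) * Ln z - z) + stirling_mu z)"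
    unfolding gamma_main_def exp_add by simp
  also have "Ln z + ((z - 1/2) * Ln z - z) + stirling_mu z = ((z + 1) - 1/2) * Ln (z + 1) - (z + 1)"
    by (simp add: stirling_mu_def field_simps)
  finally show ?thesis by (simp add: gamma_main_def)
qed

lemma Re_pos_not_nonpos_Int: "Re z > 0 \<Longrightarrow> z \<notin> \<int>\<^sub>\<le>\<^sub>0"
  by (auto elim!: nonpos_Ints_cases)

section \<open>Comparison of Gamma with its main term along z + n\<close>

lemma Gamma_over_main_telescope:
  assumes "Re z \<ge> 2"
  shows "Gamma z / gamma_main z =
    Gamma (z + of_nat n) / gamma_main (z + of_nat n) * exp (\<Sum>k<n. stirling_mu (z + of_nat k))"
proof (induction n)
  case (Suc n)
  have "gamma_main (z + of_nat n + 1) = (z + of_nat n) * gamma_main (z + of_nat n) * exp (stirling_mu (z + of_nat n))"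
    using assms by (intro gamma_main_plus1) auto
  moreover have "Gamma (z + of_nat n + 1) = (z + of_nat n) * Gamma (z + of_nat n)"
    using assms by (intro Gamma_plus1 Re_pos_not_nonpos_Int) auto
  moreover have "z + of_nat n \<noteq> 0" using assms by (auto simp: complex_eq_iff)
  moreover have "z + of_nat (Suc n) = z + of_nat n + 1" by simp
  ultimately have "Gamma (z + of_nat (Suc n)) / gamma_main (z + of_nat (Suc n)) * exp (stirling_mu (z + of_nat n))
     = Gamma (z + of_nat n) / gamma_main (z + of_nat n)"
    by (simp only:) (simp add: divide_simps)
  hence eq: "Gamma (z + of_nat n) / gamma_main (z + of_nat n) =
     Gamma (z + of_nat (Suc n)) / gamma_main (z + of_nat (Suc n)) * exp (stirling_mu (z + of_nat n))" by (rule sym)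
  show ?case unfolding Suc eq by (simp add: exp_add mult_ac)
qed auto

lemma tendsto_mult_Ln_1_plus:
  fixes c :: complex
  shows "(\<lambda>n. of_nat n * Ln (1 + c / of_nat n)) \<longlonglongrightarrow> c"
proof -
  have "((\<lambda>w. Ln (1 + c * w)) has_field_derivative c) (at 0)"
    by (auto intro!: derivative_eq_intros)
  hence *: "((\<lambda>w. Ln (1 + c * w) / w) \<longlongrightarrow> c) (at 0)"
    by (simp add: DERIV_def)
  have "filterlim (\<lambda>n. 1 / of_nat (Suc n) :: complex) (at 0) sequentially"
    unfolding filterlim_at using LIMSEQ_inverse_real_of_nat[THEN tendsto_of_real, where 'a=complex]
    by (auto simp: inverse_eq_divide intro!: always_eventually simp flip: of_nat_Suc simp del: of_nat_Suc)
  from filterlim_compose[OF * this]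
  have "(\<lambda>n. of_nat (Suc n) * Ln (1 + c / of_nat (Suc n))) \<longlonglongrightarrow> c" by (simp add: mult_ac)
  thus ?thesis by (subst (asm) filterlim_sequentially_Suc)
qed

text \<open>Up to a factor depending on n alone, \<open>gamma_main (z + n + 1)\<close> behaves like
  n^z. Gamma contains the same power of n by \<open>Gamma_shift_limit\<close>, so the asymptotics of
  the quotient of the two do not depend on z.\<close>

lemma gamma_main_shift_limit:
  assumes "Re z > 0"
  shows "(\<lambda>n. gamma_main (z + of_nat n + 1) /
     (exp ((of_nat n + 1/2) * of_real (ln (real n)) - of_nat n) * exp (z * of_real (ln (real n))))) \<longlonglongrightarrow> 1"
proof -
  have l: "(\<lambda>n. of_nat n * Ln (1 + (z + 1) / of_nat n)) \<longlonglongrightarrow> z + 1" by (rule tendsto_mult_Ln_1_plus)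
  have "(\<lambda>n. of_nat n * Ln (1 + (z + 1) / of_nat n) * (1 / of_nat n)) \<longlonglongrightarrow> (z + 1) * 0"
    by (intro tendsto_mult l lim_1_over_n)
  hence "(\<lambda>n. of_nat n * Ln (1 + (z + 1) / of_nat n) * (1 / of_nat n)) \<longlonglongrightarrow> 0" by simp
  hence l0: "(\<lambda>n. Ln (1 + (z + 1) / of_nat n)) \<longlonglongrightarrow> 0"
    by (rule Lim_transform_eventually)
       (auto intro!: eventually_mono[OF eventually_gt_at_top[of 0]])
  have "(\<lambda>n. exp ((z + 1/2) * Ln (1 + (z + 1) / of_nat n) + of_nat n * Ln (1 + (z + 1) / of_nat n) - (z + 1)))
      \<longlonglongrightarrow> exp ((z + 1/2) * 0 + (z + 1) - (z + 1))"
    by (intro tendsto_intros l l0)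
  hence "(\<lambda>n. exp ((z + 1/2) * Ln (1 + (z + 1) / of_nat n) + of_nat n * Ln (1 + (z + 1) / of_nat n) - (z + 1)))
      \<longlonglongrightarrow> 1" by simp
  moreover have "eventually (\<lambda>n. exp ((z + 1/2) * Ln (1 + (z + 1) / of_nat n) + of_nat n * Ln (1 + (z + 1) / of_nat n) - (z + 1))
     = gamma_main (z + of_nat n + 1) / (exp ((of_nat n + 1/2) * of_real (ln (real n)) - of_nat n) * exp (z * of_real (ln (real n))))) sequentially"
    using eventually_gt_at_top[of 0]
  proof eventually_elim
    case (elim n)
    define L where "L = complex_of_real (ln (real n))"
    define M where "M = Ln (1 + (z + 1) / of_nat n)"
    have "Ln (of_nat n + (z + 1)) = Ln (of_nat n) + M"
      unfolding M_def using assms elim by (intro Ln_add_eq) auto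
    also have "Ln (of_nat n) = L" using elim by (simp add: Ln_of_nat L_def)
    finally have L1: "Ln (z + of_nat n + 1) = L + M" by (simp add: add_ac)
    have "(z + of_nat n + 1 - 1/2) * (L + M) - (z + of_nat n + 1) = 
       ((of_nat n + 1/2) * L - of_nat n + z * L) + ((z + 1/2) * M + of_nat n * M - (z + 1))"
      by (simp add: field_simps)
    hence "gamma_main (z + of_nat n + 1) = exp ((of_nat n + 1/2) * L - of_nat n) * exp (z * L) * exp ((z + 1/2) * M + of_nat n * M - (z + 1))"
      unfolding gamma_main_def L1 by (simp only: exp_add)
    thus ?case unfolding L_def M_def by simp
  qed
  ultimately show ?thesis by (rule Lim_transform_eventually)
qed

text \<open>Gauss's limit formula for Gamma, solved for the Gamma value at the shifted
  argument.\<close>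

lemma Gamma_shift_limit:
  assumes "Re z > 0"
  shows "(\<lambda>n. Gamma (z + of_nat n + 1) / (fact n * exp (z * of_real (ln (real n))))) \<longlonglongrightarrow> 1"
proof -
  have z: "z \<notin> \<int>\<^sub>\<le>\<^sub>0" using assms by (rule Re_pos_not_nonpos_Int)
  hence nz: "Gamma z \<noteq> 0" by (simp add: Gamma_eq_zero_iff)
  have "(\<lambda>n. Gamma z / Gamma_series z n) \<longlonglongrightarrow> Gamma z / Gamma z"
    using nz by (intro tendsto_intros)
  moreover have "Gamma z / Gamma_series z n = Gamma (z + of_nat n + 1) / (fact n * exp (z * of_real (ln (real n))))" for n
    using pochhammer_Gamma[OF z, of "Suc n"] nz by (simp add: Gamma_series_def field_simps)
  ultimately show ?thesis using nz by simp
qed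

text \<open>For the quotient q of Gamma by its main term, q (z + n) tends to q z / exp (E z), where
  E is the sum of Gudermann's series, while q (z + n + 1) / q (2 + n + 1) tends to 1. Hence q z /
  exp (E z) is the same number for all z, and c is its value at 2.\<close>

theorem Gamma_stirling:
  obtains c :: complex where "c \<noteq> 0"
    "\<And>z. Re z \<ge> 2 \<Longrightarrow> \<exists>E. norm E \<le> 22 / Re z \<and> Gamma z = c * exp ((z - 1/2) * Ln z - z + E)"
proof -
  define q where "q z = Gamma z / gamma_main z" for z
  define E where "E z = (\<Sum>k. stirling_mu (z + of_nat k))" for z
  have lim: "(\<lambda>n. q (z + of_nat n)) \<longlonglongrightarrow> q z / exp (E z)" if z: "Re z \<ge> 2" for z
  proof -
    have "(\<lambda>n. \<Sum>k<n. stirling_mu (z + of_nat k)) \<longlonglongrightarrow> E z"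
      unfolding E_def using stirling_mu_summable[OF z] by (intro summable_LIMSEQ)
    hence "(\<lambda>n. q z / exp (\<Sum>k<n. stirling_mu (z + of_nat k))) \<longlonglongrightarrow> q z / exp (E z)"
      by (intro tendsto_intros) auto
    moreover have "q z / exp (\<Sum>k<n. stirling_mu (z + of_nat k)) = q (z + of_nat n)" for n
      using Gamma_over_main_telescope[OF z, of n] by (simp add: q_def)
    ultimately show ?thesis by simp
  qed
  have lim2: "(\<lambda>n. q (z + of_nat n + 1) / (fact n / exp ((of_nat n + 1/2) * of_real (ln (real n)) - of_nat n))) \<longlonglongrightarrow> 1"
    if z: "Re z \<ge> 2" for z
  proof -
    have "Re z > 0" using z by simp
    from tendsto_divide[OF Gamma_shift_limit[OF this] gamma_main_shift_limit[OF this]]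
    show ?thesis by (simp add: q_def field_simps)
  qed
  define c where "c = q 2 / exp (E 2)"
  have c: "c \<noteq> 0" by (simp add: c_def q_def Gamma_eq_zero_iff Re_pos_not_nonpos_Int)
  have "q z = c * exp (E z)" if z: "Re z \<ge> 2" for z
  proof -
    have *: "(\<lambda>n. q (w + of_nat n + 1)) \<longlonglongrightarrow> q w / exp (E w)" if "Re w \<ge> 2" for w
      using lim[OF that, THEN LIMSEQ_Suc] by (simp add: add_ac)
    have "(\<lambda>n. q (z + of_nat n + 1) / q (2 + of_nat n + 1)) \<longlonglongrightarrow> 1"
    proof -
      have "(\<lambda>n. q (z + of_nat n + 1) / (fact n / exp ((of_nat n + 1/2) * of_real (ln (real n)) - of_nat n)) /
        (q (2 + of_nat n + 1) / (fact n / exp ((of_nat n + 1/2) * of_real (ln (real n)) - of_nat n)))) \<longlonglongrightarrow> 1 / 1"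
        using lim2[OF z] lim2[of 2] by (intro tendsto_divide) auto
      thus ?thesis by simp
    qed
    moreover have "(\<lambda>n. q (z + of_nat n + 1) / q (2 + of_nat n + 1)) \<longlonglongrightarrow> (q z / exp (E z)) / c"
      using c unfolding c_def by (intro tendsto_divide * z) auto
    ultimately have "1 = (q z / exp (E z)) / c" by (rule LIMSEQ_unique)
    thus ?thesis using c by (simp add: field_simps)
  qed
  hence "Gamma z = c * exp (E z) * gamma_main z" if z: "Re z \<ge> 2" for z
    using z by (simp add: q_def field_simps)
  hence "Gamma z = c * exp ((z - 1/2) * Ln z - z + E z)" if z: "Re z \<ge> 2" for z
    using z unfolding gamma_main_def exp_add by simp
  moreover have "norm (E z) \<le> 22 / Re z" if z: "Re z \<ge> 2" for z
    unfolding E_def using stirling_mu_summable(2)[OF z] .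
  ultimately show ?thesis using that[OF c] by blast
qed

section \<open>Estimates for affine and slightly displaced arguments\<close>

lemma norm_Ln_1_plus_le:
  assumes "norm (w::complex) \<le> 1/2"
  shows "norm (Ln (1 + w)) \<le> 4 * norm w"
proof -
  have "norm (Ln (1 + w)) \<le> norm (Ln (1 + w) - (w - w^2/2)) + norm (w - w^2/2)"
    using norm_triangle_sub[of "Ln (1 + w)" "w - w^2/2"] by simp
  also have "norm (w - w^2/2) \<le> norm w + norm w ^ 2 / 2"
    using norm_triangle_ineq4[of w "w^2/2"] by (simp add: norm_divide norm_power)
  also have "norm (Ln (1 + w) - (w - w^2/2)) \<le> 8 * norm w ^ 3"
    using assms by (rule Ln_1_plus_approx_quadratic)
  finally have "norm (Ln (1 + w)) \<le> norm w * (8 * norm w ^ 2 + norm w / 2 + 1)"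
    by (simp add: power2_eq_square power3_eq_cube algebra_simps)
  also have "norm w ^ 2 \<le> (1/2)^2" using assms by (intro power_mono) auto
  hence "norm w * (8 * norm w ^ 2 + norm w / 2 + 1) \<le> norm w * 4"
    using assms by (intro mult_left_mono) (auto simp: power2_eq_square)
  finally show ?thesis by (simp add: mult_ac)
qed

text \<open>The source of the thresholds 3 in what follows: beyond e, constants can be absorbed into
  multiples of the logarithm.\<close>

lemma ln_ge_1:
  assumes "(x::real) \<ge> 3"
  shows "ln x \<ge> 1"
proof -
  have "ln (exp 1) \<le> ln x" using assms exp_le by (intro ln_mono) auto
  thus ?thesis by simp
qed

lemma norm_Ln_le_ln:
  assumes "Re s \<ge> 3"
  shows "norm (Ln s) \<le> 3 * ln (norm s)" "ln (norm s) \<ge> 1"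
proof -
  have n: "norm s \<ge> 3" using assms complex_Re_le_cmod[of s] by linarith
  thus l: "ln (norm s) \<ge> 1" by (rule ln_ge_1)
  have s: "s \<noteq> 0" using n by auto
  have "norm (Ln s) \<le> \<bar>Re (Ln s)\<bar> + \<bar>Im (Ln s)\<bar>" by (rule cmod_le)
  also have "\<bar>Re (Ln s)\<bar> = ln (norm s)" using s l by simp
  also have "\<bar>Im (Ln s)\<bar> \<le> pi / 2"
    using assms s Re_Ln_pos_le[of s] by auto
  also have "pi / 2 \<le> 2 * ln (norm s)" using l pi_less_4 by linarith
  finally show "norm (Ln s) \<le> 3 * ln (norm s)" by simp
qed

text \<open>
  The size of \<open>\<Gamma>(a s + b)\<close> in a right half-plane up to powers of \<open>|s|\<close>.
\<close>

definition gamma_size :: "real \<Rightarrow> complex \<Rightarrow> real" where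
  "gamma_size a s = a * Re (s * Ln s) + a * (ln \<bar>a\<bar> - 1) * Re s"

text \<open>Write Ln (A s + B) = ln A + Ln s + \<delta> with \<delta> = O(1 / |s|). Then A s
  \<delta> is bounded, and what remains besides \<open>gamma_size\<close> is a bounded multiple of
  Ln s together with bounded terms, that is O(ln |s|).\<close>

lemma Gamma_size:
  fixes A B :: real
  assumes A: "A > 0"
  obtains K \<sigma> where "\<sigma> \<ge> 3" "K \<ge> 0"
    "\<And>s. Re s \<ge> \<sigma> \<Longrightarrow> A * Re s + B \<ge> 2"
    "\<And>s. Re s \<ge> \<sigma> \<Longrightarrow> \<bar>ln (norm (Gamma (of_real A * s + of_real B))) - gamma_size A s\<bar> \<le> K * ln (norm s)"
proof -
  obtain c :: complex where c: "c \<noteq> 0"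
    "\<And>z. Re z \<ge> 2 \<Longrightarrow> \<exists>E. norm E \<le> 22 / Re z \<and> Gamma z = c * exp ((z - 1/2) * Ln z - z + E)"
    using Gamma_stirling by blast
  \<comment> \<open>The bound (2 - B) / A puts A s + B into the range of
    \<open>Gamma_stirling\<close>, and 2 |B| / A keeps B / (A s) in the disc of radius 1/2.\<close>
  define \<sigma> where "\<sigma> = max 3 (max ((2 - B) / A) (2 * \<bar>B\<bar> / A))"
  define K where "K = \<bar>ln (norm c)\<bar> + 11 + 4 * \<bar>B\<bar> + \<bar>B - 1/2\<bar> * (\<bar>ln A\<bar> + 5) + \<bar>B\<bar>"
  have \<sigma>: "\<sigma> \<ge> 3" "\<sigma> \<ge> (2 - B) / A" "\<sigma> \<ge> 2 * \<bar>B\<bar> / A" by (auto simp: \<sigma>_def)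
  have ge2: "A * Re s + B \<ge> 2" if s: "Re s \<ge> \<sigma>" for s
  proof -
    have "Re s \<ge> (2 - B) / A" using s \<sigma> by linarith
    thus ?thesis using A by (simp add: field_simps)
  qed
  have "\<bar>ln (norm (Gamma (of_real A * s + of_real B))) - gamma_size A s\<bar> \<le> K * ln (norm s)"
    if s: "Re s \<ge> \<sigma>" for s
  proof -
    define z where "z = of_real A * s + of_real B"
    have s3: "Re s \<ge> 3" using s \<sigma> by linarith
    have ns: "norm s \<ge> Re s" by (rule complex_Re_le_cmod)
    have s0: "s \<noteq> 0" using s3 by auto
    have z2: "Re z \<ge> 2" using ge2[OF s] by (simp add: z_def)
    define \<delta> where "\<delta> = Ln (1 + of_real B / (of_real A * s))"
    have nw: "norm (of_real B / (of_real A * s)) = \<bar>B\<bar> / (A * norm s)"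
      using A by (simp add: norm_divide norm_mult)
    also have "2 * \<bar>B\<bar> / A \<le> norm s" using s \<sigma> ns by linarith
    hence "\<bar>B\<bar> / (A * norm s) \<le> 1/2" using A s0 by (simp add: field_simps)
    finally have "norm \<delta> \<le> 4 * (\<bar>B\<bar> / (A * norm s))"
      unfolding \<delta>_def nw[symmetric] by (rule norm_Ln_1_plus_le)
    also have "\<dots> \<le> 4 * (1/2)" using \<open>\<bar>B\<bar> / (A * norm s) \<le> 1/2\<close> by (intro mult_left_mono) auto
    finally have \<delta>2: "norm \<delta> \<le> 2" by simp
    have "norm (of_real A * s * \<delta>) = A * norm s * norm \<delta>" using A by (simp add: norm_mult)
    also have "\<dots> \<le> A * norm s * (4 * (\<bar>B\<bar> / (A * norm s)))"
      using A \<open>norm \<delta> \<le> 4 * (\<bar>B\<bar> / (A * norm s))\<close> by (intro mult_left_mono) auto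
    also have "\<dots> = 4 * \<bar>B\<bar>" using A s0 by (simp add: field_simps)
    finally have \<delta>1: "norm (of_real A * s * \<delta>) \<le> 4 * \<bar>B\<bar>" .
    have "Ln z = Ln (of_real A * s) + \<delta>"
      unfolding z_def \<delta>_def using A s3 z2 by (intro Ln_add_eq) (auto simp: z_def)
    also have "Ln (of_real A * s) = of_real (ln A) + Ln s"
      using A s0 by (simp add: Ln_times_of_real Ln_of_real)
    finally have Lz: "Ln z = of_real (ln A) + Ln s + \<delta>" .
    obtain E where E: "norm E \<le> 22 / Re z" "Gamma z = c * exp ((z - 1/2) * Ln z - z + E)"
      using c(2)[OF z2] by blast
    have "22 / Re z \<le> 11" using z2 by (simp add: field_simps)
    hence E11: "norm E \<le> 11" using E by linarith
    \<comment> \<open>\<open>V\<close> collects the part growing like s Ln s or s, \<open>W\<close>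
      everything of at most logarithmic order.\<close>
    define W where "W = of_real (B - 1/2) * (of_real (ln A) + Ln s + \<delta>) + of_real A * s * \<delta> - of_real B + E"
    define V where "V = of_real A * (s * Ln s) + of_real (A * (ln A - 1)) * s"
    have eq: "(z - 1/2) * Ln z - z + E = V + W"
      unfolding Lz by (simp add: z_def W_def V_def algebra_simps)
    have "norm (Gamma z) = norm c * exp (Re V + Re W)"
      unfolding E(2) eq by (simp add: norm_mult)
    hence ln: "ln (norm (Gamma z)) = ln (norm c) + Re V + Re W"
      using c(1) by (simp add: ln_mult)
    have ReV: "Re V = gamma_size A s" using A by (simp add: V_def gamma_size_def)
    have lns: "norm (Ln s) \<le> 3 * ln (norm s)" "ln (norm s) \<ge> 1" using norm_Ln_le_ln[OF s3] by auto
    have sub: "norm (of_real (ln A) + Ln s + \<delta>) \<le> (\<bar>ln A\<bar> + 5) * ln (norm s)"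
    proof -
      have "norm (of_real (ln A) + Ln s + \<delta>) \<le> norm (complex_of_real (ln A)) + norm (Ln s) + norm \<delta>"
        by (intro norm_triangle_le add_mono order.refl norm_triangle_ineq)
      also have "norm (complex_of_real (ln A)) = \<bar>ln A\<bar>" by simp
      also have "\<bar>ln A\<bar> + norm (Ln s) + norm \<delta> \<le> \<bar>ln A\<bar> * ln (norm s) + 3 * ln (norm s) + 2 * ln (norm s)"
        using lns \<delta>2 mult_left_mono[of 1 "ln (norm s)" "\<bar>ln A\<bar>"] by (intro add_mono) auto
      finally show ?thesis by (simp add: algebra_simps)
    qed
    have "norm W \<le> norm (of_real (B - 1/2) * (of_real (ln A) + Ln s + \<delta>)) + norm (of_real A * s * \<delta>) + norm (complex_of_real B) + norm E"
      unfolding W_def by (meson add_mono norm_triangle_ineq norm_triangle_ineq4 norm_triangle_le order.refl order.trans)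
    also have "\<dots> \<le> \<bar>B - 1/2\<bar> * ((\<bar>ln A\<bar> + 5) * ln (norm s)) + 4 * \<bar>B\<bar> + \<bar>B\<bar> + 11"
      unfolding norm_mult[of "of_real (B - 1/2)"] norm_of_real using sub \<delta>1 E11
      by (intro add_mono mult_mono) auto
    finally have "\<bar>Re W\<bar> \<le> \<bar>B - 1/2\<bar> * ((\<bar>ln A\<bar> + 5) * ln (norm s)) + 4 * \<bar>B\<bar> + \<bar>B\<bar> + 11"
      using abs_Re_le_cmod[of W] by linarith
    hence "\<bar>ln (norm (Gamma z)) - gamma_size A s\<bar> \<le>
       \<bar>B - 1/2\<bar> * (\<bar>ln A\<bar> + 5) * ln (norm s) + (\<bar>ln (norm c)\<bar> + 4 * \<bar>B\<bar> + \<bar>B\<bar> + 11)"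
      unfolding ln ReV by linarith
    also have "(\<bar>ln (norm c)\<bar> + 4 * \<bar>B\<bar> + \<bar>B\<bar> + 11) \<le> (\<bar>ln (norm c)\<bar> + 4 * \<bar>B\<bar> + \<bar>B\<bar> + 11) * ln (norm s)"
      using mult_left_mono[OF lns(2), of "\<bar>ln (norm c)\<bar> + 4 * \<bar>B\<bar> + \<bar>B\<bar> + 11"] by simp
    finally show ?thesis by (simp add: z_def K_def algebra_simps)
  qed
  moreover have "K \<ge> 0" by (simp add: K_def)
  ultimately show ?thesis using that[OF \<sigma>(1), of K] ge2 by blast
qed

text \<open>For use on small circles far to the right: a displacement v changes Gamma by a factor
  close to 1 as soon as |v| ln x is small, in accordance with the derivative of ln Gamma being about
  ln x. The summand 1 / x comes from the errors in Stirling's formula at the two points.\<close>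

lemma Gamma_ratio:
  obtains K where "K \<ge> 0"
    "\<And>(x::real) (v::complex). x \<ge> 3 \<Longrightarrow> norm v \<le> 1 \<Longrightarrow> 
       \<exists>e. norm e \<le> K * (norm v * ln x + 1 / x) \<and> Gamma (of_real x + v) = of_real (Gamma x) * exp e"
proof -
  obtain c :: complex where c: "c \<noteq> 0"
    "\<And>z. Re z \<ge> 2 \<Longrightarrow> \<exists>E. norm E \<le> 22 / Re z \<and> Gamma z = c * exp ((z - 1/2) * Ln z - z + E)"
    using Gamma_stirling by blast
  have main: "\<exists>e. norm e \<le> 55 * (norm v * ln x + 1 / x) \<and> Gamma (of_real x + v) = of_real (Gamma x) * exp e"
    if x: "x \<ge> 3" and v: "norm v \<le> 1" for x :: real and v :: complex
  proof -
    have Rev: "\<bar>Re v\<bar> \<le> 1" using v abs_Re_le_cmod[of v] by linarith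
    obtain E1 where E1: "norm E1 \<le> 22 / Re (of_real x)" "Gamma (complex_of_real x) = c * exp ((of_real x - 1/2) * Ln (of_real x) - of_real x + E1)"
      using c(2)[of "of_real x"] x by auto
    obtain E2 where E2: "norm E2 \<le> 22 / Re (of_real x + v)" "Gamma (complex_of_real x + v) = c * exp ((of_real x + v - 1/2) * Ln (of_real x + v) - (of_real x + v) + E2)"
      using c(2)[of "of_real x + v"] x Rev by (auto simp: abs_le_iff)
    \<comment> \<open>Since x is at least 3, Re (x + v) \<ge> x - 1 \<ge> 2 x / 3.\<close>
    have "22 / Re (of_real x + v) \<le> 33 / x" using x Rev by (simp add: field_simps)
    hence nE2: "norm E2 \<le> 33 / x" using E2(1) by linarith
    have nE1: "norm E1 \<le> 22 / x" using E1(1) by simp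
    define w where "w = v / of_real x"
    have nw: "norm w = norm v / x" using x by (simp add: w_def norm_divide)
    have "norm w \<le> 1/2" unfolding nw using x v by (simp add: field_simps)
    hence lw: "norm (Ln (1 + w)) \<le> 4 * (norm v / x)" using norm_Ln_1_plus_le nw by metis
    have lx: "Ln (of_real x + v) = of_real (ln x) + Ln (1 + w)"
      unfolding w_def using x Rev by (subst Ln_add_eq) (auto simp: Ln_of_real)
    define e where "e = v * of_real (ln x) + (of_real x + v - 1/2) * Ln (1 + w) - v + E2 - E1"
    have l1: "ln x \<ge> 1" using x by (rule ln_ge_1)
    have n1: "norm ((of_real x + v - 1/2) * Ln (1 + w)) \<le> 2 * x * (4 * (norm v / x))"
      unfolding norm_mult
    proof (intro mult_mono lw)
      have "norm (of_real x + v - 1/2) \<le> norm (complex_of_real x) + norm v + norm (1/2 :: complex)"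
        by (meson add_mono norm_triangle_ineq norm_triangle_ineq4 norm_triangle_le order.refl order.trans)
      also have "\<dots> \<le> 2 * x" using x v by simp
      finally show "norm (of_real x + v - 1/2) \<le> 2 * x" .
    qed (use x in auto)
    have "norm e \<le> norm (v * of_real (ln x)) + norm ((of_real x + v - 1/2) * Ln (1 + w)) + norm v + norm E2 + norm E1"
      unfolding e_def by (meson add_mono norm_triangle_ineq norm_triangle_ineq4 norm_triangle_le order.refl order.trans)
    also have "\<dots> \<le> norm v * ln x + 2 * x * (4 * (norm v / x)) + norm v + 33 / x + 22 / x"
      using n1 nE1 nE2 l1 by (intro add_mono) (auto simp: norm_mult)
    also have "\<dots> = norm v * ln x + 9 * norm v + 55 / x" using x by (simp add: field_simps)
    also have "9 * norm v \<le> 9 * (norm v * ln x)" using mult_left_mono[OF l1, of "norm v"] by simp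
    finally have "norm e \<le> 10 * (norm v * ln x) + 55 / x" by simp
    also have "\<dots> \<le> 55 * (norm v * ln x) + 55 / x" using l1 by (intro add_mono mult_right_mono) auto
    finally have "norm e \<le> 55 * (norm v * ln x + 1 / x)" by (simp add: algebra_simps)
    moreover have "Gamma (of_real x + v) = of_real (Gamma x) * exp e"
    proof -
      have lnx: "Ln (complex_of_real x) = of_real (ln x)" using x by (simp add: Ln_of_real)
      have "(of_real x + v - 1/2) * Ln (of_real x + v) - (of_real x + v) + E2 
         = ((of_real x - 1/2) * Ln (of_real x) - of_real x + E1) + e"
        unfolding lx lnx e_def by (simp add: algebra_simps)
      hence "Gamma (of_real x + v) = Gamma (of_real x) * exp e"
        unfolding E1(2) E2(2) by (simp only: exp_add mult.assoc)
      thus ?thesis by (simp add: Gamma_complex_of_real)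
    qed
    ultimately show ?thesis by blast
  qed
  show ?thesis by (rule that[OF _ main]) auto
qed

section \<open>Growth of affine Gamma factors\<close>

lemma norm_sin_le: "norm (sin (z::complex)) \<le> exp \<bar>Im z\<bar>"
proof (rule power2_le_imp_le)
  have "norm (sin z)^2 = (exp (2 * Im z) + exp (-2 * Im z) - 2 * cos (2 * Re z)) / 4"
    by (simp add: norm_sin_squared exp_minus)
  also have "\<dots> \<le> (exp (2 * \<bar>Im z\<bar>) + exp (2 * \<bar>Im z\<bar>) + 2 * exp (2 * \<bar>Im z\<bar>)) / 4"
  proof -
    have "exp (2 * Im z) \<le> exp (2 * \<bar>Im z\<bar>)" "exp (-2 * Im z) \<le> exp (2 * \<bar>Im z\<bar>)" "1 \<le> exp (2 * \<bar>Im z\<bar>)"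
      by (auto simp only: exp_le_cancel_iff one_le_exp_iff)
    moreover have "- cos (2 * Re z) \<le> 1" using cos_ge_minus_one[of "2 * Re z"] by linarith
    ultimately show ?thesis by (intro divide_right_mono) linarith+
  qed
  finally show "norm (sin z)^2 \<le> (exp \<bar>Im z\<bar>)^2" by (simp add: exp_double[symmetric])
qed auto

text \<open>Away from the integers the sine attains its full exponential size. All is read off from
  4 |sin (pi z)|^2 = u + 1/u - 2 cos (2 pi Re z) with u = exp (2 pi |Im z|): either u or the cosine
  stays away from 1.\<close>

lemma norm_sin_pi_ge:
  assumes "\<delta> > 0" "y0 > 0"
  obtains c where "c > 0" "\<And>z. y0 \<le> \<bar>Im z\<bar> \<or> (\<forall>n::int. \<delta> \<le> \<bar>Re z - of_int n\<bar>) \<Longrightarrow>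
     c * exp (pi * \<bar>Im z\<bar>) \<le> norm (sin (of_real pi * z))"
proof -
  define d where "d = min \<delta> (1/2)"
  have d: "0 < d" "d \<le> 1/2" "d \<le> \<delta>" using assms by (auto simp: d_def)
  \<comment> \<open>This is sin^2 (pi d). A real part at distance at least d from the integers
    satisfies 2 cos (2 pi Re z) \<le> 2 - 4 \<eta>; the cap d \<le> 1/2 keeps 2 pi d in the range
    where the cosine decreases.\<close>
  define \<eta> where "\<eta> = (1 - cos (2 * pi * d)) / 2"
  have \<eta>: "0 < \<eta>" "\<eta> \<le> 1"
  proof -
    have "cos (2 * pi * d) < cos 0" using d by (intro cos_monotone_0_pi) auto
    thus "0 < \<eta>" by (simp add: \<eta>_def)
    show "\<eta> \<le> 1" using cos_ge_minus_one[of "2 * pi * d"] by (simp add: \<eta>_def)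
  qed
  define u0 where "u0 = exp (2 * pi * y0)"
  have u0: "u0 > 1" using assms by (simp add: u0_def)
  define c0 where "c0 = min (\<eta> / 2) ((1 - 1 / u0)^2)"
  have c0: "c0 > 0" using \<eta> u0 by (auto simp: c0_def)
  have "sqrt (c0 / 4) * exp (pi * \<bar>Im z\<bar>) \<le> norm (sin (of_real pi * z))"
    if z: "y0 \<le> \<bar>Im z\<bar> \<or> (\<forall>n::int. \<delta> \<le> \<bar>Re z - of_int n\<bar>)" for z
  proof -
    define u where "u = exp (2 * pi * \<bar>Im z\<bar>)"
    have u: "u \<ge> 1" by (simp add: u_def)
    have "4 * norm (sin (of_real pi * z))^2 = exp (2 * (pi * Im z)) + exp (-2 * (pi * Im z)) - 2 * cos (2 * (pi * Re z))"
      by (simp add: norm_sin_squared exp_minus)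
    also have "exp (2 * (pi * Im z)) + exp (-2 * (pi * Im z)) = u + 1 / u"
      by (cases "Im z \<ge> 0") (auto simp: u_def exp_minus field_simps)
    finally have n: "4 * norm (sin (of_real pi * z))^2 = u + 1 / u - 2 * cos (2 * (pi * Re z))" .
    have "c0 * u \<le> 4 * norm (sin (of_real pi * z))^2"
      using z
    proof
      assume "y0 \<le> \<bar>Im z\<bar>"
      hence "u0 \<le> u" unfolding u0_def u_def by simp
      hence "1 / u \<le> 1 / u0" using u0 by (intro divide_left_mono) auto
      hence "(1 - 1 / u0)^2 \<le> (1 - 1 / u)^2" using u0 u by (intro power_mono) (auto simp: field_simps)
      hence "c0 \<le> (1 - 1 / u)^2" by (simp add: c0_def)
      hence "c0 * u \<le> (1 - 1 / u)^2 * u" using u by (intro mult_right_mono) auto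
      also have "\<dots> = u + 1 / u - 2" using u by (simp add: power2_eq_square field_simps)
      also have "\<dots> \<le> u + 1 / u - 2 * cos (2 * (pi * Re z))" by simp
      finally show ?thesis by (simp add: n)
    next
      assume dist: "\<forall>n::int. \<delta> \<le> \<bar>Re z - of_int n\<bar>"
      define f where "f = Re z - of_int (round (Re z))"
      have f: "d \<le> \<bar>f\<bar>" "\<bar>f\<bar> \<le> 1/2"
        using dist d of_int_round_abs_le[of "Re z"] by (auto simp: f_def abs_minus_commute intro: order.trans)
      have "2 * (pi * Re z) = 2 * pi * f + of_int (round (Re z)) * (2 * pi)" by (simp add: f_def algebra_simps)
      hence "cos (2 * (pi * Re z)) = cos (2 * pi * f)" using cos.plus_of_int[of "2 * pi * f" "round (Re z)"] by simp
      also have "\<dots> = cos (2 * pi * \<bar>f\<bar>)" by (simp add: abs_if)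
      also have "\<dots> \<le> cos (2 * pi * d)" using f d by (intro cos_monotone_0_pi_le) auto
      finally have c: "2 * cos (2 * (pi * Re z)) \<le> 2 - 4 * \<eta>" by (simp add: \<eta>_def field_simps)
      have "c0 * u \<le> \<eta> / 2 * u" using u by (intro mult_right_mono) (auto simp: c0_def)
      also have "\<eta> / 2 * u \<le> u + 1 / u - 2 + 4 * \<eta>"
      \<comment> \<open>For u \<le> 4 the summand 4 \<eta> alone is large enough, as u + 1/u - 2 is
        nonnegative; for larger u the inequality u - 2 \<ge> u / 2 takes over.\<close>
      proof (cases "u \<le> 4")
        case True
        have "0 \<le> (u - 1)^2 / u" using u by auto
        hence "0 \<le> u + 1 / u - 2" using u by (simp add: power2_eq_square field_simps)
        moreover have "\<eta> / 2 * u \<le> \<eta> / 2 * 4" using True \<eta> by (intro mult_left_mono) auto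
        ultimately show ?thesis using \<eta> by linarith
      next
        case False
        have "\<eta> / 2 * u \<le> 1 / 2 * u" using \<eta> u by (intro mult_right_mono) auto
        moreover have "0 \<le> 1 / u" using u by auto
        ultimately show ?thesis using \<eta> False by linarith
      qed
      also have "\<dots> \<le> u + 1 / u - 2 * cos (2 * (pi * Re z))" using c by linarith
      finally show ?thesis by (simp add: n)
    qed
    hence "c0 / 4 * u \<le> norm (sin (of_real pi * z))^2" by simp
    hence "sqrt (c0 / 4 * u) \<le> norm (sin (of_real pi * z))" by (intro real_le_lsqrt) auto
    also have "u = (exp (pi * \<bar>Im z\<bar>))^2" by (simp add: u_def exp_double[symmetric] mult_ac)
    hence "sqrt (c0 / 4 * u) = sqrt (c0 / 4) * exp (pi * \<bar>Im z\<bar>)"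
      by (simp only: real_sqrt_mult real_sqrt_abs abs_exp_cancel)
    finally show ?thesis .
  qed
  thus ?thesis using that[of "sqrt (c0 / 4)"] c0 by simp
qed

text \<open>
  By the reflection formula \<open>1 / \<Gamma>(a s + b)\<close> is the quotient of the following two functions, the
  second of which is free of zeros and poles in a right half-plane for either sign of \<open>a\<close>.
\<close>

definition trig_part :: "real \<Rightarrow> real \<Rightarrow> complex \<Rightarrow> complex" where
  "trig_part a b s = (if a > 0 then 1 else sin (of_real pi * (of_real a * s + of_real b)) / of_real pi)"

definition regular_part :: "real \<Rightarrow> real \<Rightarrow> complex \<Rightarrow> complex" where
  "regular_part a b s = (if a > 0 then Gamma (of_real a * s + of_real b)
     else rGamma (1 - (of_real a * s + of_real b)))"

lemma rGamma_eq_trig_over_regular: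
  assumes "regular_part a b s \<noteq> 0"
  shows "rGamma (of_real a * s + of_real b) = trig_part a b s / regular_part a b s"
  using assms rGamma_reflection_complex[of "of_real a * s + of_real b"]
  by (auto simp: trig_part_def regular_part_def rGamma_inverse_Gamma field_simps split: if_splits)

lemma Gamma_eq_regular_over_trig:
  assumes "regular_part a b s \<noteq> 0"
  shows "Gamma (of_real a * s + of_real b) = regular_part a b s / trig_part a b s"
  using rGamma_eq_trig_over_regular[OF assms] by (simp add: Gamma_def)

text \<open>For negative a the regular part is the reciprocal of Gamma at an argument with slope -a.
  As \<open>gamma_size\<close> is odd in its first argument, both signs of a share one
  formula.\<close>

lemma regular_part_size:
  assumes "a \<noteq> 0"
  obtains K \<sigma> where "\<sigma> \<ge> 3" "K \<ge> 0"
    "\<And>s. Re s \<ge> \<sigma> \<Longrightarrow> regular_part a b s \<noteq> 0"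
    "\<And>s. Re s \<ge> \<sigma> \<Longrightarrow> \<bar>ln (norm (regular_part a b s)) - gamma_size a s\<bar> \<le> K * ln (norm s)"
proof (cases "a > 0")
  case True
  obtain K \<sigma> where K: "\<sigma> \<ge> 3" "K \<ge> 0"
    "\<And>s. Re s \<ge> \<sigma> \<Longrightarrow> a * Re s + b \<ge> 2"
    "\<And>s. Re s \<ge> \<sigma> \<Longrightarrow> \<bar>ln (norm (Gamma (of_real a * s + of_real b))) - gamma_size a s\<bar> \<le> K * ln (norm s)"
    by (rule Gamma_size[OF True, of b]; rule that; blast)
  have "Gamma (of_real a * s + of_real b) \<noteq> 0" if "Re s \<ge> \<sigma>" for s :: complex
    using K(3)[OF that] by (auto simp: Gamma_eq_zero_iff intro!: Re_pos_not_nonpos_Int)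
  thus ?thesis using K True by (intro that[of \<sigma> K]) (auto simp: regular_part_def)
next
  case False
  hence a: "-a > 0" using assms by simp
  obtain K \<sigma> where K: "\<sigma> \<ge> 3" "K \<ge> 0"
    "\<And>s. Re s \<ge> \<sigma> \<Longrightarrow> (-a) * Re s + (1 - b) \<ge> 2"
    "\<And>s. Re s \<ge> \<sigma> \<Longrightarrow> \<bar>ln (norm (Gamma (of_real (-a) * s + of_real (1 - b)))) - gamma_size (-a) s\<bar> \<le> K * ln (norm s)"
    by (rule Gamma_size[OF a, of "1 - b"]; rule that; blast)
  have reg: "regular_part a b s = inverse (Gamma (of_real (-a) * s + of_real (1 - b)))" for s
    using False by (simp add: regular_part_def rGamma_inverse_Gamma algebra_simps)
  have gs: "gamma_size a s = - gamma_size (-a) s" for s by (simp add: gamma_size_def)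
  have nz: "Gamma (of_real (-a) * s + of_real (1 - b)) \<noteq> 0" if "Re s \<ge> \<sigma>" for s :: complex
    using K(3)[OF that] unfolding Gamma_eq_zero_iff by (intro Re_pos_not_nonpos_Int) simp
  show ?thesis
  proof (rule that[OF K(1,2)])
    fix s assume s: "Re s \<ge> \<sigma>"
    show "regular_part a b s \<noteq> 0" using nz[OF s] by (simp add: reg)
    have "ln (norm (regular_part a b s)) = - ln (norm (Gamma (of_real (-a) * s + of_real (1 - b))))"
      unfolding reg using nz[OF s] by (simp add: norm_inverse ln_inverse)
    thus "\<bar>ln (norm (regular_part a b s)) - gamma_size a s\<bar> \<le> K * ln (norm s)"
      using K(4)[OF s] unfolding gs by linarith
  qed
qed

text \<open>The number (|a| - a) / 2 is the negative part of a: what is subtracted is the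
  exponential size of the sine in \<open>trig_part\<close>, which occurs for negative a
  only.\<close>

definition affine_size :: "real \<Rightarrow> complex \<Rightarrow> real" where
  "affine_size a s = gamma_size a s - pi * ((\<bar>a\<bar> - a) / 2) * \<bar>Im s\<bar>"

text \<open>For negative a Gamma has the sine in its denominator, so a lower bound for the sine
  enters; this is the source of the condition on s. The reciprocal in
  \<open>rGamma_affine_far_le\<close> rests on the upper bound \<open>norm_sin_le\<close>, which
  holds everywhere.\<close>

lemma Gamma_affine_far_le:
  fixes \<delta> :: real
  assumes a: "a \<noteq> 0" and \<delta>: "\<delta> > 0"
  obtains K \<sigma> where "\<sigma> \<ge> 3" "K \<ge> 0"
    "\<And>s. Re s \<ge> \<sigma> \<Longrightarrow> 1 \<le> \<bar>Im s\<bar> \<or> (\<forall>n::int. \<delta> \<le> \<bar>a * Re s + b - of_int n\<bar>) \<Longrightarrow>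
       norm (Gamma (of_real a * s + of_real b)) \<le> exp (affine_size a s + K * ln (norm s))"
proof -
  obtain K \<sigma> where K: "\<sigma> \<ge> 3" "K \<ge> 0"
    "\<And>s. Re s \<ge> \<sigma> \<Longrightarrow> regular_part a b s \<noteq> 0"
    "\<And>s. Re s \<ge> \<sigma> \<Longrightarrow> \<bar>ln (norm (regular_part a b s)) - gamma_size a s\<bar> \<le> K * ln (norm s)"
    by (rule regular_part_size[OF a, of b]; rule that; blast)
  obtain c where c: "c > 0" "\<And>z. \<bar>a\<bar> \<le> \<bar>Im z\<bar> \<or> (\<forall>n::int. \<delta> \<le> \<bar>Re z - of_int n\<bar>) \<Longrightarrow>
     c * exp (pi * \<bar>Im z\<bar>) \<le> norm (sin (of_real pi * z))"
    using norm_sin_pi_ge[of \<delta> "\<bar>a\<bar>"] a \<delta> by auto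
  \<comment> \<open>The value c / pi serves negative a, the value 1 positive a, where
    \<open>trig_part\<close> is constantly 1.\<close>
  define c' where "c' = min 1 (c / pi)"
  have c': "c' > 0" "c' \<le> 1" "c' \<le> c / pi" using c by (auto simp: c'_def)
  show ?thesis
  proof (rule that[of \<sigma> "K + \<bar>ln c'\<bar>"])
    fix s assume s: "Re s \<ge> \<sigma>" and good: "1 \<le> \<bar>Im s\<bar> \<or> (\<forall>n::int. \<delta> \<le> \<bar>a * Re s + b - of_int n\<bar>)"
    have trig: "norm (trig_part a b s) \<ge> c' * exp (pi * ((\<bar>a\<bar> - a) / 2) * \<bar>Im s\<bar>)"
    proof (cases "a > 0")
      case False
      have "\<bar>a\<bar> * 1 \<le> \<bar>a\<bar> * \<bar>Im s\<bar>" if "1 \<le> \<bar>Im s\<bar>" using that by (intro mult_left_mono) auto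
      hence "c * exp (pi * \<bar>Im (of_real a * s + of_real b)\<bar>) \<le> norm (sin (of_real pi * (of_real a * s + of_real b)))"
        using good by (intro c(2)) (auto simp: abs_mult)
      moreover have "(\<bar>a\<bar> - a) / 2 = \<bar>a\<bar>" using False by simp
      ultimately have "c / pi * exp (pi * ((\<bar>a\<bar> - a) / 2) * \<bar>Im s\<bar>) \<le> norm (trig_part a b s)"
        using False by (simp add: trig_part_def norm_divide abs_mult field_simps)
      moreover have "c' * exp (pi * ((\<bar>a\<bar> - a) / 2) * \<bar>Im s\<bar>) \<le> c / pi * exp (pi * ((\<bar>a\<bar> - a) / 2) * \<bar>Im s\<bar>)"
        using c'(3) by (intro mult_right_mono) auto
      ultimately show ?thesis by linarith
    qed (use c' in \<open>auto simp: trig_part_def\<close>)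
    have nz: "regular_part a b s \<noteq> 0" by (rule K(3)[OF s])
    have l1: "ln (norm s) \<ge> 1" using norm_Ln_le_ln(2)[of s] s K(1) by simp
    have "norm (regular_part a b s) = exp (ln (norm (regular_part a b s)))" using nz by simp
    also have "\<dots> \<le> exp (gamma_size a s + K * ln (norm s))" using K(4)[OF s] by simp
    finally have reg: "norm (regular_part a b s) \<le> exp (gamma_size a s + K * ln (norm s))" .
    have "norm (Gamma (of_real a * s + of_real b)) = norm (regular_part a b s) / norm (trig_part a b s)"
      unfolding Gamma_eq_regular_over_trig[OF nz] by (rule norm_divide)
    also have "\<dots> \<le> exp (gamma_size a s + K * ln (norm s)) / (c' * exp (pi * ((\<bar>a\<bar> - a) / 2) * \<bar>Im s\<bar>))"
      using reg trig c' by (intro frac_le) auto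
    also have "\<dots> = exp (gamma_size a s + K * ln (norm s)) / exp (ln c' + pi * ((\<bar>a\<bar> - a) / 2) * \<bar>Im s\<bar>)"
      using c' by (simp add: exp_add)
    also have "\<dots> = exp (gamma_size a s - pi * ((\<bar>a\<bar> - a) / 2) * \<bar>Im s\<bar> + K * ln (norm s) - ln c')"
      unfolding exp_diff[symmetric] by (simp add: algebra_simps)
    finally have le: "norm (Gamma (of_real a * s + of_real b)) \<le> \<dots>" .
    have "- ln c' \<le> \<bar>ln c'\<bar> * ln (norm s)"
      using mult_left_mono[OF l1, of "\<bar>ln c'\<bar>"] by linarith
    moreover have "(K + \<bar>ln c'\<bar>) * ln (norm s) = K * ln (norm s) + \<bar>ln c'\<bar> * ln (norm s)"
      by (simp add: algebra_simps)
    ultimately have "gamma_size a s - pi * ((\<bar>a\<bar> - a) / 2) * \<bar>Im s\<bar> + K * ln (norm s) - ln c' \<le>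
      gamma_size a s - pi * ((\<bar>a\<bar> - a) / 2) * \<bar>Im s\<bar> + (K + \<bar>ln c'\<bar>) * ln (norm s)"
      by linarith
    with le show "norm (Gamma (of_real a * s + of_real b)) \<le> exp (affine_size a s + (K + \<bar>ln c'\<bar>) * ln (norm s))"
      unfolding affine_size_def by (meson exp_le_cancel_iff order.trans)
  qed (use K in auto)
qed

lemma rGamma_affine_far_le:
  assumes a: "a \<noteq> 0"
  obtains K \<sigma> where "\<sigma> \<ge> 3" "K \<ge> 0"
    "\<And>s. Re s \<ge> \<sigma> \<Longrightarrow>
       norm (rGamma (of_real a * s + of_real b)) \<le> exp (- affine_size a s + K * ln (norm s))"
proof -
  obtain K \<sigma> where K: "\<sigma> \<ge> 3" "K \<ge> 0"
    "\<And>s. Re s \<ge> \<sigma> \<Longrightarrow> regular_part a b s \<noteq> 0"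
    "\<And>s. Re s \<ge> \<sigma> \<Longrightarrow> \<bar>ln (norm (regular_part a b s)) - gamma_size a s\<bar> \<le> K * ln (norm s)"
    by (rule regular_part_size[OF a, of b]; rule that; blast)
  show ?thesis
  proof (rule that[OF K(1,2)])
    fix s assume s: "Re s \<ge> \<sigma>"
    have trig: "norm (trig_part a b s) \<le> exp (pi * ((\<bar>a\<bar> - a) / 2) * \<bar>Im s\<bar>)"
    proof (cases "a > 0")
      case False
      have "norm (trig_part a b s) \<le> norm (sin (of_real pi * (of_real a * s + of_real b)))"
        using False pi_ge_two divide_left_mono[of 1 pi "norm (sin (of_real pi * (of_real a * s + of_real b)))"]
        by (simp add: trig_part_def norm_divide)
      also have "\<dots> \<le> exp \<bar>Im (of_real pi * (of_real a * s + of_real b))\<bar>" by (rule norm_sin_le)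
      also have "\<bar>Im (of_real pi * (of_real a * s + of_real b))\<bar> = pi * ((\<bar>a\<bar> - a) / 2) * \<bar>Im s\<bar>"
        using False by (simp add: abs_mult)
      finally show ?thesis .
    qed (auto simp: trig_part_def)
    have nz: "regular_part a b s \<noteq> 0" by (rule K(3)[OF s])
    have "exp (gamma_size a s - K * ln (norm s)) \<le> exp (ln (norm (regular_part a b s)))" using K(4)[OF s] by simp
    hence reg: "exp (gamma_size a s - K * ln (norm s)) \<le> norm (regular_part a b s)" using nz by simp
    have "norm (rGamma (of_real a * s + of_real b)) = norm (trig_part a b s) / norm (regular_part a b s)"
      unfolding rGamma_eq_trig_over_regular[OF nz] by (rule norm_divide)
    also have "\<dots> \<le> exp (pi * ((\<bar>a\<bar> - a) / 2) * \<bar>Im s\<bar>) / exp (gamma_size a s - K * ln (norm s))"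
      using reg trig by (intro frac_le) auto
    also have "\<dots> = exp (- affine_size a s + K * ln (norm s))"
      unfolding exp_diff[symmetric] by (simp add: affine_size_def algebra_simps)
    finally show "norm (rGamma (of_real a * s + of_real b)) \<le> exp (- affine_size a s + K * ln (norm s))" .
  qed
qed

section \<open>Decay of Gamma in vertical strips\<close>

lemma Gamma_strip_right:
  assumes "M \<ge> 2"
  obtains K where "K \<ge> 0"
    "\<And>z. 2 \<le> Re z \<Longrightarrow> Re z \<le> M \<Longrightarrow> \<bar>ln (norm (Gamma z)) + pi / 2 * \<bar>Im z\<bar>\<bar> \<le> K * ln (3 + \<bar>Im z\<bar>)"
proof -
  obtain c :: complex where c: "c \<noteq> 0"
    "\<And>z. Re z \<ge> 2 \<Longrightarrow> \<exists>E. norm E \<le> 22 / Re z \<and> Gamma z = c * exp ((z - 1/2) * Ln z - z + E)"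
    using Gamma_stirling by blast
  define K where "K = \<bar>ln (norm c)\<bar> + 11 + M * (1 + ln M) + 2 * M"
  have lnM: "ln M \<ge> 0" using assms by simp
  have "\<bar>ln (norm (Gamma z)) + pi / 2 * \<bar>Im z\<bar>\<bar> \<le> K * ln (3 + \<bar>Im z\<bar>)" if z: "2 \<le> Re z" "Re z \<le> M" for z
  proof -
    define x t where "x = Re z" and "t = Im z"
    have z0: "z \<noteq> 0" using z by auto
    obtain E where E: "norm E \<le> 22 / Re z" "Gamma z = c * exp ((z - 1/2) * Ln z - z + E)"
      using c(2)[OF z(1)] by blast
    have "22 / Re z \<le> 11" using z by (simp add: field_simps)
    hence E11: "\<bar>Re E\<bar> \<le> 11" using E abs_Re_le_cmod[of E] by linarith
    define T where "T = 3 + \<bar>t\<bar>"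
    have lT: "ln T \<ge> 1" by (rule ln_ge_1) (simp add: T_def)
    have "Re ((z - 1/2) * Ln z) = (x - 1/2) * ln (norm z) - t * Arg z"
      using z0 by (simp add: x_def t_def Arg_def)
    hence ln: "ln (norm (Gamma z)) = ln (norm c) + (x - 1/2) * ln (norm z) - t * Arg z - x + Re E"
      unfolding E(2) using c(1) by (simp add: norm_mult ln_mult x_def)
    \<comment> \<open>The exponential decay sits in the term t Arg z. Its deviation from pi |t| / 2
      is |t| arctan (x / |t|), which lies between 0 and x and is therefore bounded in the
      strip.\<close>
    have arg: "\<bar>t * Arg z - pi / 2 * \<bar>t\<bar>\<bar> \<le> x"
    proof (cases "t = 0")
      case False
      have "Arg z = arctan (t / x)" using z by (subst arg_conv_arctan) (auto simp: x_def t_def)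
      hence "t * Arg z = \<bar>t\<bar> * arctan (\<bar>t\<bar> / x)" using z by (cases "t \<ge> 0") (auto simp: arctan_minus)
      also have "arctan (\<bar>t\<bar> / x) = pi / 2 - arctan (x / \<bar>t\<bar>)"
        using arctan_inverse[of "x / \<bar>t\<bar>"] z False by (simp add: x_def)
      finally have eq: "t * Arg z - pi / 2 * \<bar>t\<bar> = - (\<bar>t\<bar> * arctan (x / \<bar>t\<bar>))" by (simp add: algebra_simps)
      have "0 \<le> \<bar>t\<bar> * arctan (x / \<bar>t\<bar>)" using z by (simp add: x_def)
      moreover have "\<bar>t\<bar> * arctan (x / \<bar>t\<bar>) \<le> \<bar>t\<bar> * (x / \<bar>t\<bar>)"
        using z by (intro mult_left_mono arctan_le_self) (auto simp: x_def)
      ultimately show ?thesis unfolding eq using False by simp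
    qed (use z in \<open>auto simp: x_def\<close>)
    have nz: "1 \<le> norm z" "norm z \<le> M * T"
    proof -
      show "1 \<le> norm z" using complex_Re_le_cmod[of z] z by linarith
      have "norm z \<le> \<bar>x\<bar> + \<bar>t\<bar>" unfolding x_def t_def by (rule cmod_le)
      also have "\<dots> \<le> M * 1 + M * \<bar>t\<bar>" using z assms mult_right_mono[of 1 M "\<bar>t\<bar>"] by (auto simp: x_def)
      also have "\<dots> \<le> M * T" using assms by (simp add: T_def algebra_simps)
      finally show "norm z \<le> M * T" .
    qed
    have "ln (norm z) \<le> ln (M * T)" using nz by (intro ln_mono) auto
    hence lz: "0 \<le> ln (norm z)" "ln (norm z) \<le> ln M + ln T"
      using nz assms by (auto simp: ln_mult_pos T_def)
    have "(x - 1/2) * ln (norm z) \<le> M * (ln M + ln T)" using z lz by (intro mult_mono) (auto simp: x_def)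
    moreover have "0 \<le> (x - 1/2) * ln (norm z)" using z lz by (intro mult_nonneg_nonneg) (auto simp: x_def)
    ultimately have "\<bar>ln (norm (Gamma z)) + pi / 2 * \<bar>t\<bar>\<bar> \<le> \<bar>ln (norm c)\<bar> + M * (ln M + ln T) + 2 * M + 11"
      using arg E11 z unfolding ln x_def by linarith
    also have "M * (ln M + ln T) \<le> M * (1 + ln M) * ln T"
      using mult_left_mono[OF lT, of "M * ln M"] assms lnM by (simp add: algebra_simps)
    also have "\<bar>ln (norm c)\<bar> + M * (1 + ln M) * ln T + 2 * M + 11 \<le> K * ln T"
      using mult_left_mono[OF lT, of "\<bar>ln (norm c)\<bar> + 2 * M + 11"] assms by (simp add: K_def algebra_simps)
    finally show ?thesis by (simp add: t_def T_def)
  qed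
  moreover have "K \<ge> 0" using assms lnM by (simp add: K_def)
  ultimately show ?thesis using that by blast
qed

lemma abs_ln_norm_le:
  assumes "y0 > 0" "M \<ge> 1" "y0 \<le> norm z" "norm z \<le> M * T" "ln T \<ge> 1" "T > 0"
  shows "\<bar>ln (norm z)\<bar> \<le> (\<bar>ln y0\<bar> + ln M + 1) * ln T"
proof -
  have "ln y0 \<le> ln (norm z)" using assms by (subst ln_le_cancel_iff) auto
  moreover have "ln (norm z) \<le> ln (M * T)" using assms by (subst ln_le_cancel_iff) auto
  moreover have "ln (M * T) = ln M + ln T" using assms by (simp add: ln_mult)
  moreover have "\<bar>ln y0\<bar> + ln M \<le> (\<bar>ln y0\<bar> + ln M) * ln T"
    using mult_left_mono[OF assms(5), of "\<bar>ln y0\<bar> + ln M"] assms by simp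
  moreover have "ln M \<ge> 0" using assms by simp
  moreover have "(\<bar>ln y0\<bar> + ln M + 1) * ln T = (\<bar>ln y0\<bar> + ln M) * ln T + ln T" by (simp add: algebra_simps)
  ultimately show ?thesis using assms(5) by linarith
qed

text \<open>A shift by n moves the strip into the region of \<open>Gamma_strip_right\<close>. The n
  factors z + k of the recurrence stay away from 0 by y0 and grow at most linearly in the imaginary
  part, so each costs one logarithmic term.\<close>

lemma Gamma_strip:
  assumes M: "M \<ge> 2" and y0: "y0 > 0"
  obtains K where "K \<ge> 0"
    "\<And>z. \<bar>Re z\<bar> \<le> M \<Longrightarrow> y0 \<le> \<bar>Im z\<bar> \<Longrightarrow> 
       Gamma z \<noteq> 0 \<and> \<bar>ln (norm (Gamma z)) + pi / 2 * \<bar>Im z\<bar>\<bar> \<le> K * ln (3 + \<bar>Im z\<bar>)"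
proof -
  define n where "n = nat \<lceil>M + 2\<rceil>"
  have n: "real n \<ge> M + 2" unfolding n_def by (rule real_nat_ceiling_ge)
  obtain K where K: "K \<ge> 0"
    "\<And>z. 2 \<le> Re z \<Longrightarrow> Re z \<le> M + real n \<Longrightarrow> \<bar>ln (norm (Gamma z)) + pi / 2 * \<bar>Im z\<bar>\<bar> \<le> K * ln (3 + \<bar>Im z\<bar>)"
    using Gamma_strip_right[of "M + real n"] M by auto
  define K1 where "K1 = \<bar>ln y0\<bar> + ln (M + real n) + 1"
  have K1: "K1 \<ge> 0" using M by (simp add: K1_def)
  have "Gamma z \<noteq> 0 \<and> \<bar>ln (norm (Gamma z)) + pi / 2 * \<bar>Im z\<bar>\<bar> \<le> (K + real n * K1) * ln (3 + \<bar>Im z\<bar>)"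
    if z: "\<bar>Re z\<bar> \<le> M" "y0 \<le> \<bar>Im z\<bar>" for z
  proof -
    define T where "T = 3 + \<bar>Im z\<bar>"
    have lT: "ln T \<ge> 1" by (rule ln_ge_1) (simp add: T_def)
    have ni: "z \<notin> \<int>\<^sub>\<le>\<^sub>0" using z y0 by (auto elim!: nonpos_Ints_cases)
    hence nz: "Gamma z \<noteq> 0" by (simp add: Gamma_eq_zero_iff)
    have ni': "z + of_nat n \<notin> \<int>\<^sub>\<le>\<^sub>0" using z n by (intro Re_pos_not_nonpos_Int) auto
    have zk: "z + of_nat k \<noteq> 0" for k using z y0 by (auto simp: complex_eq_iff)
    have ln1: "\<bar>ln (norm (z + of_nat k))\<bar> \<le> K1 * ln T" if k: "k < n" for k
      unfolding K1_def
    proof (rule abs_ln_norm_le)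
      show "y0 \<le> norm (z + of_nat k)" using z abs_Im_le_cmod[of "z + of_nat k"] by simp
      have "norm (z + of_nat k) \<le> \<bar>Re z + real k\<bar> + \<bar>Im z\<bar>" using cmod_le[of "z + of_nat k"] by simp
      also have "\<dots> \<le> (M + real n) * 1 + (M + real n) * \<bar>Im z\<bar>"
        using z k M mult_right_mono[of 1 "M + real n" "\<bar>Im z\<bar>"] by auto
      also have "\<dots> \<le> (M + real n) * T" using M by (simp add: T_def algebra_simps)
      finally show "norm (z + of_nat k) \<le> (M + real n) * T" .
    qed (use M y0 lT in \<open>auto simp: T_def\<close>)
    have "Gamma (z + of_nat n) = pochhammer z n * Gamma z" using pochhammer_Gamma[OF ni, of n] nz by simp
    hence "ln (norm (Gamma (z + of_nat n))) = ln (norm (pochhammer z n)) + ln (norm (Gamma z))"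
      using nz zk by (simp add: norm_mult ln_mult pochhammer_prod)
    also have "ln (norm (pochhammer z n)) = (\<Sum>k<n. ln (norm (z + of_nat k)))"
      using zk by (simp add: pochhammer_prod atLeast0LessThan prod_norm[symmetric] ln_prod)
    finally have "\<bar>ln (norm (Gamma z)) - ln (norm (Gamma (z + of_nat n)))\<bar> = \<bar>\<Sum>k<n. ln (norm (z + of_nat k))\<bar>"
      by simp
    also have "\<dots> \<le> (\<Sum>k<n. K1 * ln T)" by (rule order.trans[OF sum_abs sum_mono]) (use ln1 in auto)
    finally have "\<bar>ln (norm (Gamma z)) - ln (norm (Gamma (z + of_nat n)))\<bar> \<le> real n * K1 * ln T" by (simp add: mult_ac)
    moreover have "\<bar>ln (norm (Gamma (z + of_nat n))) + pi / 2 * \<bar>Im z\<bar>\<bar> \<le> K * ln T"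
      using K(2)[of "z + of_nat n"] z n by (simp add: T_def)
    ultimately show ?thesis using nz by (simp add: T_def algebra_simps)
  qed
  thus ?thesis using that[of "K + real n * K1"] K(1) K1 by auto
qed

lemma Gamma_affine_strip:
  assumes a: "a \<noteq> 0"
  obtains K where "K \<ge> 0"
    "\<And>s. \<bar>Re s\<bar> \<le> M \<Longrightarrow> 1 \<le> \<bar>Im s\<bar> \<Longrightarrow>
       norm (Gamma (of_real a * s + of_real b)) \<le> exp (- (pi / 2 * \<bar>a\<bar> * \<bar>Im s\<bar>) + K * ln (3 + \<bar>Im s\<bar>))"
    "\<And>s. \<bar>Re s\<bar> \<le> M \<Longrightarrow> 1 \<le> \<bar>Im s\<bar> \<Longrightarrow>
       norm (rGamma (of_real a * s + of_real b)) \<le> exp (pi / 2 * \<bar>a\<bar> * \<bar>Im s\<bar> + K * ln (3 + \<bar>Im s\<bar>))"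
proof -
  define M' where "M' = max 2 (\<bar>a\<bar> * M + \<bar>b\<bar>)"
  obtain K where K: "K \<ge> 0"
    "\<And>z. \<bar>Re z\<bar> \<le> M' \<Longrightarrow> \<bar>a\<bar> \<le> \<bar>Im z\<bar> \<Longrightarrow> 
       Gamma z \<noteq> 0 \<and> \<bar>ln (norm (Gamma z)) + pi / 2 * \<bar>Im z\<bar>\<bar> \<le> K * ln (3 + \<bar>Im z\<bar>)"
    using Gamma_strip[of M' "\<bar>a\<bar>"] a by (auto simp: M'_def)
  define A where "A = 1 + \<bar>a\<bar>"
  define K2 where "K2 = K * (ln A + 1)"
  have lA: "ln A \<ge> 0" by (simp add: A_def)
  have *: "Gamma z \<noteq> 0 \<and> \<bar>ln (norm (Gamma z)) + pi / 2 * \<bar>a\<bar> * \<bar>Im s\<bar>\<bar> \<le> K2 * ln (3 + \<bar>Im s\<bar>)"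
    if s: "\<bar>Re s\<bar> \<le> M" "1 \<le> \<bar>Im s\<bar>" and z: "z = of_real a * s + of_real b" for s z
  proof -
    have Imz: "\<bar>Im z\<bar> = \<bar>a\<bar> * \<bar>Im s\<bar>" by (simp add: z abs_mult)
    have "\<bar>Re z\<bar> \<le> \<bar>a\<bar> * \<bar>Re s\<bar> + \<bar>b\<bar>" unfolding z using abs_triangle_ineq[of "a * Re s" b] by (simp add: abs_mult)
    also have "\<dots> \<le> \<bar>a\<bar> * M + \<bar>b\<bar>" using s by (intro add_mono mult_left_mono) auto
    finally have "\<bar>Re z\<bar> \<le> M'" by (simp add: M'_def)
    moreover have "\<bar>a\<bar> \<le> \<bar>Im z\<bar>" unfolding Imz using mult_left_mono[OF s(2), of "\<bar>a\<bar>"] by simp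
    ultimately have k: "Gamma z \<noteq> 0 \<and> \<bar>ln (norm (Gamma z)) + pi / 2 * \<bar>Im z\<bar>\<bar> \<le> K * ln (3 + \<bar>Im z\<bar>)" by (rule K(2))
    have lT: "ln (3 + \<bar>Im s\<bar>) \<ge> 1" by (rule ln_ge_1) simp
    have "3 + \<bar>Im z\<bar> \<le> A * (3 + \<bar>Im s\<bar>)" unfolding Imz A_def by (simp add: algebra_simps)
    moreover have "0 < 3 + \<bar>Im z\<bar>" by simp
    ultimately have "ln (3 + \<bar>Im z\<bar>) \<le> ln (A * (3 + \<bar>Im s\<bar>))" by (intro ln_mono) auto
    also have "\<dots> = ln A + ln (3 + \<bar>Im s\<bar>)" by (intro ln_mult_pos) (auto simp: A_def)
    also have "\<dots> \<le> (ln A + 1) * ln (3 + \<bar>Im s\<bar>)" using mult_left_mono[OF lT lA] by (simp add: algebra_simps)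
    finally have "K * ln (3 + \<bar>Im z\<bar>) \<le> K2 * ln (3 + \<bar>Im s\<bar>)"
      unfolding K2_def mult.assoc using K(1) by (intro mult_left_mono)
    moreover have "pi / 2 * \<bar>Im z\<bar> = pi / 2 * \<bar>a\<bar> * \<bar>Im s\<bar>" by (simp add: Imz)
    ultimately show ?thesis using k by linarith
  qed
  show ?thesis
  proof (rule that[of K2])
    show "K2 \<ge> 0" using K(1) lA by (simp add: K2_def)
    fix s assume s: "\<bar>Re s\<bar> \<le> M" "1 \<le> \<bar>Im s\<bar>"
    define z where "z = of_real a * s + of_real b"
    have nz: "norm (Gamma z) = exp (ln (norm (Gamma z)))" using *[OF s z_def] by simp
    show "norm (Gamma z) \<le> exp (- (pi / 2 * \<bar>a\<bar> * \<bar>Im s\<bar>) + K2 * ln (3 + \<bar>Im s\<bar>))"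
      by (subst nz, subst exp_le_cancel_iff) (use *[OF s z_def] in linarith)
    have "norm (rGamma z) = exp (- ln (norm (Gamma z)))"
      using nz by (simp add: rGamma_inverse_Gamma norm_inverse exp_minus)
    also have "\<dots> \<le> exp (pi / 2 * \<bar>a\<bar> * \<bar>Im s\<bar> + K2 * ln (3 + \<bar>Im s\<bar>))"
      by (subst exp_le_cancel_iff) (use *[OF s z_def] in linarith)
    finally show "norm (rGamma z) \<le> exp (pi / 2 * \<bar>a\<bar> * \<bar>Im s\<bar> + K2 * ln (3 + \<bar>Im s\<bar>))" .
  qed
qed

section \<open>Moments and inversion\<close>

lemma measure_density_Ioc:
  fixes f :: "real \<Rightarrow> real"
  assumes f: "f \<in> borel_measurable borel" "\<And>x. 0 \<le> f x" "continuous_on {a..b} f" and ab: "a \<le> b"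
  shows "measure (density lborel (\<lambda>x. ennreal (f x))) {a<..b} = integral {a..b} f"
proof -
  have int: "set_integrable lborel {a..b} f" using f(3) by (rule borel_integrable_atLeastAtMost')
  have "emeasure (density lborel (\<lambda>x. ennreal (f x))) {a<..b} = (\<integral>\<^sup>+x. ennreal (f x) * indicator {a<..b} x \<partial>lborel)"
    using f(1) by (intro emeasure_density) auto
  also have "\<dots> = (\<integral>\<^sup>+x. ennreal (indicator {a..b} x *\<^sub>R f x) \<partial>lborel)"
    using AE_lborel_singleton[of a] by (intro nn_integral_cong_AE) (auto simp: indicator_def)
  also have "\<dots> = ennreal (\<integral>x. indicator {a..b} x *\<^sub>R f x \<partial>lborel)"
    using int f(2) by (intro nn_integral_eq_integral) (auto simp: set_integrable_def)
  also have "(\<integral>x. indicator {a..b} x *\<^sub>R f x \<partial>lborel) = integral {a..b} f"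
    using set_borel_integral_eq_integral(2)[OF int] by (simp add: set_lebesgue_integral_def)
  finally show ?thesis
    using f(2) ab by (simp add: measure_def integral_nonneg[OF set_borel_integral_eq_integral(1)[OF int]])
qed

lemma tendsto_average_right:
  fixes f :: "real \<Rightarrow> real"
  assumes "continuous_on {b..b+1} f"
  shows "(\<lambda>n. integral {b..b + 1 / real (Suc n)} f * real (Suc n)) \<longlonglongrightarrow> f b"
proof -
  have "((\<lambda>x. integral {b..x} f) has_real_derivative f b) (at b within {b..b+1})"
    using assms by (intro integral_has_real_derivative) auto
  hence *: "((\<lambda>y. (integral {b..y} f - integral {b..b} f) / (y - b)) \<longlongrightarrow> f b) (at b within {b..b+1})"
    by (simp add: has_field_derivative_iff)
  have "(\<lambda>n. 1 / real (Suc n)) \<longlonglongrightarrow> 0" by (rule LIMSEQ_Suc[OF lim_1_over_n])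
  hence "(\<lambda>n. b + 1 / real (Suc n)) \<longlonglongrightarrow> b + 0" by (intro tendsto_intros)
  hence "filterlim (\<lambda>n. b + 1 / real (Suc n)) (at b within {b..b+1}) sequentially"
    unfolding filterlim_at by (auto intro!: always_eventually simp: field_simps)
  from filterlim_compose[OF * this] show ?thesis by simp
qed

lemma tendsto_interval_integral_UNIV:
  fixes f :: "real \<Rightarrow> complex"
  assumes "integrable lborel f"
  shows "(\<lambda>n::nat. CLBINT t=-real n..real n. f t) \<longlonglongrightarrow> (CLBINT t. f t)"
proof -
  have "(\<lambda>n. \<integral>t. indicator {-real n..real n} t *\<^sub>R f t \<partial>lborel) \<longlonglongrightarrow> (CLBINT t. f t)"
  proof (rule integral_dominated_convergence[where w = "\<lambda>t. norm (f t)"])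
    show "AE x in lborel. (\<lambda>n. indicator {- real n..real n} x *\<^sub>R f x) \<longlonglongrightarrow> f x"
    proof (intro AE_I2)
      fix x :: real
      have "eventually (\<lambda>n. indicator {- real n..real n} x *\<^sub>R f x = f x) sequentially"
        using eventually_ge_at_top[of "nat \<lceil>\<bar>x\<bar>\<rceil>"] by eventually_elim (auto simp: indicator_def; linarith)
      thus "(\<lambda>n. indicator {- real n..real n} x *\<^sub>R f x) \<longlonglongrightarrow> f x" by (rule tendsto_eventually)
    qed
  qed (use assms in \<open>auto simp: indicator_def\<close>)
  thus ?thesis by (simp add: interval_integral_Icc set_lebesgue_integral_def)
qed

text \<open>Levy's formula describes the mass of (b, b + h]. After division by h the kernel
  \<open>Q\<close> is bounded by 1 and converges to exp (-i t b), so integrability of the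
  characteristic function permits dominated convergence, while the mass divided by h tends to
  \<open>g b\<close> by continuity.\<close>

lemma (in real_distribution) density_inversion:
  assumes M: "M = density lborel (\<lambda>x. ennreal (g x))"
    and g: "g \<in> borel_measurable borel" "\<And>x. 0 \<le> g x" "continuous_on UNIV g"
    and int: "integrable lborel (char M)"
  shows "of_real (g b) = 1 / (2 * pi) * (CLBINT t. iexp (-(t * b)) * char M t)"
proof -
  have null: "measure M {x} = 0" for x
    using g(1) by (simp add: M measure_def emeasure_density)
  define h where "h n = 1 / real (Suc n)" for n
  have h: "h n > 0" for n by (simp add: h_def)
  have h0: "h \<longlonglongrightarrow> 0" unfolding h_def by (rule LIMSEQ_Suc[OF lim_1_over_n])
  define Q where "Q n t = (iexp (-(t * b)) - iexp (-(t * (b + h n)))) / (\<i> * t)" for n and t :: real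
  \<comment> \<open>At t = 0 the kernel is 0 / 0 = 0, which respects the bound; elsewhere it is
    Levy's estimate applied to -t.\<close>
  have Qb: "norm (Q n t) \<le> h n" for n t
  proof (cases "t = 0")
    case False
    have "Q n t = (iexp ((-t) * (b + h n)) - iexp ((-t) * b)) / (\<i> * of_real (-t))"
      unfolding Q_def by (simp add: divide_simps)
    thus ?thesis using Levy_Inversion_aux2[of b "b + h n" "-t"] False h[of n] by (simp del: of_real_minus)
  qed (use h[of n] in \<open>auto simp: Q_def\<close>)
  have Qm: "Q n \<in> borel_measurable borel" for n unfolding Q_def by measurable
  have cm: "char M \<in> borel_measurable borel" using int by simp
  have Qi: "integrable lborel (\<lambda>t. Q n t * char M t)" for n
  proof (rule Bochner_Integration.integrable_bound)
    show "integrable lborel (\<lambda>t. h n * norm (char M t))" using int by auto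
    show "(\<lambda>t. Q n t * char M t) \<in> borel_measurable lborel" using Qm[of n] cm by simp
  qed (use h[of n] in \<open>auto simp: norm_mult intro!: mult_right_mono Qb\<close>)
  have eq: "of_real (measure M {b<..b + h n}) = 1 / (2 * pi) * (CLBINT t. Q n t * char M t)" for n
  proof -
    have "(\<lambda>T. 1 / (2 * pi) * (CLBINT t=-real T..real T. Q n t * char M t)) \<longlonglongrightarrow> of_real (measure M {b<..b + h n})"
      using Levy_Inversion[of b "b + h n"] null h[of n] unfolding Q_def by simp
    moreover have "(\<lambda>T. 1 / (2 * pi) * (CLBINT t=-real T..real T. Q n t * char M t)) \<longlonglongrightarrow> 1 / (2 * pi) * (CLBINT t. Q n t * char M t)"
      by (intro tendsto_intros tendsto_interval_integral_UNIV Qi)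
    ultimately show ?thesis by (rule LIMSEQ_unique)
  qed
  have "(\<lambda>n. CLBINT t. (Q n t * real (Suc n)) * char M t) \<longlonglongrightarrow> (CLBINT t. iexp (-(t * b)) * char M t)"
  proof (rule integral_dominated_convergence[where w = "\<lambda>t. norm (char M t)"])
    show "AE t in lborel. (\<lambda>n. (Q n t * real (Suc n)) * char M t) \<longlonglongrightarrow> iexp (-(t * b)) * char M t"
      using AE_lborel_singleton[of "0::real"]
    proof eventually_elim
      case (elim t)
      have "((\<lambda>z::complex. (iexp (-(t * b)) - exp (\<i> * (-(t * (b + z))))) / (\<i> * t)) has_field_derivative iexp (-(t*b))) (at 0)"
        using elim by (auto intro!: derivative_eq_intros simp: mult_ac)
      hence "((\<lambda>z::complex. (iexp (-(t * b)) - exp (\<i> * (-(t * (b + z))))) / (\<i> * t) / z) \<longlongrightarrow> iexp (-(t*b))) (at 0)"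
        by (simp add: DERIV_def)
      moreover have "filterlim (\<lambda>n. complex_of_real (h n)) (at 0) sequentially"
        using tendsto_of_real[OF h0, where 'a=complex] h unfolding filterlim_at
        by (auto intro!: always_eventually simp: less_imp_neq[symmetric])
      ultimately have "(\<lambda>n. (iexp (-(t * b)) - exp (\<i> * (-(complex_of_real t * (complex_of_real b + complex_of_real (h n)))))) / (\<i> * t) / of_real (h n)) \<longlonglongrightarrow> iexp (-(t*b))"
        by (rule filterlim_compose)
      hence "(\<lambda>n. Q n t / of_real (h n)) \<longlonglongrightarrow> iexp (-(t*b))"
        unfolding Q_def by simp
      hence "(\<lambda>n. Q n t * real (Suc n)) \<longlonglongrightarrow> iexp (-(t*b))"
        by (simp add: h_def)
      thus ?case by (intro tendsto_intros)
    qed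
    show "AE t in lborel. norm ((Q n t * real (Suc n)) * char M t) \<le> norm (char M t)" for n
    proof (intro AE_I2)
      fix t
      have "norm (Q n t) * real (Suc n) \<le> h n * real (Suc n)" using Qb by (intro mult_right_mono) auto
      also have "\<dots> = 1" by (simp add: h_def)
      finally show "norm ((Q n t * real (Suc n)) * char M t) \<le> norm (char M t)"
        using mult_right_mono[of "norm (Q n t) * real (Suc n)" 1 "norm (char M t)"]
        unfolding norm_mult norm_of_real by simp
    qed
  qed (use Qm cm int in auto)
  hence "(\<lambda>n. 1 / (2 * pi) * (CLBINT t. (Q n t * real (Suc n)) * char M t)) \<longlonglongrightarrow> 1 / (2 * pi) * (CLBINT t. iexp (-(t * b)) * char M t)"
    by (intro tendsto_intros)
  moreover have "1 / (2 * pi) * (CLBINT t. (Q n t * real (Suc n)) * char M t) = of_real (measure M {b<..b + h n} * real (Suc n))" for n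
  proof -
    have "(CLBINT t. (Q n t * real (Suc n)) * char M t) = (CLBINT t. real (Suc n) * (Q n t * char M t))"
      by (simp only: mult_ac)
    also have "\<dots> = real (Suc n) * (CLBINT t. Q n t * char M t)" by (rule integral_mult_right_zero)
    finally show ?thesis unfolding of_real_mult eq by simp
  qed
  ultimately have "(\<lambda>n. complex_of_real (measure M {b<..b + h n} * real (Suc n))) \<longlonglongrightarrow> 1 / (2 * pi) * (CLBINT t. iexp (-(t * b)) * char M t)"
    by simp
  moreover have "(\<lambda>n. measure M {b<..b + h n} * real (Suc n)) \<longlonglongrightarrow> g b"
  proof -
    have "measure M {b<..b + h n} = integral {b..b + h n} g" for n
      unfolding M using h[of n] by (intro measure_density_Ioc g continuous_on_subset[OF g(3)]) auto
    thus ?thesis using tendsto_average_right[of b g] continuous_on_subset[OF g(3)] by (simp add: h_def)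
  qed
  hence "(\<lambda>n. complex_of_real (measure M {b<..b + h n} * real (Suc n))) \<longlonglongrightarrow> of_real (g b)" by (rule tendsto_of_real)
  ultimately show ?thesis by (rule LIMSEQ_unique[rotated])
qed

lemma (in prob_space) integral_exp_pos:
  fixes Y :: "'a \<Rightarrow> real"
  assumes "integrable M (\<lambda>\<omega>. exp (\<sigma> * Y \<omega>))"
  shows "(\<integral>\<omega>. exp (\<sigma> * Y \<omega>) \<partial>M) > 0"
proof -
  have "(\<integral>\<omega>. exp (\<sigma> * Y \<omega>) \<partial>M) \<ge> 0" by (intro integral_nonneg_AE) auto
  moreover have "(\<integral>\<omega>. exp (\<sigma> * Y \<omega>) \<partial>M) \<noteq> 0"
  proof
    assume "(\<integral>\<omega>. exp (\<sigma> * Y \<omega>) \<partial>M) = 0"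
    hence "AE \<omega> in M. exp (\<sigma> * Y \<omega>) = 0"
      using assms by (subst (asm) integral_nonneg_eq_0_iff_AE) auto
    thus False using AE_False by simp
  qed
  ultimately show ?thesis by linarith
qed

text \<open>Exponential tilting: f weighted by exp (\<sigma> x) and normalised by Z is a probability
  density whose characteristic function is \<phi> / Z. Inversion on the line Re s = \<sigma> thus
  reduces to the Fourier case.\<close>

lemma bilateral_laplace_inversion:
  fixes Y :: "'a \<Rightarrow> real" and f :: "real \<Rightarrow> real"
  assumes "prob_space M"
    and dist: "distributed M lborel Y (\<lambda>x. ennreal (f x))"
    and f: "\<And>x. 0 \<le> f x" "continuous_on UNIV f"
    and intY: "integrable M (\<lambda>\<omega>. exp (\<sigma> * Y \<omega>))"
    and \<phi>: "\<And>t. \<phi> t = (\<integral>\<omega>. exp (Complex \<sigma> t * of_real (Y \<omega>)) \<partial>M)"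
    and int\<phi>: "integrable lborel \<phi>"
  shows "of_real (f y) = 1 / (2 * pi) * (CLBINT t. exp (- (Complex \<sigma> t * of_real y)) * \<phi> t)"
proof -
  interpret prob_space M by fact
  have fm [measurable]: "f \<in> borel_measurable borel"
    using distributed_real_measurable[OF _ dist] f(1) by simp
  have Ym [measurable]: "Y \<in> borel_measurable M" using dist by (simp add: distributed_def)
  define Z where "Z = (\<integral>\<omega>. exp (\<sigma> * Y \<omega>) \<partial>M)"
  define g where "g x = exp (\<sigma> * x) * f x / Z" for x
  have Z: "Z > 0" unfolding Z_def by (rule integral_exp_pos[OF intY])
  have g0: "0 \<le> g x" for x using f(1) Z by (simp add: g_def)
  have gm [measurable]: "g \<in> borel_measurable borel" unfolding g_def by measurable
  have gc: "continuous_on UNIV g" unfolding g_def using f(2) Z by (intro continuous_intros) auto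
  have dens: "distr M lborel Y = density lborel (\<lambda>x. ennreal (f x))"
    using dist by (simp add: distributed_def)
  have trans: "(\<integral>x. f x *\<^sub>R k x \<partial>lborel) = (\<integral>\<omega>. k (Y \<omega>) \<partial>M)"
    if [measurable]: "k \<in> borel_measurable borel" for k :: "real \<Rightarrow> complex"
  proof -
    have "(\<integral>\<omega>. k (Y \<omega>) \<partial>M) = integral\<^sup>L (distr M lborel Y) k" by (rule integral_distr[symmetric]) auto
    thus ?thesis unfolding dens using f(1) by (simp add: integral_density)
  qed
  define N where "N = density lborel (\<lambda>x. ennreal (g x))"
  have "(\<integral>\<^sup>+x. ennreal (g x) \<partial>lborel) = 1"
  proof -
    have "integrable lborel (\<lambda>x. f x * exp (\<sigma> * x))"
      using intY distributed_integrable[OF dist, of "\<lambda>x. exp (\<sigma> * x)"] f(1) by simp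
    hence "integrable lborel g" unfolding g_def by (simp add: mult.commute)
    hence "(\<integral>\<^sup>+x. ennreal (g x) \<partial>lborel) = ennreal (\<integral>x. g x \<partial>lborel)"
      using g0 by (intro nn_integral_eq_integral) auto
    also have "(\<integral>x. g x \<partial>lborel) = (\<integral>x. f x * exp (\<sigma> * x) \<partial>lborel) / Z"
      by (simp add: g_def mult.commute)
    also have "(\<integral>x. f x * exp (\<sigma> * x) \<partial>lborel) = Z"
      unfolding Z_def using f(1) by (intro distributed_integral[OF dist]) auto
    finally show ?thesis using Z by simp
  qed
  hence "prob_space N" unfolding N_def by (intro prob_spaceI) (simp add: emeasure_density)
  then interpret N: real_distribution N
    by (intro real_distribution.intro) (auto simp: real_distribution_axioms_def N_def)
  have charN: "char N t = \<phi> t / of_real Z" for t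
  proof -
    have "char N t = (\<integral>x. g x *\<^sub>R iexp (t * x) \<partial>lborel)"
      unfolding char_def N_def using g0 by (intro integral_density) auto
    also have "\<dots> = (\<integral>x. f x *\<^sub>R (exp (Complex \<sigma> t * of_real x) / of_real Z) \<partial>lborel)"
    proof (intro Bochner_Integration.integral_cong refl)
      fix x
      have "Complex \<sigma> t * of_real x = of_real (\<sigma> * x) + \<i> * of_real (t * x)"
        by (simp add: complex_eq_iff)
      hence "exp (Complex \<sigma> t * of_real x) = of_real (exp (\<sigma> * x)) * iexp (t * x)"
        by (simp only: exp_add exp_of_real)
      thus "g x *\<^sub>R iexp (t * x) = f x *\<^sub>R (exp (Complex \<sigma> t * of_real x) / of_real Z)"
        by (simp add: g_def scaleR_conv_of_real)
    qed
    also have "\<dots> = (\<integral>\<omega>. exp (Complex \<sigma> t * of_real (Y \<omega>)) / of_real Z \<partial>M)" by (intro trans) auto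
    also have "\<dots> = \<phi> t / of_real Z" unfolding \<phi> by simp
    finally show ?thesis .
  qed
  have "integrable lborel (char N)" unfolding charN using int\<phi> by simp
  hence "of_real (g y) = 1 / (2 * pi) * (CLBINT t. iexp (-(t * y)) * char N t)"
    by (intro N.density_inversion) (auto simp: N_def g0 gc)
  hence "of_real (Z * exp (-\<sigma> * y)) * of_real (g y) = 1 / (2 * pi) * (of_real (Z * exp (-\<sigma> * y)) * (CLBINT t. iexp (-(t * y)) * char N t))"
    by (simp only: mult_ac)
  also have "of_real (Z * exp (-\<sigma> * y)) * (CLBINT t. iexp (-(t * y)) * char N t) = (CLBINT t. of_real (Z * exp (-\<sigma> * y)) * (iexp (-(t * y)) * char N t))"
    by (rule integral_mult_right_zero[symmetric])
  also have "\<dots> = (CLBINT t. exp (- (Complex \<sigma> t * of_real y)) * \<phi> t)"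
  proof (intro Bochner_Integration.integral_cong refl)
    fix t
    have "- (Complex \<sigma> t * of_real y) = of_real (-\<sigma> * y) + \<i> * of_real (-(t * y))"
      by (simp add: complex_eq_iff)
    hence "exp (- (Complex \<sigma> t * of_real y)) = of_real (exp (-\<sigma> * y)) * iexp (-(t * y))"
      by (simp only: exp_add exp_of_real)
    thus "of_real (Z * exp (-\<sigma> * y)) * (iexp (-(t * y)) * char N t) = exp (- (Complex \<sigma> t * of_real y)) * \<phi> t"
      unfolding charN using Z by simp
  qed
  also have "of_real (Z * exp (-\<sigma> * y)) * of_real (g y) = complex_of_real (f y)"
    using Z by (simp add: g_def exp_minus field_simps)
  finally show ?thesis .
qed

section \<open>Analytic continuation of the moment function\<close>

text \<open>Differentiation under the integral sign. Within distance \<delta> of s the difference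
  quotient at y is dominated by exp (Re s y + 2 \<delta> |y|) / \<delta>, and \<delta> is so small
  that both exponents Re s + 2 \<delta> and Re s - 2 \<delta> remain in the interval of
  integrability.\<close>

lemma holomorphic_mgf:
  fixes Y :: "'a \<Rightarrow> real"
  assumes Y [measurable]: "Y \<in> borel_measurable M"
    and int: "\<And>s. l < s \<Longrightarrow> s < u \<Longrightarrow> integrable M (\<lambda>\<omega>. exp (s * Y \<omega>))"
  shows "(\<lambda>s. \<integral>\<omega>. exp (s * of_real (Y \<omega>)) \<partial>M) holomorphic_on {s. l < Re s \<and> Re s < u}"
proof -
  define m where "m s = (\<integral>\<omega>. exp (s * complex_of_real (Y \<omega>)) \<partial>M)" for s
  have intc: "integrable M (\<lambda>\<omega>. exp (s * complex_of_real (Y \<omega>)))" if "l < Re s" "Re s < u" for s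
    by (rule Bochner_Integration.integrable_bound[OF int[OF that]]) auto
  have "m field_differentiable (at s)" if s: "l < Re s" "Re s < u" for s
  proof -
    define \<delta> where "\<delta> = min (Re s - l) (u - Re s) / 4"
    have \<delta>: "\<delta> > 0" "l < Re s - 2 * \<delta>" "Re s + 2 * \<delta> < u" using s by (auto simp: \<delta>_def min_def field_simps)
    define w where "w \<omega> = (exp ((Re s + 2 * \<delta>) * Y \<omega>) + exp ((Re s - 2 * \<delta>) * Y \<omega>)) / \<delta>" for \<omega>
    have wint: "integrable M w"
      unfolding w_def using \<delta> s by (intro Bochner_Integration.integrable_divide Bochner_Integration.integrable_add int) auto
    define D where "D = (\<integral>\<omega>. of_real (Y \<omega>) * exp (s * complex_of_real (Y \<omega>)) \<partial>M)"
    have bound: "norm ((exp (z * of_real y) - exp (s * of_real y)) / (z - s)) \<le> 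
         (exp ((Re s + 2 * \<delta>) * y) + exp ((Re s - 2 * \<delta>) * y)) / \<delta>"
      if z: "z \<in> ball s \<delta> - {s}" for z and y :: real
    proof -
      define h where "h = z - s"
      have h: "h \<noteq> 0" "norm h \<le> \<delta>" using z by (auto simp: h_def dist_norm norm_minus_commute)
      have eq: "exp (z * of_real y) - exp (s * of_real y) = exp (s * of_real y) * (exp (h * of_real y) - 1)"
        by (simp add: h_def algebra_simps exp_diff)
      have "norm (exp (h * of_real y) - 1) \<le> exp \<bar>Re (h * of_real y)\<bar> * norm (h * of_real y)"
        using Taylor_exp[of "h * of_real y" 0] by simp
      also have "\<dots> \<le> exp (\<delta> * \<bar>y\<bar>) * (norm h * \<bar>y\<bar>)"
      proof (intro mult_mono)
        have "\<bar>Re h\<bar> * \<bar>y\<bar> \<le> \<delta> * \<bar>y\<bar>" using h abs_Re_le_cmod[of h] by (intro mult_right_mono) auto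
        thus "exp \<bar>Re (h * of_real y)\<bar> \<le> exp (\<delta> * \<bar>y\<bar>)" by (simp add: abs_mult)
      qed (auto simp: norm_mult)
      also have "\<dots> = norm h * (exp (\<delta> * \<bar>y\<bar>) * (\<delta> * \<bar>y\<bar>)) / \<delta>" using \<delta> by simp
      \<comment> \<open>The linear factor \<delta> |y| is absorbed by a second exponential, whence
        the 2 \<delta> in the dominating function.\<close>
      also have "\<dots> \<le> norm h * (exp (\<delta> * \<bar>y\<bar>) * exp (\<delta> * \<bar>y\<bar>)) / \<delta>"
        using \<delta> order.trans[OF _ exp_ge_add_one_self[of "\<delta> * \<bar>y\<bar>"], of "\<delta> * \<bar>y\<bar>"]
        by (intro divide_right_mono mult_left_mono) auto
      finally have "norm (exp (h * of_real y) - 1) \<le> norm h * exp (2 * \<delta> * \<bar>y\<bar>) / \<delta>"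
        by (simp add: exp_add[symmetric] algebra_simps)
      hence "norm (exp (h * of_real y) - 1) / norm h \<le> exp (2 * \<delta> * \<bar>y\<bar>) / \<delta>"
        using h by (subst pos_divide_le_eq) (auto simp: mult_ac)
      hence "exp (Re s * y) * (norm (exp (h * of_real y) - 1) / norm h) \<le> exp (Re s * y) * (exp (2 * \<delta> * \<bar>y\<bar>) / \<delta>)"
        by (intro mult_left_mono) auto
      also have "\<dots> = exp (Re s * y + 2 * \<delta> * \<bar>y\<bar>) / \<delta>" by (simp add: exp_add)
      also have "\<dots> \<le> (exp ((Re s + 2 * \<delta>) * y) + exp ((Re s - 2 * \<delta>) * y)) / \<delta>"
        using \<delta> by (intro divide_right_mono) (auto simp: abs_if algebra_simps)
      finally show ?thesis unfolding eq by (simp add: norm_divide norm_mult h_def)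
    qed
    have "((\<lambda>z. (m z - m s) / (z - s)) \<longlongrightarrow> D) (at s within ball s \<delta>)"
      unfolding tendsto_at_iff_sequentially o_def
    proof (intro allI impI)
      fix Z :: "nat \<Rightarrow> complex" assume Z: "\<forall>i. Z i \<in> ball s \<delta> - {s}" "Z \<longlonglongrightarrow> s"
      have Zr: "l < Re (Z n)" "Re (Z n) < u" for n
      proof -
        have "norm (Z n - s) < \<delta>" using Z(1) by (auto simp: dist_norm norm_minus_commute)
        hence "\<bar>Re (Z n) - Re s\<bar> < \<delta>" using abs_Re_le_cmod[of "Z n - s"] by simp
        thus "l < Re (Z n)" "Re (Z n) < u" using \<delta> by linarith+
      qed
      have "(\<lambda>n. \<integral>\<omega>. (exp (Z n * of_real (Y \<omega>)) - exp (s * of_real (Y \<omega>))) / (Z n - s) \<partial>M) \<longlonglongrightarrow> D"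
        unfolding D_def
      proof (rule integral_dominated_convergence[where w = w])
        show "AE \<omega> in M. (\<lambda>n. (exp (Z n * of_real (Y \<omega>)) - exp (s * of_real (Y \<omega>))) / (Z n - s))
                \<longlonglongrightarrow> of_real (Y \<omega>) * exp (s * of_real (Y \<omega>))"
        proof (intro AE_I2)
          fix \<omega>
          have "((\<lambda>z. exp (z * of_real (Y \<omega>))) has_field_derivative of_real (Y \<omega>) * exp (s * of_real (Y \<omega>))) (at s)"
            by (auto intro!: derivative_eq_intros)
          hence "((\<lambda>z. (exp (z * of_real (Y \<omega>)) - exp (s * of_real (Y \<omega>))) / (z - s)) \<longlongrightarrow> of_real (Y \<omega>) * exp (s * of_real (Y \<omega>))) (at s)"
            by (simp add: has_field_derivative_iff)
          moreover have "filterlim Z (at s) sequentially" using Z unfolding filterlim_at by auto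
          ultimately show "(\<lambda>n. (exp (Z n * of_real (Y \<omega>)) - exp (s * of_real (Y \<omega>))) / (Z n - s))
                \<longlonglongrightarrow> of_real (Y \<omega>) * exp (s * of_real (Y \<omega>))" by (rule filterlim_compose)
        qed
        show "AE \<omega> in M. norm ((exp (Z n * of_real (Y \<omega>)) - exp (s * of_real (Y \<omega>))) / (Z n - s)) \<le> w \<omega>" for n
          unfolding w_def using Z(1) by (intro AE_I2 bound) auto
      qed (use wint in auto)
      moreover have "(\<integral>\<omega>. (exp (Z n * of_real (Y \<omega>)) - exp (s * of_real (Y \<omega>))) / (Z n - s) \<partial>M) = (m (Z n) - m s) / (Z n - s)" for n
        unfolding m_def using intc[OF Zr] intc[OF s] by simp
      ultimately show "(\<lambda>n. (m (Z n) - m s) / (Z n - s)) \<longlonglongrightarrow> D" by (simp only:)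
    qed
    hence "(m has_field_derivative D) (at s within ball s \<delta>)" by (simp add: has_field_derivative_iff)
    hence "(m has_field_derivative D) (at s)" using \<delta> by (subst (asm) at_within_open) auto
    thus ?thesis by (auto simp: field_differentiable_def)
  qed
  thus ?thesis unfolding m_def[symmetric]
    by (auto simp: holomorphic_on_def intro: field_differentiable_at_within)
qed


text \<open>The identity theorem on the strip without the poles of F: removing a sparse set leaves
  it connected, and the real interval on which F agrees with the moments supplies a limit point.
  Poles in the strip are then impossible, because F coincides with a holomorphic function around
  them.\<close>

lemma (in prob_space) mgf_eq_meromorphic:
  fixes Y :: "'a \<Rightarrow> real"
  assumes Y [measurable]: "Y \<in> borel_measurable M"
    and int: "\<And>s. l < s \<Longrightarrow> s < u \<Longrightarrow> integrable M (\<lambda>\<omega>. exp (s * Y \<omega>))"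
    and F: "F nicely_meromorphic_on UNIV"
    and sub: "l \<le> l'" "l' < u'" "u' \<le> u"
    and eq: "\<And>s. l' < s \<Longrightarrow> s < u' \<Longrightarrow> F (of_real s) = of_real (\<integral>\<omega>. exp (s * Y \<omega>) \<partial>M)"
    and s: "l < Re s" "Re s < u"
  shows "\<not> is_pole F s" "F s = (\<integral>\<omega>. exp (s * of_real (Y \<omega>)) \<partial>M)"
proof -
  define m where "m s = (\<integral>\<omega>. exp (s * complex_of_real (Y \<omega>)) \<partial>M)" for s
  define S where "S = {s. l < Re s \<and> Re s < u}"
  define P where "P = {z. is_pole F z}"
  have hol: "m holomorphic_on S" unfolding m_def S_def by (rule holomorphic_mgf[OF Y int])
  have S_eq: "S = {s. l < Re s} \<inter> {s. Re s < u}" by (auto simp: S_def)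
  have oS: "open S" unfolding S_eq by (intro open_Int open_halfspace_Re_gt open_halfspace_Re_lt)
  have cS: "connected S" unfolding S_eq
    by (intro convex_connected convex_Int convex_halfspace_Re_gt convex_halfspace_Re_lt)
  have sparse: "P sparse_in S"
    using F unfolding P_def nicely_meromorphic_on_def
    by (meson meromorphic_on_isolated_singularity meromorphic_on_meromorphic_at not_islimpt_poles oS sparse_in_open UNIV_I)
  have mr: "m (of_real x) = of_real (\<integral>\<omega>. exp (x * Y \<omega>) \<partial>M)" for x
  proof -
    have "m (of_real x) = (\<integral>\<omega>. complex_of_real (exp (x * Y \<omega>)) \<partial>M)"
      unfolding m_def by (simp flip: exp_of_real)
    thus ?thesis by simp
  qed
  \<comment> \<open>A nicely meromorphic function takes the value 0 at a pole, but the moments on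
    this interval are strictly positive.\<close>
  have npr: "of_real x \<in> S - P" if x: "l' < x" "x < u'" for x
  proof -
    have "F (of_real x) \<noteq> 0" unfolding eq[OF x]
      using integral_exp_pos[OF int, of x] x sub by auto
    moreover have "(is_pole F (of_real x) \<and> F (of_real x) = 0) \<or> F \<midarrow>(of_real x)\<rightarrow> F (of_real x)"
      using F by (auto simp: nicely_meromorphic_on_def)
    ultimately have "\<not> is_pole F (of_real x)"
      using at_neq_bot not_tendsto_and_filterlim_at_infinity unfolding is_pole_def by blast
    thus ?thesis using x sub by (auto simp: S_def P_def)
  qed
  define \<xi> where "\<xi> = complex_of_real ((l' + u') / 2)"
  have lim: "\<xi> islimpt of_real ` {l'<..<u'}"
  proof -
    have "(l' + u') / 2 islimpt {l'<..<u'}" using sub by (intro interior_limit_point) auto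
    thus ?thesis unfolding \<xi>_def islimpt_approachable dist_of_real[symmetric, where 'a=complex]
      by (metis (no_types, lifting) imageI of_real_eq_iff)
  qed
  have FM: "F w = m w" if w: "w \<in> S - P" for w
  proof -
    have "F w - m w = 0"
    proof (rule analytic_continuation[of "\<lambda>w. F w - m w" "S - P" "of_real ` {l'<..<u'}" \<xi>])
      have "F holomorphic_on S - P" unfolding P_def
        by (rule analytic_imp_holomorphic)
           (metis (mono_tags, lifting) DiffD2 F UNIV_I analytic_on_analytic_at mem_Collect_eq nicely_meromorphic_on_imp_analytic_at)
      thus "(\<lambda>w. F w - m w) holomorphic_on S - P"
        by (intro holomorphic_intros holomorphic_on_subset[OF hol]) auto
      show "open (S - P)" using sparse oS by (simp add: open_diff_sparse_pts)
      show "connected (S - P)" using sparse oS cS by (intro sparse_imp_connected) auto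
      show "of_real ` {l'<..<u'} \<subseteq> S - P" using npr by auto
      show "\<xi> \<in> S - P" unfolding \<xi>_def using sub by (intro npr) auto
      show "F z - m z = 0" if "z \<in> of_real ` {l'<..<u'}" for z
        using that eq mr by auto
    qed (use lim w in auto)
    thus ?thesis by simp
  qed
  show np: "\<not> is_pole F s"
  proof
    assume p: "is_pole F s"
    have "eventually (\<lambda>w. w \<in> S - P - {s}) (at s)"
    proof -
      have "eventually (\<lambda>w. w \<in> S) (at s)" using oS s by (intro eventually_at_in_open') (auto simp: S_def)
      moreover have "eventually (\<lambda>w. \<not>is_pole F w) (at s)"
        using F unfolding nicely_meromorphic_on_def by (metis UNIV_I eventually_not_pole meromorphic_onE)
      ultimately show ?thesis using eventually_neq_at_within[of s s UNIV]
        by eventually_elim (auto simp: P_def)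
    qed
    hence "eventually (\<lambda>w. F w = m w) (at s)" by eventually_elim (auto intro: FM)
    hence "is_pole F s \<longleftrightarrow> is_pole m s" by (intro is_pole_cong) auto
    moreover have "m analytic_on {s}" using hol oS s by (auto simp: S_def analytic_at)
    ultimately show False using p analytic_at_imp_no_pole by blast
  qed
  have "F s = m s" using s np by (intro FM) (auto simp: S_def P_def)
  thus "F s = (\<integral>\<omega>. exp (s * of_real (Y \<omega>)) \<partial>M)" by (simp add: m_def)
qed

text \<open>The expansion runs over the poles to the right of 0, contour shifting over those to the
  right of \<sigma>, and the given interval of moments may lie anywhere. Integrability spreads from
  one nonzero exponent to all exponents between it and 0, so \<sigma> can be put half-way to 0 with
  no pole in between.\<close>

lemma (in prob_space) mgf_line_left_of_positive_poles:
  fixes Y :: "'a \<Rightarrow> real"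
  assumes Y [measurable]: "Y \<in> borel_measurable M"
    and F: "F nicely_meromorphic_on UNIV"
    and lu: "l < u"
    and int: "\<And>s. l < s \<Longrightarrow> s < u \<Longrightarrow> integrable M (\<lambda>\<omega>. exp (s * Y \<omega>))"
    and eq: "\<And>s. l < s \<Longrightarrow> s < u \<Longrightarrow> F (of_real s) = of_real (\<integral>\<omega>. exp (s * Y \<omega>) \<partial>M)"
  obtains \<sigma> where "integrable M (\<lambda>\<omega>. exp (\<sigma> * Y \<omega>))"
    "\<And>t. F (Complex \<sigma> t) = (\<integral>\<omega>. exp (Complex \<sigma> t * of_real (Y \<omega>)) \<partial>M)"
    "\<And>t. \<not> is_pole F (Complex \<sigma> t)"
    "\<And>\<rho>::real. is_pole F (of_real \<rho>) \<Longrightarrow> \<rho> > 0 \<longleftrightarrow> \<rho> > \<sigma>"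
proof -
  have "\<exists>s. l < s \<and> s < u \<and> s \<noteq> 0"
  proof (cases "l < (l + u)/2 \<and> (l + u) / 2 \<noteq> 0")
    case True
    thus ?thesis using lu by (intro exI[of _ "(l+u)/2"]) auto
  next
    case False
    thus ?thesis using lu by (intro exI[of _ "l + (u - l) / 3"]) (auto simp: field_simps)
  qed
  then obtain s1 where s1: "l < s1" "s1 < u" "s1 \<noteq> 0" by blast
  have bnd: "exp (s * y) \<le> 1 + exp (s1 * y)" if "0 < s \<and> s < s1 \<or> s1 < s \<and> s < 0" for s y :: real
  proof -
    have "s * y \<le> 0 \<or> s * y \<le> s1 * y"
      using that by (cases "y \<ge> 0") (auto simp: mult_right_mono mult_right_mono_neg mult_nonpos_nonneg mult_nonneg_nonpos)
    hence "exp (s * y) \<le> 1 \<or> exp (s * y) \<le> exp (s1 * y)" by auto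
    thus ?thesis using exp_gt_zero[of "s1 * y"] by linarith
  qed
  have i1: "integrable M (\<lambda>\<omega>. 1 + exp (s1 * Y \<omega>))" using int[OF s1(1,2)] by simp
  have int': "integrable M (\<lambda>\<omega>. exp (s * Y \<omega>))" if "0 < s \<and> s < s1 \<or> s1 < s \<and> s < 0" for s
    by (rule Bochner_Integration.integrable_bound[OF i1])
       (use bnd[OF that] in \<open>auto intro!: AE_I2 simp: abs_of_pos add_pos_pos\<close>)
  show ?thesis
  proof (cases "s1 > 0")
    case True
    have *: "\<not> is_pole F s \<and> F s = (\<integral>\<omega>. exp (s * of_real (Y \<omega>)) \<partial>M)" if "0 < Re s" "Re s < s1" for s
      using mgf_eq_meromorphic[OF Y int' F, of 0 s1 "max 0 l" s1 s] True s1 that eq by auto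
    have i2: "integrable M (\<lambda>\<omega>. exp (s1 / 2 * Y \<omega>))" by (rule int') (use s1 in auto)
    show ?thesis
    proof (rule that[OF i2])
      show "\<rho> > 0 \<longleftrightarrow> \<rho> > s1 / 2" if "is_pole F (of_real \<rho>)" for \<rho> :: real
        using *[of "of_real \<rho>"] that True by (cases "\<rho> > s1 / 2") auto
    qed (use True * in auto)
  next
    case False
    hence s1': "s1 < 0" using s1 by simp
    have *: "\<not> is_pole F s \<and> F s = (\<integral>\<omega>. exp (s * of_real (Y \<omega>)) \<partial>M)" if "s1 < Re s" "Re s < 0" for s
      using mgf_eq_meromorphic[OF Y int' F, of s1 0 s1 "min 0 u" s] s1' s1 that eq by auto
    \<comment> \<open>With \<sigma> negative, a pole at 0 would lie to the right of \<sigma> without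
      being positive. It is excluded because the moments stay bounded as the real exponent increases
      to 0.\<close>
    have np0: "\<not> is_pole F 0"
    proof
      assume "is_pole F 0"
      hence "filterlim (\<lambda>z. norm (F z)) at_top (at 0)"
        unfolding is_pole_def using filterlim_at_infinity_imp_norm_at_top by blast
      define B where "B = (\<integral>\<omega>. 1 + exp (s1 * Y \<omega>) \<partial>M)"
      have "eventually (\<lambda>z. norm (F z) > B) (at 0)"
        using \<open>filterlim (\<lambda>z. norm (F z)) at_top (at 0)\<close> by (rule filterlim_at_top_dense[THEN iffD1, rule_format])
      then obtain d where d: "d > 0" "\<And>z. z \<noteq> 0 \<Longrightarrow> norm z < d \<Longrightarrow> norm (F z) > B"
        unfolding eventually_at by (auto simp: dist_norm)
      define x where "x = max (s1 / 2) (-d / 2)"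
      have x: "s1 < x" "x < 0" "\<bar>x\<bar> < d" using s1' d(1) by (auto simp: x_def)
      have "norm (F (of_real x)) = norm (\<integral>\<omega>. exp (of_real x * complex_of_real (Y \<omega>)) \<partial>M)" using *[of "of_real x"] x by simp
      also have "\<dots> \<le> (\<integral>\<omega>. norm (exp (of_real x * complex_of_real (Y \<omega>))) \<partial>M)" by (rule integral_norm_bound)
      also have "\<dots> = (\<integral>\<omega>. exp (x * Y \<omega>) \<partial>M)" by simp
      also have "\<dots> \<le> B" unfolding B_def using x by (intro integral_mono int' i1 bnd) auto
      finally show False using d(2)[of "of_real x"] x by simp
    qed
    have i2: "integrable M (\<lambda>\<omega>. exp (s1 / 2 * Y \<omega>))" by (rule int') (use s1 in auto)
    show ?thesis
    proof (rule that[OF i2])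
      show "\<rho> > 0 \<longleftrightarrow> \<rho> > s1 / 2" if "is_pole F (of_real \<rho>)" for \<rho> :: real
        using *[of "of_real \<rho>"] that s1' np0 by (cases "\<rho> > 0"; cases "\<rho> = 0") auto
    qed (use s1' * in auto)
  qed
qed

section \<open>Contour integrals and residues\<close>

text \<open>The residue theorem on rectangles whose height tends to infinity. The open strip between
  a and b is wider than the rectangles, so P may contain points outside them; these have winding
  number 0. The factor i of the residue theorem cancels because the lines are parametrised by their
  imaginary part.\<close>

lemma vertical_contour_shift:
  fixes f :: "complex \<Rightarrow> complex"
  assumes \<sigma>R: "a < \<sigma>" "\<sigma> < R" "R < b"
    and P: "finite P" "\<sigma> \<notin> P" "R \<notin> P"
    and hol: "f holomorphic_on {s. a < Re s \<and> Re s < b} - of_real ` P"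
    and int: "integrable lborel (\<lambda>t. f (Complex \<sigma> t))" "integrable lborel (\<lambda>t. f (Complex R t))"
    and bound: "\<And>x t. \<sigma> \<le> x \<Longrightarrow> x \<le> R \<Longrightarrow> \<bar>t\<bar> \<ge> 1 \<Longrightarrow> norm (f (Complex x t)) \<le> g \<bar>t\<bar>"
    and g: "(g \<longlongrightarrow> 0) at_top"
  shows "(CLBINT t. f (Complex R t)) - (CLBINT t. f (Complex \<sigma> t)) = 2 * pi * (\<Sum>\<rho>\<in>P \<inter> {\<sigma><..<R}. residue f (of_real \<rho>))"
proof -
  define Q where "Q = P \<inter> {\<sigma><..<R}"
  define S where "S = {s. a < Re s \<and> Re s < b}"
  have S_eq: "S = {s. a < Re s} \<inter> {s. Re s < b}" by (auto simp: S_def)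
  have oS: "open S" unfolding S_eq by (intro open_Int open_halfspace_Re_gt open_halfspace_Re_lt)
  have cvS: "convex S" unfolding S_eq
    by (intro convex_Int convex_halfspace_Re_gt convex_halfspace_Re_lt)
  have cont: "continuous_on (S - of_real ` P) f"
    using hol holomorphic_on_imp_continuous_on by (simp add: S_def)
  define V where "V x T = (LBINT t:{-T..T}. f (Complex x t))" for x T :: real
  define H where "H T = contour_integral (linepath (Complex \<sigma> T) (Complex R T)) f" for T
  have seg: "closed_segment (Complex \<sigma> T) (Complex R T) = {Complex x T | x. x \<in> {\<sigma>..R}}" for T
  proof -
    have "closed_segment (Complex \<sigma> T) (Complex R T) = {z. Im z = T \<and> Re z \<in> closed_segment \<sigma> R}"
      by (subst closed_segment_same_Im) auto
    thus ?thesis using \<sigma>R by (auto simp: closed_segment_eq_real_ivl complex_eq_iff)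
  qed
  have inth: "f contour_integrable_on linepath (Complex \<sigma> T) (Complex R T)" if "T \<noteq> 0" for T
  proof (rule contour_integrable_continuous_linepath, rule continuous_on_subset[OF cont])
    show "closed_segment (Complex \<sigma> T) (Complex R T) \<subseteq> S - of_real ` P"
      unfolding seg using that \<sigma>R by (auto simp: S_def complex_eq_iff)
  qed
  have Hb: "norm (H T) \<le> g \<bar>T\<bar> * (R - \<sigma>)" if T: "\<bar>T\<bar> \<ge> 1" for T
  proof -
    have "norm (H T) \<le> g \<bar>T\<bar> * norm (Complex R T - Complex \<sigma> T)" unfolding H_def
    proof (rule contour_integral_bound_linepath)
      show "0 \<le> g \<bar>T\<bar>" using order.trans[OF norm_ge_zero bound[of \<sigma> T]] \<sigma>R T by auto
      show "norm (f x) \<le> g \<bar>T\<bar>" if "x \<in> closed_segment (Complex \<sigma> T) (Complex R T)" for x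
        using that bound T unfolding seg by auto
    qed (use T in \<open>auto intro!: inth\<close>)
    also have "Complex R T - Complex \<sigma> T = of_real (R - \<sigma>)" by (simp add: complex_eq_iff)
    finally show ?thesis using \<sigma>R by (simp only: norm_of_real abs_of_pos)
  qed
  have vert: "f contour_integrable_on linepath (Complex x (-T)) (Complex x T)"
             "contour_integral (linepath (Complex x (-T)) (Complex x T)) f = \<i> * V x T"
    if x: "x \<in> {\<sigma>, R}" and T: "T > 0" for x T
  proof -
    have seg': "closed_segment (Complex x (-T)) (Complex x T) \<subseteq> S - of_real ` P"
      using x P \<sigma>R by (subst closed_segment_same_Re) (auto simp: S_def)
    thus "f contour_integrable_on linepath (Complex x (-T)) (Complex x T)"
      by (intro contour_integrable_continuous_linepath continuous_on_subset[OF cont])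
    have "contour_integral (linepath (Complex x (-T)) (Complex x T)) f = \<i> * integral {-T..T} (\<lambda>t. f (Complex x t))"
      using T by (intro contour_integral_linepath_same_Re) auto
    also have "integral {-T..T} (\<lambda>t. f (Complex x t)) = V x T"
      unfolding V_def using int x
      by (intro set_borel_integral_eq_integral(2)[symmetric]) (auto simp: set_integrable_def intro!: integrable_mult_indicator)
    finally show "contour_integral (linepath (Complex x (-T)) (Complex x T)) f = \<i> * V x T" .
  qed
  have rect: "H (-T) + \<i> * V R T - H T - \<i> * V \<sigma> T = 2 * pi * \<i> * (\<Sum>\<rho>\<in>Q. residue f (of_real \<rho>))" if T: "T \<ge> 1" for T
  proof -
    define p where "p = rectpath (Complex \<sigma> (-T)) (Complex R T)"
    have img: "path_image p \<subseteq> S - of_real ` P"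
      unfolding p_def using \<sigma>R P T
      by (subst path_image_rectpath) (auto simp: S_def)
    have "contour_integral p f = 2 * pi * \<i> * (\<Sum>z\<in>of_real ` P. winding_number p z * residue f z)"
    proof (rule Residue_theorem[OF oS convex_connected[OF cvS]])
      show "\<forall>z. z \<notin> S \<longrightarrow> winding_number p z = 0"
      proof (intro allI impI)
        fix z assume "z \<notin> S"
        moreover have "cbox (Complex \<sigma> (-T)) (Complex R T) \<subseteq> S"
          using \<sigma>R by (auto simp: S_def cbox_complex_eq)
        ultimately show "winding_number p z = 0" unfolding p_def
          using \<sigma>R T by (intro winding_number_rectpath_outside) auto
      qed
    qed (use P hol img in \<open>auto simp: p_def S_def\<close>)
    also have "(\<Sum>z\<in>of_real ` P. winding_number p z * residue f z) = (\<Sum>z\<in>of_real ` Q. winding_number p z * residue f z)"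
    proof (rule sum.mono_neutral_right)
      show "\<forall>z\<in>of_real ` P - of_real ` Q. winding_number p z * residue f z = 0"
      proof
        fix z :: complex assume "z \<in> of_real ` P - of_real ` Q"
        then obtain x where x: "z = of_real x" "x \<in> P" "x \<notin> Q" by auto
        hence "x < \<sigma> \<or> x > R" using P by (auto simp: Q_def not_less le_less)
        hence "z \<notin> cbox (Complex \<sigma> (-T)) (Complex R T)"
          using x by (auto simp: in_cbox_complex_iff)
        hence "winding_number p z = 0" unfolding p_def using \<sigma>R T
          by (intro winding_number_rectpath_outside) auto
        thus "winding_number p z * residue f z = 0" by simp
      qed
    qed (use P in \<open>auto simp: Q_def\<close>)
    also have "(\<Sum>z\<in>of_real ` Q. winding_number p z * residue f z) = (\<Sum>z\<in>of_real ` Q. residue f z)"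
    proof (rule sum.cong)
      fix z :: complex assume z: "z \<in> of_real ` Q"
      have "winding_number p z = 1" unfolding p_def
        using z T by (intro winding_number_rectpath) (auto simp: in_box_complex_iff Q_def)
      thus "winding_number p z * residue f z = residue f z" by simp
    qed auto
    also have "\<dots> = (\<Sum>\<rho>\<in>Q. residue f (of_real \<rho>))" by (subst sum.reindex) (auto simp: inj_on_def)
    also have "contour_integral p f = H (-T) + \<i> * V R T - H T - \<i> * V \<sigma> T"
    proof -
      have hT: "f contour_integrable_on linepath (Complex R T) (Complex \<sigma> T)"
        "contour_integral (linepath (Complex R T) (Complex \<sigma> T)) f = - H T"
        using inth[of T] T contour_integrable_reversepath[of "linepath (Complex \<sigma> T) (Complex R T)" f]
           contour_integral_reversepath[of "linepath (Complex \<sigma> T) (Complex R T)" f] by (auto simp: H_def)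
      have vT: "f contour_integrable_on linepath (Complex \<sigma> T) (Complex \<sigma> (-T))"
        "contour_integral (linepath (Complex \<sigma> T) (Complex \<sigma> (-T))) f = - \<i> * V \<sigma> T"
        using vert[of \<sigma> T] T contour_integrable_reversepath[of "linepath (Complex \<sigma> (-T)) (Complex \<sigma> T)" f]
           contour_integral_reversepath[of "linepath (Complex \<sigma> (-T)) (Complex \<sigma> T)" f] by auto
      show ?thesis
        unfolding p_def rectpath_def using hT vT vert[of R T] inth[of "-T"] T
        by (simp add: Let_def H_def)
    qed
    finally show ?thesis .
  qed
  have Vlim: "(\<lambda>n. V x (real (Suc n))) \<longlonglongrightarrow> (CLBINT t. f (Complex x t))" if "x \<in> {\<sigma>, R}" for x
  proof -
    have "(\<lambda>n. V x (real n)) \<longlonglongrightarrow> (CLBINT t. f (Complex x t))"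
      using tendsto_interval_integral_UNIV[of "\<lambda>t. f (Complex x t)"] int that
      by (auto simp: V_def interval_integral_Icc)
    thus ?thesis by (rule LIMSEQ_Suc)
  qed
  have glim: "(\<lambda>n. g (real (Suc n)) * (R - \<sigma>)) \<longlonglongrightarrow> 0"
  proof -
    have "filterlim (\<lambda>n. real (Suc n)) at_top sequentially"
      using filterlim_real_sequentially filterlim_sequentially_Suc by blast
    from tendsto_mult_left_zero[OF filterlim_compose[OF g this]] show ?thesis .
  qed
  have Hlim: "(\<lambda>n. H (real (Suc n))) \<longlonglongrightarrow> 0" "(\<lambda>n. H (- real (Suc n))) \<longlonglongrightarrow> 0"
    by (rule Lim_null_comparison[OF _ glim], intro always_eventually allI order.trans[OF Hb]; simp add: add.commute)+
  have "(\<lambda>n. H (- real (Suc n)) + \<i> * V R (real (Suc n)) - H (real (Suc n)) - \<i> * V \<sigma> (real (Suc n))) \<longlonglongrightarrow>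
      0 + \<i> * (CLBINT t. f (Complex R t)) - 0 - \<i> * (CLBINT t. f (Complex \<sigma> t))"
    using \<sigma>R by (intro tendsto_intros Hlim Vlim) auto
  moreover have "H (- real (Suc n)) + \<i> * V R (real (Suc n)) - H (real (Suc n)) - \<i> * V \<sigma> (real (Suc n)) =
     2 * pi * \<i> * (\<Sum>\<rho>\<in>Q. residue f (of_real \<rho>))" for n by (rule rect) simp
  ultimately have "(\<lambda>n::nat. 2 * pi * \<i> * (\<Sum>\<rho>\<in>Q. residue f (of_real \<rho>))) \<longlonglongrightarrow>
      0 + \<i> * (CLBINT t. f (Complex R t)) - 0 - \<i> * (CLBINT t. f (Complex \<sigma> t))"
    by (simp only:)
  from LIMSEQ_unique[OF this tendsto_const]
  have "\<i> * ((CLBINT t. f (Complex R t)) - (CLBINT t. f (Complex \<sigma> t))) = \<i> * (2 * pi * (\<Sum>\<rho>\<in>Q. residue f (of_real \<rho>)))"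
    by (simp add: algebra_simps)
  thus ?thesis unfolding Q_def by (subst (asm) mult_left_cancel) auto
qed

lemma circlepath_sum_residues:
  assumes r: "0 < r" "r < r'" and P: "finite P" "P \<subseteq> ball c r"
    and hol: "f holomorphic_on ball c r' - P"
  shows "contour_integral (circlepath c r) f = 2 * pi * \<i> * (\<Sum>z\<in>P. residue f z)"
proof -
  have "contour_integral (circlepath c r) f = 2 * pi * \<i> * (\<Sum>z\<in>P. winding_number (circlepath c r) z * residue f z)"
  proof (rule Residue_theorem)
    show "path_image (circlepath c r) \<subseteq> ball c r' - P" using r P by auto
    show "\<forall>z. z \<notin> ball c r' \<longrightarrow> winding_number (circlepath c r) z = 0"
    proof (intro allI impI)
      fix z assume "z \<notin> ball c r'"
      thus "winding_number (circlepath c r) z = 0" using r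
        by (intro winding_number_zero_outside[of _ "cball c r"]) auto
    qed
  qed (use assms in auto)
  also have "(\<Sum>z\<in>P. winding_number (circlepath c r) z * residue f z) = (\<Sum>z\<in>P. residue f z)"
  proof (rule sum.cong)
    fix z assume "z \<in> P"
    hence "norm (z - c) < r" using P by (auto simp: dist_norm norm_minus_commute)
    thus "winding_number (circlepath c r) z * residue f z = residue f z"
      by (simp add: winding_number_circlepath)
  qed auto
  finally show ?thesis .
qed

text \<open>At a pole of order d only the Taylor coefficients of exp (-s y) up to order d - 1 meet
  the singular part of F. This identifies the whole inner sum of logarithmic terms at one pole with
  a single residue, up to sign.\<close>

lemma residue_exp_times:
  fixes y :: real and F :: "complex \<Rightarrow> complex"
  assumes iso: "isolated_singularity_at F \<rho>" and pole: "is_pole F \<rho>"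
  shows "residue (\<lambda>s. exp (- (s * of_real y)) * F s) \<rho> =
    (\<Sum>l<pole_order F \<rho>. singular_coeff F (l + 1) \<rho> * (- of_real y) ^ l / fact l * exp (- (\<rho> * of_real y)))"
proof -
  define L where "L = laurent_expansion F \<rho>"
  have L: "(\<lambda>w. F (\<rho> + w)) has_laurent_expansion L"
    unfolding L_def using iso pole by (intro not_essential_has_laurent_expansion) (auto simp: not_essential_def)
  define E :: "complex fps" where "E = fps_const (exp (- (\<rho> * of_real y))) * fps_exp (- of_real y)"
  have "(\<lambda>w. exp (- (\<rho> * of_real y)) * exp (- of_real y * w)) has_fps_expansion E"
    unfolding E_def by (intro fps_expansion_intros)
  hence "(\<lambda>w. exp (- ((\<rho> + w) * of_real y))) has_fps_expansion E"
    by (simp add: exp_add[symmetric] algebra_simps)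
  hence "(\<lambda>w. exp (- ((\<rho> + w) * of_real y))) has_laurent_expansion fps_to_fls E"
    by (rule has_laurent_expansion_fps)
  hence "(\<lambda>w. exp (- ((\<rho> + w) * of_real y)) * F (\<rho> + w)) has_laurent_expansion fps_to_fls E * L"
    by (intro laurent_expansion_intros L)
  hence res: "residue (\<lambda>s. exp (- (s * of_real y)) * F s) \<rho> = fls_nth (fps_to_fls E * L) (-1)"
    using has_laurent_expansion_residue[of "\<lambda>s. exp (- (s * of_real y)) * F s" \<rho>] by simp
  define d where "d = pole_order F \<rho>"
  have "fls_subdegree L < 0" using is_pole_imp_neg_fls_subdegree[OF L pole] .
  hence L0: "L \<noteq> 0" by auto
  have sub: "fls_subdegree L = - int d"
    using has_laurent_expansion_zorder[OF L L0] \<open>fls_subdegree L < 0\<close> by (simp add: d_def pole_order_def)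
  have E0: "subdegree E = 0" by (simp add: E_def)
  have En: "E $ n = exp (- (\<rho> * of_real y)) * (- of_real y) ^ n / fact n" for n
    by (simp add: E_def)
  have arith: "- 1 - (i + int d) = - int d - 1 - i" for i by simp
  have "fls_nth (fps_to_fls E * L) (-1) = (\<Sum>i=-int d..-1. E $ nat (i + int d) * fls_nth L (- int d - 1 - i))"
    using fls_times_nth(3)[of "fps_to_fls E" L "-1"] sub E0
    by (simp add: fls_subdegree_fls_to_fps)
  also have "\<dots> = (\<Sum>l<d. E $ l * fls_nth L (-1 - int l))"
    by (rule sum.reindex_bij_witness[of _ "\<lambda>l. int l - int d" "\<lambda>i. nat (i + int d)"]) (auto simp: arith)
  also have "\<dots> = (\<Sum>l<d. singular_coeff F (l + 1) \<rho> * (- of_real y) ^ l / fact l * exp (- (\<rho> * of_real y)))"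
    by (intro sum.cong refl) (simp add: En singular_coeff_def L_def algebra_simps)
  finally show ?thesis unfolding res d_def .
qed

lemma fY_pole_term_eq_residue:
  assumes "isolated_singularity_at F (of_real \<rho>)" "is_pole F (of_real \<rho>)"
  shows "fY_pole_term F y \<rho> = - residue (\<lambda>s. exp (- (s * of_real y)) * F s) (of_real \<rho>)"
  unfolding residue_exp_times[OF assms] fY_pole_term_def sum_negf[symmetric]
  by (intro sum.cong refl) (simp add: power_minus[of "complex_of_real y"] exp_of_real[symmetric])

lemma fY_residue_term_eq_pole_term:
  assumes iso: "isolated_singularity_at F (of_real \<rho>)" and pole: "is_pole F (of_real \<rho>)"
    and "pole_order F (of_real \<rho>) = 1"
  shows "fY_residue_term F y \<rho> = fY_pole_term F y \<rho>"
proof -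
  have "(\<lambda>w. F (of_real \<rho> + w)) has_laurent_expansion laurent_expansion F (of_real \<rho>)"
    using iso pole by (intro not_essential_has_laurent_expansion) (auto simp: not_essential_def)
  hence "residue F (of_real \<rho>) = singular_coeff F 1 (of_real \<rho>)"
    using has_laurent_expansion_residue by (simp add: singular_coeff_def)
  thus ?thesis using assms(3) by (simp add: fY_residue_term_def fY_pole_term_def)
qed

lemma fX_pole_term_eq:
  assumes "x > 0"
  shows "fX_pole_term F x \<rho> = fY_pole_term F (ln x) \<rho> / of_real x"
  using assms unfolding fX_pole_term_def fY_pole_term_def sum_divide_distrib
  by (intro sum.cong refl) (simp add: powr_def exp_diff exp_minus field_simps)

lemma fX_residue_term_eq:
  assumes "x > 0"
  shows "fX_residue_term F x \<rho> = fY_residue_term F (ln x) \<rho> / of_real x"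
  using assms unfolding fX_residue_term_def fY_residue_term_def
  by (simp add: powr_def exp_diff exp_minus field_simps)

section \<open>Growth of the Gamma quotient\<close>

lemma prod_norm_le_exp_sum:
  fixes f :: "'i \<Rightarrow> complex"
  assumes "\<And>i. i \<in> A \<Longrightarrow> norm (f i) \<le> exp (g i)"
  shows "norm (\<Prod>i\<in>A. f i) \<le> exp (\<Sum>i\<in>A. g i)"
proof (cases "finite A")
  case True
  have "norm (\<Prod>i\<in>A. f i) = (\<Prod>i\<in>A. norm (f i))" by (simp add: prod_norm)
  also have "\<dots> \<le> (\<Prod>i\<in>A. exp (g i))" using assms by (intro prod_mono) auto
  finally show ?thesis using True by (simp add: exp_sum)
qed auto

text \<open>\<open>kappa_param\<close> also contains ln D, which stems from the power of D and from
  none of the Gamma factors; hence the subtraction.\<close>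

lemma sum_gamma_size:
  "(\<Sum>j=1..J. gamma_size (a j) s) - (\<Sum>k=1..K. gamma_size (a' k) s) =
     gamma'_param J a K a' * (Re (s * Ln s) - Re s) + (kappa_param D J a K a' - ln D) * Re s"
  unfolding gamma_size_def gamma'_param_def kappa_param_def
  by (simp add: sum_distrib_left[symmetric] sum_distrib_right[symmetric] sum.distrib sum_subtractf algebra_simps)

lemma sum_affine_size:
  "(\<Sum>j=1..J. affine_size (a j) s) - (\<Sum>k=1..K. affine_size (a' k) s) =
     gamma'_param J a K a' * (Re (s * Ln s) - Re s) + (kappa_param D J a K a' - ln D) * Re s
       - pi / 2 * (gamma_param J a K a' - gamma'_param J a K a') * \<bar>Im s\<bar>"
proof -
  have *: "(\<Sum>i=1..N. affine_size (x i) s) =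
     (\<Sum>i=1..N. gamma_size (x i) s) - pi / 2 * ((\<Sum>i=1..N. \<bar>x i\<bar>) - (\<Sum>i=1..N. x i)) * \<bar>Im s\<bar>"
    for N and x :: "nat \<Rightarrow> real"
    by (simp add: affine_size_def sum.distrib sum_subtractf sum_distrib_left sum_distrib_right algebra_simps
          diff_divide_distrib sum_divide_distrib)
  have "(\<Sum>j=1..J. affine_size (a j) s) - (\<Sum>k=1..K. affine_size (a' k) s) =
     (\<Sum>j=1..J. gamma_size (a j) s) - (\<Sum>k=1..K. gamma_size (a' k) s)
       - pi / 2 * (gamma_param J a K a' - gamma'_param J a K a') * \<bar>Im s\<bar>"
    unfolding * gamma_param_def gamma'_param_def by (simp add: algebra_simps)
  thus ?thesis unfolding sum_gamma_size[where D = D] .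
qed

lemma norm_powr_of_real:
  assumes "D > 0"
  shows "norm (of_real D powr s :: complex) = exp (ln D * Re s)"
  using assms by (simp add: powr_def Ln_of_real mult.commute)

text \<open>Designed for multiplication by \<gamma>' \<le> 0, which turns it into an upper bound.
  The argument of s is at most pi / 2 in absolute value, so replacing |s| by Re s costs no more than
  (pi/2) |Im s|.\<close>

lemma Re_mult_Ln_ge:
  assumes "Re s > 0"
  shows "Re (s * Ln s) \<ge> Re s * ln (Re s) - pi / 2 * \<bar>Im s\<bar>"
proof -
  have s: "s \<noteq> 0" using assms by auto
  have "Re (s * Ln s) = Re s * ln (norm s) - Im s * Im (Ln s)" using s by simp
  moreover have "Re s * ln (norm s) \<ge> Re s * ln (Re s)"
    using assms complex_Re_le_cmod[of s] by (intro mult_left_mono ln_mono) auto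
  moreover have "\<bar>Im s * Im (Ln s)\<bar> \<le> \<bar>Im s\<bar> * (pi / 2)" unfolding abs_mult
    using assms s Re_Ln_pos_le[of s] by (intro mult_left_mono) auto
  moreover have "\<bar>Im s\<bar> * (pi / 2) = pi / 2 * \<bar>Im s\<bar>" by simp
  ultimately show ?thesis by linarith
qed

section \<open>The Gamma quotient and its candidates for poles\<close>

locale gamma_type =
  fixes C D :: real and J K :: nat and a b a' b' :: "nat \<Rightarrow> real"
  assumes D_pos: "D > 0"
    and a_nonzero: "j \<in> {1..J} \<Longrightarrow> a j \<noteq> 0"
    and a'_nonzero: "k \<in> {1..K} \<Longrightarrow> a' k \<noteq> 0"
begin

abbreviation F :: "complex \<Rightarrow> complex" where "F \<equiv> gamma_type_fun C D J a b K a' b'"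
abbreviation \<gamma> :: real where "\<gamma> \<equiv> gamma_param J a K a'"
abbreviation \<gamma>' :: real where "\<gamma>' \<equiv> gamma'_param J a K a'"
abbreviation \<kappa> :: real where "\<kappa> \<equiv> kappa_param D J a K a'"

text \<open>The reciprocal Gamma factors are entire, so in this form only the numerator can produce
  exceptional points.\<close>

definition G :: "complex \<Rightarrow> complex" where
  "G s = of_real C * of_real D powr s * ((\<Prod>j=1..J. Gamma (of_real (a j) * s + of_real (b j))) *
       (\<Prod>k=1..K. rGamma (of_real (a' k) * s + of_real (b' k))))"

text \<open>A superset of the poles: zeros of the \<open>rGamma\<close> factors may cancel some of
  these points.\<close>

definition singularities :: "complex set" where
  "singularities = {s. \<exists>j\<in>{1..J}. of_real (a j) * s + of_real (b j) \<in> \<int>\<^sub>\<le>\<^sub>0}"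

lemma F_eq_remove_sings: "F = remove_sings G"
  unfolding gamma_type_fun_def G_def[abs_def]
  by (simp add: rGamma_inverse_Gamma divide_inverse prod_inversef[symmetric] o_def)

lemma F_eq_G:
  assumes "s \<notin> singularities"
  shows "F s = G s"
proof -
  have "G analytic_on {s}"
    unfolding G_def[abs_def] using assms D_pos
    by (intro analytic_intros) (auto simp: complex_nonpos_Reals_iff singularities_def)
  thus ?thesis unfolding F_eq_remove_sings by (rule remove_sings_at_analytic)
qed

lemma F_nicely_meromorphic: "F nicely_meromorphic_on A"
proof -
  have "(\<lambda>s. inverse (rGamma (of_real x * s + of_real y))) meromorphic_on A" for x y :: real
    by (intro meromorphic_intros analytic_on_imp_meromorphic_on analytic_intros)
  hence "(\<lambda>s. Gamma (of_real x * s + of_real y)) meromorphic_on A" for x y :: real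
    by (simp add: Gamma_def)
  hence "G meromorphic_on A"
    unfolding G_def[abs_def] using D_pos
    by (intro meromorphic_on_mult meromorphic_on_prod meromorphic_on_const)
       (auto intro!: analytic_on_imp_meromorphic_on analytic_intros simp: complex_nonpos_Reals_iff)
  thus ?thesis unfolding F_eq_remove_sings by (rule remove_sings_nicely_meromorphic)
qed

lemma F_analytic: "\<not> is_pole F s \<Longrightarrow> F analytic_on {s}"
  using nicely_meromorphic_on_imp_analytic_at[OF F_nicely_meromorphic UNIV_I] .

lemma F_isolated_singularity: "isolated_singularity_at F s"
  using F_nicely_meromorphic[of "{s}"] unfolding nicely_meromorphic_on_def
  by (blast intro: meromorphic_on_isolated_singularity)

lemma F_pole_singularity: "is_pole F s \<Longrightarrow> s \<in> singularities"
  using is_pole_gamma_type_fun[OF D_pos] by (simp add: singularities_def)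

lemma singularity_real: "s \<in> singularities \<Longrightarrow> Im s = 0"
  using a_nonzero by (force simp: singularities_def elim!: nonpos_Ints_cases simp: complex_eq_iff)

lemma F_pole_real: "is_pole F s \<Longrightarrow> s = of_real (Re s)"
  using singularity_real[OF F_pole_singularity] by (simp add: complex_eq_iff)

lemma singularity_lattice: "s \<in> singularities \<Longrightarrow> \<exists>j\<in>{1..J}. \<exists>n::int. a j * Re s + b j = of_int n"
  by (force simp: singularities_def elim!: nonpos_Ints_cases simp: complex_eq_iff)

definition integrand :: "real \<Rightarrow> complex \<Rightarrow> complex" where
  "integrand y s = exp (- (s * of_real y)) * F s"

lemma integrand_analytic: "\<not> is_pole F s \<Longrightarrow> integrand y analytic_on {s}"
  unfolding integrand_def[abs_def] by (intro analytic_intros F_analytic)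

lemma fY_pole_term_eq:
  "\<rho> \<in> pos_poles F \<Longrightarrow> fY_pole_term F y \<rho> = - residue (integrand y) (of_real \<rho>)"
  using fY_pole_term_eq_residue[OF F_isolated_singularity]
  by (simp add: pos_poles_def integrand_def[abs_def])

text \<open>All integers are to be avoided, not merely the nonpositive ones, because the sine in
  \<open>trig_part\<close> vanishes at each of them.\<close>

definition off_lattices :: "real \<Rightarrow> real \<Rightarrow> bool" where
  "off_lattices \<delta> x \<longleftrightarrow> (\<forall>j\<in>{1..J}. \<forall>n::int. \<delta> \<le> \<bar>a j * x + b j - of_int n\<bar>)"

definition far_exponent :: "real \<Rightarrow> complex \<Rightarrow> real" where
  "far_exponent M s = M * ln (norm s) + \<gamma>' * (Re s * ln (Re s) - Re s)
     + \<kappa> * Re s - pi / 2 * \<gamma> * \<bar>Im s\<bar>"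

lemma G_far_le:
  assumes g': "\<gamma>' \<le> 0" and \<delta>: "\<delta> > 0"
  obtains M \<sigma> where "\<sigma> \<ge> 3" "M \<ge> 0"
    "\<And>s. Re s \<ge> \<sigma> \<Longrightarrow> 1 \<le> \<bar>Im s\<bar> \<or> off_lattices \<delta> (Re s) \<Longrightarrow> norm (G s) \<le> \<bar>C\<bar> * exp (far_exponent M s)"
proof -
  have "\<forall>j\<in>{1..J}. \<exists>M \<sigma>. \<sigma> \<ge> 3 \<and> M \<ge> 0 \<and>
    (\<forall>s. Re s \<ge> \<sigma> \<longrightarrow> 1 \<le> \<bar>Im s\<bar> \<or> (\<forall>n::int. \<delta> \<le> \<bar>a j * Re s + b j - of_int n\<bar>) \<longrightarrow>
       norm (Gamma (of_real (a j) * s + of_real (b j))) \<le> exp (affine_size (a j) s + M * ln (norm s)))"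
    by (intro ballI, rule Gamma_affine_far_le[OF a_nonzero \<delta>], assumption) blast
  then obtain M1 \<sigma>1 where 1: "\<And>j. j \<in> {1..J} \<Longrightarrow> \<sigma>1 j \<ge> 3" "\<And>j. j \<in> {1..J} \<Longrightarrow> M1 j \<ge> 0"
    "\<And>j s. j \<in> {1..J} \<Longrightarrow> Re s \<ge> \<sigma>1 j \<Longrightarrow> 1 \<le> \<bar>Im s\<bar> \<or> (\<forall>n::int. \<delta> \<le> \<bar>a j * Re s + b j - of_int n\<bar>) \<Longrightarrow>
       norm (Gamma (of_real (a j) * s + of_real (b j))) \<le> exp (affine_size (a j) s + M1 j * ln (norm s))"
    by metis
  have "\<forall>k\<in>{1..K}. \<exists>M \<sigma>. \<sigma> \<ge> 3 \<and> M \<ge> 0 \<and> (\<forall>s. Re s \<ge> \<sigma> \<longrightarrow>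
       norm (rGamma (of_real (a' k) * s + of_real (b' k))) \<le> exp (- affine_size (a' k) s + M * ln (norm s)))"
    by (intro ballI, rule rGamma_affine_far_le[OF a'_nonzero], assumption) blast
  then obtain M2 \<sigma>2 where 2: "\<And>k. k \<in> {1..K} \<Longrightarrow> \<sigma>2 k \<ge> 3" "\<And>k. k \<in> {1..K} \<Longrightarrow> M2 k \<ge> 0"
    "\<And>k s. k \<in> {1..K} \<Longrightarrow> Re s \<ge> \<sigma>2 k \<Longrightarrow>
       norm (rGamma (of_real (a' k) * s + of_real (b' k))) \<le> exp (- affine_size (a' k) s + M2 k * ln (norm s))"
    by metis
  define M where "M = (\<Sum>j=1..J. M1 j) + (\<Sum>k=1..K. M2 k)"
  define \<sigma> where "\<sigma> = 3 + (\<Sum>j=1..J. \<sigma>1 j) + (\<Sum>k=1..K. \<sigma>2 k)"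
  have p: "0 \<le> \<sigma>1 j" if "j \<in> {1..J}" for j using 1(1)[OF that] by simp
  have q: "0 \<le> \<sigma>2 k" if "k \<in> {1..K}" for k using 2(1)[OF that] by simp
  have pq: "0 \<le> (\<Sum>j=1..J. \<sigma>1 j)" "0 \<le> (\<Sum>k=1..K. \<sigma>2 k)" using p q by (auto intro!: sum_nonneg)
  have \<sigma>1: "\<sigma>1 j \<le> \<sigma>" if "j \<in> {1..J}" for j
    using member_le_sum[OF that, of \<sigma>1] p pq by (auto simp: \<sigma>_def)
  have \<sigma>2: "\<sigma>2 k \<le> \<sigma>" if "k \<in> {1..K}" for k
    using member_le_sum[OF that, of \<sigma>2] q pq by (auto simp: \<sigma>_def)
  show ?thesis
  proof (rule that[of \<sigma> M])
    show "\<sigma> \<ge> 3" using pq by (simp add: \<sigma>_def)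
    show "M \<ge> 0" unfolding M_def using 1(2) 2(2) by (intro add_nonneg_nonneg sum_nonneg) auto
    fix s :: complex
    assume s: "Re s \<ge> \<sigma>" and good: "1 \<le> \<bar>Im s\<bar> \<or> off_lattices \<delta> (Re s)"
    have s0: "Re s > 0" using s \<open>\<sigma> \<ge> 3\<close> by simp
    define L where "L = ln (norm s)"
    let ?e1 = "\<Sum>j=1..J. affine_size (a j) s + M1 j * L"
    let ?e2 = "\<Sum>k=1..K. - affine_size (a' k) s + M2 k * L"
    have b1: "norm (\<Prod>j=1..J. Gamma (of_real (a j) * s + of_real (b j))) \<le> exp ?e1"
      unfolding L_def using good s \<sigma>1
      by (intro prod_norm_le_exp_sum 1(3)) (auto simp: off_lattices_def intro: order.trans)
    have b2: "norm (\<Prod>k=1..K. rGamma (of_real (a' k) * s + of_real (b' k))) \<le> exp ?e2"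
      unfolding L_def using s \<sigma>2 by (intro prod_norm_le_exp_sum 2(3)) (auto intro: order.trans)
    have "norm (G s) \<le> \<bar>C\<bar> * exp (ln D * Re s) * (exp ?e1 * exp ?e2)"
      unfolding G_def norm_mult norm_powr_of_real[OF D_pos] norm_of_real
      by (intro mult_mono b1 b2) auto
    also have "\<dots> = \<bar>C\<bar> * exp (ln D * Re s + (?e1 + ?e2))" by (simp add: exp_add)
    also have "?e1 + ?e2 = ((\<Sum>j=1..J. affine_size (a j) s) - (\<Sum>k=1..K. affine_size (a' k) s)) + M * L"
      by (simp add: M_def sum.distrib sum_subtractf sum_distrib_left sum_distrib_right algebra_simps)
    also have "\<bar>C\<bar> * exp (ln D * Re s + \<dots>) \<le> \<bar>C\<bar> * exp (far_exponent M s)"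
    proof (intro mult_left_mono, subst exp_le_cancel_iff)
      \<comment> \<open>The terms in |Im s| add up to the decay: -(pi/2) (\<gamma> - \<gamma>') from
        \<open>sum_affine_size\<close> and -(pi/2) \<gamma>' from this inequality leave -(pi/2)
        \<gamma>.\<close>
      have "\<gamma>' * Re (s * Ln s) \<le> \<gamma>' * (Re s * ln (Re s) - pi / 2 * \<bar>Im s\<bar>)"
        using g' Re_mult_Ln_ge[OF s0] by (intro mult_left_mono_neg) auto
      thus "ln D * Re s + ((\<Sum>j=1..J. affine_size (a j) s) - (\<Sum>k=1..K. affine_size (a' k) s) + M * L)
          \<le> far_exponent M s"
        unfolding sum_affine_size[where D = D] far_exponent_def
        by (simp add: L_def algebra_simps diff_divide_distrib add_divide_distrib)
    qed auto
    finally show "norm (G s) \<le> \<bar>C\<bar> * exp (far_exponent M s)" .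
  qed
qed

text \<open>This supplies integrability on single vertical lines and the vanishing of the horizontal
  sides of the contour, whereas \<open>G_far_le\<close> serves the limit of lines moving to the
  right.\<close>

lemma G_strip_le:
  obtains M B where "M \<ge> 0" "B > 0"
    "\<And>s. \<bar>Re s\<bar> \<le> R \<Longrightarrow> 1 \<le> \<bar>Im s\<bar> \<Longrightarrow> norm (G s) \<le> B *
         exp (M * ln (3 + \<bar>Im s\<bar>) - pi / 2 * \<gamma> * \<bar>Im s\<bar>)"
proof -
  have "\<forall>j\<in>{1..J}. \<exists>M. M \<ge> 0 \<and>
    (\<forall>s. \<bar>Re s\<bar> \<le> R \<longrightarrow> 1 \<le> \<bar>Im s\<bar> \<longrightarrow>
       norm (Gamma (of_real (a j) * s + of_real (b j))) \<le> exp (- (pi / 2 * \<bar>a j\<bar> * \<bar>Im s\<bar>) + M * ln (3 + \<bar>Im s\<bar>)))"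
    by (intro ballI, rule Gamma_affine_strip[OF a_nonzero], assumption) blast
  then obtain M1 where 1: "\<And>j. j \<in> {1..J} \<Longrightarrow> M1 j \<ge> 0"
    "\<And>j s. j \<in> {1..J} \<Longrightarrow> \<bar>Re s\<bar> \<le> R \<Longrightarrow> 1 \<le> \<bar>Im s\<bar> \<Longrightarrow>
       norm (Gamma (of_real (a j) * s + of_real (b j))) \<le> exp (- (pi / 2 * \<bar>a j\<bar> * \<bar>Im s\<bar>) + M1 j * ln (3 + \<bar>Im s\<bar>))"
    by metis
  have "\<forall>k\<in>{1..K}. \<exists>M. M \<ge> 0 \<and>
    (\<forall>s. \<bar>Re s\<bar> \<le> R \<longrightarrow> 1 \<le> \<bar>Im s\<bar> \<longrightarrow>
       norm (rGamma (of_real (a' k) * s + of_real (b' k))) \<le> exp (pi / 2 * \<bar>a' k\<bar> * \<bar>Im s\<bar> + M * ln (3 + \<bar>Im s\<bar>)))"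
    by (intro ballI, rule Gamma_affine_strip[OF a'_nonzero], assumption) blast
  then obtain M2 where 2: "\<And>k. k \<in> {1..K} \<Longrightarrow> M2 k \<ge> 0"
    "\<And>k s. k \<in> {1..K} \<Longrightarrow> \<bar>Re s\<bar> \<le> R \<Longrightarrow> 1 \<le> \<bar>Im s\<bar> \<Longrightarrow>
       norm (rGamma (of_real (a' k) * s + of_real (b' k))) \<le> exp (pi / 2 * \<bar>a' k\<bar> * \<bar>Im s\<bar> + M2 k * ln (3 + \<bar>Im s\<bar>))"
    by metis
  define M where "M = (\<Sum>j=1..J. M1 j) + (\<Sum>k=1..K. M2 k)"
  show ?thesis
  proof (rule that[of M "(\<bar>C\<bar> + 1) * exp (\<bar>ln D\<bar> * R)"])
    show "M \<ge> 0" unfolding M_def using 1(1) 2(1) by (intro add_nonneg_nonneg sum_nonneg) auto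
    fix s :: complex
    assume s: "\<bar>Re s\<bar> \<le> R" "1 \<le> \<bar>Im s\<bar>"
    define t L where "t = \<bar>Im s\<bar>" and "L = ln (3 + \<bar>Im s\<bar>)"
    let ?e1 = "\<Sum>j=1..J. - (pi / 2 * \<bar>a j\<bar> * t) + M1 j * L"
    let ?e2 = "\<Sum>k=1..K. pi / 2 * \<bar>a' k\<bar> * t + M2 k * L"
    have b1: "norm (\<Prod>j=1..J. Gamma (of_real (a j) * s + of_real (b j))) \<le> exp ?e1"
      unfolding t_def L_def by (rule prod_norm_le_exp_sum, rule 1(2)) (use s in auto)
    have b2: "norm (\<Prod>k=1..K. rGamma (of_real (a' k) * s + of_real (b' k))) \<le> exp ?e2"
      unfolding t_def L_def by (rule prod_norm_le_exp_sum, rule 2(2)) (use s in auto)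
    have "ln D * Re s \<le> \<bar>ln D * Re s\<bar>" by simp
    also have "\<dots> \<le> \<bar>ln D\<bar> * R" unfolding abs_mult using s by (intro mult_left_mono) auto
    finally have "norm (G s) \<le> (\<bar>C\<bar> + 1) * exp (\<bar>ln D\<bar> * R) * (exp ?e1 * exp ?e2)"
      unfolding G_def norm_mult norm_powr_of_real[OF D_pos] norm_of_real
      by (intro mult_mono b1 b2) auto
    also have "exp ?e1 * exp ?e2 = exp (?e1 + ?e2)" by (simp add: exp_add)
    also have "?e1 + ?e2 = M * L - pi / 2 * \<gamma> * t"
    proof -
      have "?e1 = - (pi / 2 * t * (\<Sum>j=1..J. \<bar>a j\<bar>)) + (\<Sum>j=1..J. M1 j) * L"
        by (simp only: sum.distrib sum_negf sum_distrib_left sum_distrib_right mult_ac)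
      moreover have "?e2 = pi / 2 * t * (\<Sum>k=1..K. \<bar>a' k\<bar>) + (\<Sum>k=1..K. M2 k) * L"
        by (simp only: sum.distrib sum_negf sum_distrib_left sum_distrib_right mult_ac)
      ultimately show ?thesis by (simp only: M_def gamma_param_def) (simp add: algebra_simps)
    qed
    finally show "norm (G s) \<le> (\<bar>C\<bar> + 1) * exp (\<bar>ln D\<bar> * R) *
         exp (M * ln (3 + \<bar>Im s\<bar>) - pi / 2 * \<gamma> * \<bar>Im s\<bar>)"
      by (simp add: t_def L_def)
  qed auto
qed

end

section \<open>Convergence of the pole sums\<close>

lemma ln_1_plus_le_linear:
  assumes "M \<ge> 0" "c > 0"
  obtains B :: real where "\<And>t. t \<ge> 0 \<Longrightarrow> M * ln (1 + t) \<le> B + c * t"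
proof -
  \<comment> \<open>The inequality ln (u \<epsilon>) \<le> u \<epsilon> - 1 is applied to u = 1 + t;
    this \<epsilon> makes the slope M \<epsilon> at most c.\<close>
  define \<epsilon> where "\<epsilon> = c / (M + 1)"
  have \<epsilon>: "\<epsilon> > 0" "M * \<epsilon> \<le> c" using assms by (auto simp: \<epsilon>_def field_simps)
  have "M * ln (1 + t) \<le> (c - M * ln \<epsilon>) + c * t" if t: "t \<ge> 0" for t
  proof -
    have "ln ((1 + t) * \<epsilon>) \<le> (1 + t) * \<epsilon> - 1" using t \<epsilon> by (intro ln_le_minus_one) auto
    moreover have "ln ((1 + t) * \<epsilon>) = ln (1 + t) + ln \<epsilon>" using t \<epsilon> by (intro ln_mult_pos) auto
    ultimately have "ln (1 + t) \<le> (1 + t) * \<epsilon> - ln \<epsilon>" by linarith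
    hence "M * ln (1 + t) \<le> M * ((1 + t) * \<epsilon> - ln \<epsilon>)" using assms by (intro mult_left_mono) auto
    also have "\<dots> = M * \<epsilon> * (1 + t) - M * ln \<epsilon>" by (simp add: algebra_simps)
    also have "\<dots> \<le> c * (1 + t) - M * ln \<epsilon>" using \<epsilon> t by (intro diff_right_mono mult_right_mono) auto
    finally show ?thesis by (simp add: algebra_simps)
  qed
  thus ?thesis by (rule that)
qed

definition line_weight :: "real \<Rightarrow> real \<Rightarrow> real \<Rightarrow> real" where
  "line_weight M c t = exp (M * ln (1 + \<bar>t\<bar>) - c * \<bar>t\<bar>)"

lemma line_weight_le:
  assumes "M \<ge> 0" "c > 0"
  obtains B where "B > 0" "\<And>t. line_weight M c t \<le> B / (1 + t^2)"
proof -
  \<comment> \<open>Two powers of 1 + |t| more than in the weight are taken into account; they pay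
    for the denominator 1 + t^2.\<close>
  obtain B where B: "\<And>t. t \<ge> 0 \<Longrightarrow> (M + 2) * ln (1 + t) \<le> B + c * t"
    using ln_1_plus_le_linear[of "M + 2" c] assms by auto
  have "line_weight M c t \<le> exp B / (1 + t^2)" for t
  proof -
    have "1 + t^2 \<le> (1 + \<bar>t\<bar>)^2" by (simp add: power2_eq_square algebra_simps)
    also have "\<dots> = exp (2 * ln (1 + \<bar>t\<bar>))" by (simp add: exp_double)
    finally have "line_weight M c t * (1 + t^2) \<le> line_weight M c t * exp (2 * ln (1 + \<bar>t\<bar>))"
      by (intro mult_left_mono) (auto simp: line_weight_def)
    also have "\<dots> = exp ((M + 2) * ln (1 + \<bar>t\<bar>) - c * \<bar>t\<bar>)"
      unfolding line_weight_def exp_add[symmetric] by (simp add: algebra_simps)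
    also have "\<dots> \<le> exp B" using B[of "\<bar>t\<bar>"] by simp
    finally show ?thesis by (subst pos_le_divide_eq) (auto simp: add_pos_nonneg)
  qed
  thus ?thesis using that[of "exp B"] by simp
qed

lemma line_weight_integrable:
  assumes "M \<ge> 0" "c > 0"
  shows "integrable lborel (line_weight M c)"
proof -
  obtain B where B: "B > 0" "\<And>t. line_weight M c t \<le> B / (1 + t^2)"
    using line_weight_le[OF assms] by auto
  have "integrable lborel (\<lambda>t. inverse (1 + t^2) :: real)"
    using integrable_inverse_1_plus_square by (simp add: set_integrable_def)
  hence i: "integrable lborel (\<lambda>t. B * inverse (1 + t^2))" by (rule integrable_mult_right)
  show ?thesis
  proof (rule Bochner_Integration.integrable_bound[OF i])
    show "line_weight M c \<in> borel_measurable lborel" unfolding line_weight_def[abs_def] by measurable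
    show "AE x in lborel. norm (line_weight M c x) \<le> norm (B * inverse (1 + x^2))"
    proof (intro AE_I2)
      fix x :: real
      have "norm (line_weight M c x) \<le> B / (1 + x^2)" using B(2)[of x] by (simp add: line_weight_def)
      also have "\<dots> \<le> norm (B * inverse (1 + x^2))" by (simp add: divide_inverse)
      finally show "norm (line_weight M c x) \<le> norm (B * inverse (1 + x^2))" .
    qed
  qed
qed

lemma line_weight_tendsto_0:
  assumes "M \<ge> 0" "c > 0"
  shows "(line_weight M c \<longlongrightarrow> 0) at_top"
proof -
  obtain B where B: "B > 0" "\<And>t. line_weight M c t \<le> B / (1 + t^2)"
    using line_weight_le[OF assms] by auto
  have "((\<lambda>t. B / (1 + t^2)) \<longlongrightarrow> 0) at_top" by real_asymp
  thus ?thesis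
    by (rule Lim_null_comparison[rotated]) (use B(2) in \<open>auto simp: line_weight_def\<close>)
qed

lemma integrable_line:
  fixes f :: "real \<Rightarrow> complex"
  assumes cont: "continuous_on UNIV f" and Mc: "M \<ge> 0" "c > 0"
    and bound: "\<And>t. \<bar>t\<bar> \<ge> 1 \<Longrightarrow> norm (f t) \<le> W * line_weight M c t"
  shows "integrable lborel f"
proof -
  have "compact (f ` {-1..1})" by (intro compact_continuous_image continuous_on_subset[OF cont]) auto
  then obtain B where B: "\<And>t. t \<in> {-1..1} \<Longrightarrow> norm (f t) \<le> B"
    using compact_imp_bounded[of "f ` {-1..1}"] unfolding bounded_iff by blast
  have B0: "B \<ge> 0" using order.trans[OF norm_ge_zero B[of 0]] by simp
  have i: "integrable lborel (\<lambda>t. B * indicator {-1..1} t + \<bar>W\<bar> * line_weight M c t)"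
    by (intro Bochner_Integration.integrable_add integrable_mult_right line_weight_integrable Mc) auto
  show ?thesis
  proof (rule Bochner_Integration.integrable_bound[OF i])
    show "f \<in> borel_measurable lborel" using cont by (simp add: borel_measurable_continuous_onI)
    show "AE t in lborel. norm (f t) \<le> norm (B * indicator {-1..1} t + \<bar>W\<bar> * line_weight M c t)"
    proof (intro AE_I2)
      fix t :: real
      have w: "0 \<le> line_weight M c t" by (simp add: line_weight_def)
      have "norm (f t) \<le> B * indicator {-1..1} t + \<bar>W\<bar> * line_weight M c t"
      proof (cases "t \<in> {-1..1}")
        case True
        thus ?thesis using B[OF True] w by (simp add: add_increasing2)
      next
        case False
        hence "norm (f t) \<le> W * line_weight M c t" by (intro bound) auto
        also have "\<dots> \<le> \<bar>W\<bar> * line_weight M c t" using w by (intro mult_right_mono) auto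
        finally show ?thesis using False by simp
      qed
      thus "norm (f t) \<le> norm (B * indicator {-1..1} t + \<bar>W\<bar> * line_weight M c t)" by simp
    qed
  qed
qed

section \<open>Points away from the lattices of candidate poles\<close>

lemma finite_affine_ints:
  assumes "\<And>j. j \<in> {1..J::nat} \<Longrightarrow> a j \<noteq> (0::real)"
  shows "finite {x. u \<le> x \<and> x \<le> v \<and> (\<exists>j\<in>{1..J}. \<exists>n::int. a j * x + b j = of_int n)}"
proof -
  define B where "B j = \<bar>a j\<bar> * (\<bar>u\<bar> + \<bar>v\<bar>) + \<bar>b j\<bar>" for j
  have fin: "finite {n::int. \<bar>of_int n\<bar> \<le> B j}" for j
  proof (rule finite_subset)
    show "{n::int. \<bar>of_int n\<bar> \<le> B j} \<subseteq> {-\<lceil>B j\<rceil>..\<lceil>B j\<rceil>}"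
      by (auto simp: abs_le_iff) linarith+
  qed auto
  have "{x. u \<le> x \<and> x \<le> v \<and> (\<exists>j\<in>{1..J}. \<exists>n::int. a j * x + b j = of_int n)} \<subseteq>
    (\<Union>j\<in>{1..J}. (\<lambda>n. (of_int n - b j) / a j) ` {n::int. \<bar>of_int n\<bar> \<le> B j})"
  proof safe
    fix x j n assume x: "u \<le> x" "x \<le> v" "j \<in> {1..J}" "a j * x + b j = of_int n"
    have "\<bar>of_int n :: real\<bar> \<le> \<bar>a j\<bar> * \<bar>x\<bar> + \<bar>b j\<bar>"
      unfolding x(4)[symmetric] using abs_triangle_ineq[of "a j * x" "b j"] by (simp add: abs_mult)
    also have "\<dots> \<le> B j" unfolding B_def using x(1,2) by (intro add_mono mult_left_mono) auto
    finally have "\<bar>of_int n :: real\<bar> \<le> B j" .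
    moreover have "x = (of_int n - b j) / a j" using assms[OF x(3)] x(4) by (simp add: field_simps)
    ultimately show "x \<in> (\<Union>j\<in>{1..J}. (\<lambda>n. (of_int n - b j) / a j) ` {n::int. \<bar>of_int n\<bar> \<le> B j})"
      using x(3) by blast
  qed
  thus ?thesis by (rule finite_subset) (use fin in auto)
qed

text \<open>
  Among \<open>J + 1\<close> sufficiently close equidistant points each of the \<open>J\<close> affine functions can be near an
  integer at one point at most.
\<close>

lemma nearby_point_off_lattices:
  assumes a: "\<And>j. j \<in> {1..J::nat} \<Longrightarrow> a j \<noteq> (0::real)" and \<delta>: "\<delta> > (0::real)"
  obtains \<epsilon> where "\<epsilon> > 0"
    "\<And>R. \<exists>R'. R \<le> R' \<and> R' < R + \<delta> \<and> (\<forall>j\<in>{1..J}. \<forall>n::int. \<epsilon> \<le> \<bar>a j * R' + b j - of_int n\<bar>)"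
proof -
  define A where "A = 1 + (\<Sum>j=1..J. \<bar>a j\<bar>)"
  have A1: "A \<ge> 1" by (auto simp: A_def intro!: sum_nonneg)
  have A: "\<bar>a j\<bar> \<le> A" if "j \<in> {1..J}" for j
    using member_le_sum[OF that, of "\<lambda>j. \<bar>a j\<bar>"] by (simp add: A_def)
  define m where "m = Min (insert 1 ((\<lambda>j. \<bar>a j\<bar>) ` {1..J}))"
  have m: "m > 0" "m \<le> 1" unfolding m_def using a by (auto simp: Min_gr_iff)
  have ma: "m \<le> \<bar>a j\<bar>" if "j \<in> {1..J}" for j unfolding m_def using that by (intro Min_le) auto
  \<comment> \<open>For two of the points sharing the index j, the values of a j x differ by at
    least m h and at most A h J \<le> 1/2. If both are within \<epsilon> of integers after adding b
    j, these integers coincide, so the difference is below 2 \<epsilon>, contrary to 4 \<epsilon>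
    \<le> m h. The first entry of the minimum keeps all points within \<delta>.\<close>
  define h where "h = min (\<delta> / (real J + 1)) (1 / (2 * A * (real J + 1)))"
  have h: "h > 0" "h * real J < \<delta>" "A * h * real J \<le> 1 / 2"
  proof -
    show "h > 0" using \<delta> A1 by (auto simp: h_def)
    have "h * real J \<le> \<delta> / (real J + 1) * real J" by (intro mult_right_mono) (auto simp: h_def)
    also have "\<dots> < \<delta>" using \<delta> by (simp add: field_simps)
    finally show "h * real J < \<delta>" .
    have "A * h * real J \<le> A * (1 / (2 * A * (real J + 1))) * real J"
      using A1 by (intro mult_right_mono mult_left_mono) (auto simp: h_def)
    also have "\<dots> = real J / (2 * (real J + 1))" using A1 by (simp add: divide_simps)
    also have "\<dots> \<le> 1 / 2" by (simp add: field_simps)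
    finally show "A * h * real J \<le> 1 / 2" .
  qed
  define \<epsilon> where "\<epsilon> = min (1/8) (m * h / 4)"
  have \<epsilon>: "\<epsilon> > 0" "\<epsilon> \<le> 1/8" "4 * \<epsilon> \<le> m * h" using m h by (auto simp: \<epsilon>_def)
  have "\<exists>R'. R \<le> R' \<and> R' < R + \<delta> \<and> (\<forall>j\<in>{1..J}. \<forall>n::int. \<epsilon> \<le> \<bar>a j * R' + b j - of_int n\<bar>)" for R
  proof (rule ccontr)
    assume neg: "\<not> ?thesis"
    have "\<exists>j\<in>{1..J}. \<exists>n::int. \<bar>a j * (R + real i * h) + b j - of_int n\<bar> < \<epsilon>" if i: "i \<in> {0..J}" for i
    proof -
      have "real i * h \<le> h * real J" using i h by (simp add: mult.commute)
      hence "R + real i * h < R + \<delta>" using h(2) by linarith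
      moreover have "R \<le> R + real i * h" using h(1) by simp
      ultimately show ?thesis using neg by (meson not_le)
    qed
    hence "\<forall>i\<in>{0..J}. \<exists>z. fst z \<in> {1..J} \<and> \<bar>a (fst z) * (R + real i * h) + b (fst z) - of_int (snd z)\<bar> < \<epsilon>"
      by (auto simp: Bex_def)
    from bchoice[OF this] obtain z where z: "\<forall>i\<in>{0..J}. fst (z i) \<in> {1..J} \<and>
        \<bar>a (fst (z i)) * (R + real i * h) + b (fst (z i)) - of_int (snd (z i))\<bar> < \<epsilon>" by (elim exE)
    define jf nf where "jf i = fst (z i)" and "nf i = snd (z i)" for i
    have jn: "jf i \<in> {1..J}" "\<bar>a (jf i) * (R + real i * h) + b (jf i) - of_int (nf i)\<bar> < \<epsilon>" if "i \<in> {0..J}" for i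
      using z that by (auto simp: jf_def nf_def)
    have "jf ` {0..J} \<subseteq> {1..J}" by (rule image_subsetI) (rule jn(1))
    hence "card (jf ` {0..J}) \<le> card {1..J}" by (rule card_mono[rotated]) simp
    hence "card (jf ` {0..J}) < card {0..J}" by simp
    hence "\<not> inj_on jf {0..J}" by (rule pigeonhole)
    then obtain p' q' where pq': "p' \<in> {0..J}" "q' \<in> {0..J}" "jf p' = jf q'" "p' \<noteq> q'"
      unfolding inj_on_def by blast
    define p q where "p = min p' q'" and "q = max p' q'"
    have pq: "p \<in> {0..J}" "q \<in> {0..J}" "jf p = jf q" "p < q"
      using pq' by (auto simp: p_def q_def min_def max_def)
    define j where "j = jf p"
    have j: "j \<in> {1..J}" unfolding j_def by (rule jn(1)[OF pq(1)])
    define x where "x = a j * (real (q - p) * h)"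
    have ax: "\<bar>x\<bar> = \<bar>a j\<bar> * (real (q - p) * h)" using h by (simp add: x_def abs_mult)
    have "a j * (R + real q * h) - a j * (R + real p * h) = x"
      using pq by (simp add: x_def of_nat_diff algebra_simps)
    hence near: "\<bar>x - of_int (nf q - nf p)\<bar> < 2 * \<epsilon>"
      using jn(2)[OF pq(1)] jn(2)[OF pq(2)] unfolding pq(3)[symmetric] j_def[symmetric] by simp
    have "m * (1 * h) \<le> \<bar>x\<bar>" unfolding ax
      using ma[OF j] pq h m by (intro mult_mono) auto
    hence lo: "4 * \<epsilon> \<le> \<bar>x\<bar>" using \<epsilon> by simp
    have "\<bar>x\<bar> \<le> A * (real J * h)" unfolding ax
      using A[OF j] pq h A1 by (intro mult_mono) auto
    hence hi: "\<bar>x\<bar> \<le> 1/2" using h by (simp add: mult_ac)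
    have "\<bar>of_int (nf q - nf p) :: real\<bar> < 1" using near hi \<epsilon> by linarith
    hence "nf q - nf p = 0" by linarith
    thus False using near lo \<epsilon> by simp
  qed
  thus ?thesis using that \<epsilon>(1) by blast
qed

lemma exp_growth_tendsto_0:
  fixes M g \<kappa> y :: real
  assumes "g < 0 \<or> (g = 0 \<and> \<kappa> < y)"
  shows "((\<lambda>R. exp (M * ln R + g * (R * ln R - R) + (\<kappa> - y) * R)) \<longlongrightarrow> 0) at_top"
proof (cases "g = 0")
  case True
  hence "\<kappa> - y < 0" using assms by simp
  hence "((\<lambda>R. exp (M * ln R + (\<kappa> - y) * R)) \<longlongrightarrow> 0) at_top" by real_asymp
  thus ?thesis using True by simp
next
  case False
  hence "g < 0" using assms by simp
  thus ?thesis by real_asymp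
qed

section \<open>The inversion integral and its shift to the right\<close>

context gamma_type
begin

definition decay :: real where "decay = pi / 2 * \<gamma>"

lemma strip_le_line_weight:
  obtains M W where "M \<ge> 0" "\<And>s. \<bar>Re s\<bar> \<le> R \<Longrightarrow> 1 \<le> \<bar>Im s\<bar> \<Longrightarrow>
    norm (F s) \<le> W * line_weight M decay (Im s) \<and> norm (integrand y s) \<le> W * line_weight M decay (Im s)"
proof -
  obtain M B where MB: "M \<ge> 0" "B > 0" "\<And>s. \<bar>Re s\<bar> \<le> R \<Longrightarrow> 1 \<le> \<bar>Im s\<bar> \<Longrightarrow> norm (G s) \<le> B *
       exp (M * ln (3 + \<bar>Im s\<bar>) - pi / 2 * \<gamma> * \<bar>Im s\<bar>)"
    by (rule G_strip_le[where R = R], rule that, assumption, assumption, blast)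
  define W where "W = B * exp (M * ln 3)"
  define W' where "W' = W * exp (R * \<bar>y\<bar>)"
  have "norm (F s) \<le> W' * line_weight M decay (Im s) \<and> norm (integrand y s) \<le> W' * line_weight M decay (Im s)"
    if s: "\<bar>Re s\<bar> \<le> R" "1 \<le> \<bar>Im s\<bar>" for s
  proof -
    have "s \<notin> singularities" using singularity_real s by force
    hence "norm (F s) \<le> B * exp (M * ln (3 + \<bar>Im s\<bar>) - decay * \<bar>Im s\<bar>)"
      using MB(3)[OF s] by (simp add: F_eq_G decay_def)
    also have "\<dots> \<le> B * exp (M * (ln 3 + ln (1 + \<bar>Im s\<bar>)) - decay * \<bar>Im s\<bar>)"
    proof -
      have "ln (3 + \<bar>Im s\<bar>) \<le> ln (3 * (1 + \<bar>Im s\<bar>))" by (intro ln_mono) auto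
      also have "\<dots> = ln 3 + ln (1 + \<bar>Im s\<bar>)" by (intro ln_mult_pos) auto
      finally have "M * ln (3 + \<bar>Im s\<bar>) \<le> M * (ln 3 + ln (1 + \<bar>Im s\<bar>))" using MB(1) by (rule mult_left_mono)
      thus ?thesis using MB(2) by (intro mult_left_mono) auto
    qed
    also have "\<dots> = W * line_weight M decay (Im s)"
      unfolding W_def line_weight_def mult.assoc exp_add[symmetric] by (simp add: algebra_simps)
    finally have 1: "norm (F s) \<le> W * line_weight M decay (Im s)" .
    have "- (Re s * y) \<le> \<bar>Re s * y\<bar>" by simp
    also have "\<dots> \<le> R * \<bar>y\<bar>" unfolding abs_mult using s by (intro mult_right_mono) auto
    finally have "exp (- (Re s * y)) \<le> exp (R * \<bar>y\<bar>)" by simp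
    hence "norm (integrand y s) \<le> exp (R * \<bar>y\<bar>) * (W * line_weight M decay (Im s))"
      unfolding integrand_def norm_mult using 1 by (intro mult_mono) auto
    moreover have "W * line_weight M decay (Im s) * 1 \<le> W * line_weight M decay (Im s) * exp (R * \<bar>y\<bar>)"
      using s MB(2) by (intro mult_left_mono) (auto simp: W_def line_weight_def)
    ultimately show ?thesis using 1 by (simp add: W'_def mult_ac)
  qed
  thus ?thesis by (intro that[of M W'] MB(1))
qed

lemma line_integrable:
  assumes \<gamma>: "\<gamma> > 0" and x: "\<And>t. \<not> is_pole F (Complex x t)"
  shows "integrable lborel (\<lambda>t. integrand y (Complex x t))" "integrable lborel (\<lambda>t. F (Complex x t))"
proof -
  have c: "decay > 0" using \<gamma> by (simp add: decay_def)
  have cont: "continuous_on UNIV (\<lambda>t. g (Complex x t))" if "\<And>t. g analytic_on {Complex x t}" for g :: "complex \<Rightarrow> complex"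
  proof -
    have "continuous_on UNIV (Complex x)" unfolding Complex_eq by (intro continuous_intros)
    moreover have "continuous_on (range (Complex x)) g"
      using that by (intro holomorphic_on_imp_continuous_on analytic_imp_holomorphic)
        (auto simp: analytic_on_analytic_at[of _ "range _"])
    ultimately show ?thesis by (intro continuous_on_compose2[of "range (Complex x)" g UNIV "Complex x"]) auto
  qed
  obtain M W where MW: "M \<ge> 0" "\<And>s. \<bar>Re s\<bar> \<le> \<bar>x\<bar> \<Longrightarrow> 1 \<le> \<bar>Im s\<bar> \<Longrightarrow>
    norm (F s) \<le> W * line_weight M decay (Im s) \<and> norm (integrand y s) \<le> W * line_weight M decay (Im s)"
    by (rule strip_le_line_weight[of "\<bar>x\<bar>" y]; rule that; blast)
  show "integrable lborel (\<lambda>t. integrand y (Complex x t))"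
    by (rule integrable_line[OF cont[of "integrand y", OF integrand_analytic[OF x]] MW(1) c, of W]) (use MW(2)[of "Complex x _"] in auto)
  show "integrable lborel (\<lambda>t. F (Complex x t))"
    by (rule integrable_line[OF cont[of F, OF F_analytic[OF x]] MW(1) c, of W]) (use MW(2)[of "Complex x _"] in auto)
qed

definition pole_partial_sum :: "real \<Rightarrow> real \<Rightarrow> complex" where
  "pole_partial_sum y R = (\<Sum>\<rho>\<in>{\<rho>\<in>pos_poles F. \<rho> \<le> R}. fY_pole_term F y \<rho>)"

text \<open>The terms are the negatives of the residues of the integrand, so the partial sum is the
  line at \<sigma> minus the line at R. The condition on \<sigma> makes the poles crossed exactly
  the positive ones up to R.\<close>

lemma pole_partial_sum_eq_line_integrals:
  assumes \<gamma>: "\<gamma> > 0" and \<sigma>: "\<And>t. \<not> is_pole F (Complex \<sigma> t)"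
    "\<And>\<rho>::real. is_pole F (of_real \<rho>) \<Longrightarrow> \<rho> > 0 \<longleftrightarrow> \<rho> > \<sigma>"
    and R: "R > \<sigma>" "R > 0" "\<not> is_pole F (of_real R)"
  shows "2 * pi * pole_partial_sum y R =
    (CLBINT t. integrand y (Complex \<sigma> t)) - (CLBINT t. integrand y (Complex R t))"
proof -
  have c: "decay > 0" using \<gamma> by (simp add: decay_def)
  have Rp: "\<not> is_pole F (Complex R t)" for t
    using R(3) F_pole_real[of "Complex R t"] by (cases "t = 0") (auto simp: complex_of_real_def)
  \<comment> \<open>The contour argument takes place in an open strip, so poles slightly beyond both
    lines are listed as well; only those between the lines enter the sum.\<close>
  define P where "P = {x. \<sigma> - 1 \<le> x \<and> x \<le> R + 1 \<and> is_pole F (of_real x)}"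
  have finP: "finite P"
  proof (rule finite_subset)
    show "P \<subseteq> {x. \<sigma> - 1 \<le> x \<and> x \<le> R + 1 \<and> (\<exists>j\<in>{1..J}. \<exists>n::int. a j * x + b j = of_int n)}"
      using singularity_lattice[OF F_pole_singularity] by (force simp: P_def)
  qed (rule finite_affine_ints[OF a_nonzero])
  obtain M W where MW: "M \<ge> 0" "\<And>s. \<bar>Re s\<bar> \<le> \<bar>\<sigma>\<bar> + \<bar>R\<bar> \<Longrightarrow> 1 \<le> \<bar>Im s\<bar> \<Longrightarrow>
    norm (F s) \<le> W * line_weight M decay (Im s) \<and> norm (integrand y s) \<le> W * line_weight M decay (Im s)"
    by (rule strip_le_line_weight[of "\<bar>\<sigma>\<bar> + \<bar>R\<bar>" y]; rule that; blast)
  have "(CLBINT t. integrand y (Complex R t)) - (CLBINT t. integrand y (Complex \<sigma> t))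
      = 2 * pi * (\<Sum>\<rho>\<in>P \<inter> {\<sigma><..<R}. residue (integrand y) (of_real \<rho>))"
  proof (rule vertical_contour_shift[where a = "\<sigma> - 1" and b = "R + 1" and g = "\<lambda>t. W * line_weight M decay t"])
    show "integrand y holomorphic_on {s. \<sigma> - 1 < Re s \<and> Re s < R + 1} - of_real ` P"
    proof (rule analytic_imp_holomorphic, subst analytic_on_analytic_at, intro ballI integrand_analytic notI)
      fix s assume s: "s \<in> {s. \<sigma> - 1 < Re s \<and> Re s < R + 1} - of_real ` P" and p: "is_pole F s"
      have "s = of_real (Re s)" by (rule F_pole_real[OF p])
      moreover have "Re s \<in> P" using s p calculation by (auto simp: P_def)
      ultimately show False using s by blast
    qed
    show "norm (integrand y (Complex x t)) \<le> W * line_weight M decay \<bar>t\<bar>" if "\<sigma> \<le> x" "x \<le> R" "1 \<le> \<bar>t\<bar>" for x t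
      using MW(2)[of "Complex x t"] that by (auto simp: line_weight_def)
    show "((\<lambda>t. W * line_weight M decay t) \<longlongrightarrow> 0) at_top"
      using tendsto_mult_right_zero[OF line_weight_tendsto_0[OF MW(1) c]] .
    show "\<sigma> \<notin> P" using \<sigma>(1)[of 0] by (auto simp: P_def complex_of_real_def)
    show "R \<notin> P" using R(3) by (simp add: P_def)
  qed (use R finP line_integrable(1)[OF \<gamma> \<sigma>(1)] line_integrable(1)[OF \<gamma> Rp] in auto)
  also have "P \<inter> {\<sigma><..<R} = {\<rho>\<in>pos_poles F. \<rho> \<le> R}"
    using \<sigma>(2) R by (auto simp: P_def pos_poles_def le_less)
  also have "(\<Sum>\<rho>\<in>{\<rho>\<in>pos_poles F. \<rho> \<le> R}. residue (integrand y) (of_real \<rho>)) = - pole_partial_sum y R"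
    unfolding sum_negf[symmetric] pole_partial_sum_def by (intro sum.cong refl) (simp add: fY_pole_term_eq)
  finally show ?thesis by (simp add: algebra_simps)
qed

text \<open>Thanks to |s| \<le> R (1 + |t|) the bound on the line factors into a function of R and
  an integrable function of t. The constants are the same for all R that avoid the lattices by
  \<epsilon>.\<close>

lemma far_line_integral_le:
  assumes \<gamma>: "\<gamma> > 0" and \<gamma>': "\<gamma>' \<le> 0" and \<epsilon>: "\<epsilon> > 0"
  obtains M \<sigma> I where "\<And>R. R \<ge> \<sigma> \<Longrightarrow> off_lattices \<epsilon> R \<Longrightarrow> norm (CLBINT t. integrand y (Complex R t)) \<le>
    exp (M * ln R + \<gamma>' * (R * ln R - R) + (\<kappa> - y) * R) * I"
proof -
  have c: "decay > 0" using \<gamma> by (simp add: decay_def)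
  obtain M \<sigma> where M: "\<sigma> \<ge> 3" "M \<ge> 0"
    "\<And>s. Re s \<ge> \<sigma> \<Longrightarrow> 1 \<le> \<bar>Im s\<bar> \<or> off_lattices \<epsilon> (Re s) \<Longrightarrow> norm (G s) \<le> \<bar>C\<bar> * exp (far_exponent M s)"
    by (rule G_far_le[OF \<gamma>' \<epsilon>], rule that, assumption, assumption, blast)
  have "norm (CLBINT t. integrand y (Complex R t)) \<le>
     exp (M * ln R + \<gamma>' * (R * ln R - R) + (\<kappa> - y) * R) * (\<bar>C\<bar> * (LBINT t. line_weight M decay t))"
    if R: "R \<ge> \<sigma>" "off_lattices \<epsilon> R" for R
  proof -
    define E where "E = M * ln R + \<gamma>' * (R * ln R - R) + (\<kappa> - y) * R"
    have R3: "R \<ge> 3" using R M(1) by simp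
    have nosing: "Complex R t \<notin> singularities" for t
    proof
      assume "Complex R t \<in> singularities"
      then obtain j and n :: int where "j \<in> {1..J}" "a j * R + b j = of_int n"
        using singularity_lattice by fastforce
      with R(2) have "\<epsilon> \<le> \<bar>of_int n - of_int n\<bar>" unfolding off_lattices_def by metis
      thus False using \<epsilon> by simp
    qed
    have "norm (CLBINT t. integrand y (Complex R t)) \<le> (LBINT t. norm (integrand y (Complex R t)))" by simp
    also have "\<dots> \<le> (LBINT t. \<bar>C\<bar> * exp E * line_weight M decay t)"
    proof (rule integral_mono)
      show "integrable lborel (\<lambda>t. norm (integrand y (Complex R t)))"
        by (intro integrable_norm line_integrable(1) \<gamma>) (use nosing F_pole_singularity in blast)
      show "integrable lborel (\<lambda>t. \<bar>C\<bar> * exp E * line_weight M decay t)"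
        by (intro integrable_mult_right line_weight_integrable M(2) c)
      fix t :: real
      define s where "s = Complex R t"
      have "norm (F s) \<le> \<bar>C\<bar> * exp (far_exponent M s)"
        using M(3)[of s] R F_eq_G[OF nosing, of t] by (simp add: s_def)
      hence "norm (integrand y s) \<le> exp (- (R * y)) * (\<bar>C\<bar> * exp (far_exponent M s))"
        unfolding integrand_def norm_mult by (intro mult_mono) (auto simp: s_def)
      also have "\<dots> = \<bar>C\<bar> * exp (- (R * y) + far_exponent M s)" by (simp only: exp_add mult_ac)
      also have "\<dots> \<le> \<bar>C\<bar> * exp (E + (M * ln (1 + \<bar>t\<bar>) - decay * \<bar>t\<bar>))"
      proof (intro mult_left_mono, subst exp_le_cancel_iff)
        have "norm s \<le> R + \<bar>t\<bar>" using cmod_le[of s] R3 by (simp add: s_def)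
        also have "\<dots> \<le> R * (1 + \<bar>t\<bar>)" using R3 mult_right_mono[of 1 R "\<bar>t\<bar>"] by (simp add: algebra_simps)
        finally have "ln (norm s) \<le> ln (R * (1 + \<bar>t\<bar>))"
          using R3 by (intro ln_mono) (auto simp: s_def complex_eq_iff)
        also have "\<dots> = ln R + ln (1 + \<bar>t\<bar>)" using R3 by (intro ln_mult_pos) auto
        finally have "M * ln (norm s) \<le> M * (ln R + ln (1 + \<bar>t\<bar>))" using M(2) by (rule mult_left_mono)
        thus "- (R * y) + far_exponent M s \<le> E + (M * ln (1 + \<bar>t\<bar>) - decay * \<bar>t\<bar>)"
          by (simp add: far_exponent_def E_def decay_def s_def algebra_simps)
      qed auto
      also have "\<bar>C\<bar> * exp (E + (M * ln (1 + \<bar>t\<bar>) - decay * \<bar>t\<bar>)) = \<bar>C\<bar> * exp E * line_weight M decay t"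
        by (simp only: exp_add line_weight_def mult.assoc)
      finally show "norm (integrand y (Complex R t)) \<le> \<bar>C\<bar> * exp E * line_weight M decay t" by (simp add: s_def)
    qed
    finally show ?thesis by (simp add: E_def mult_ac)
  qed
  thus ?thesis by (rule that)
qed

theorem pole_sum_expansion:
  fixes Y :: "'w \<Rightarrow> real" and f :: "real \<Rightarrow> real"
  assumes "prob_space M" and dist: "distributed M lborel Y (\<lambda>x. ennreal (f x))"
    and f: "\<And>x. 0 \<le> f x" "continuous_on UNIV f"
    and lu: "l < u"
    and mom: "\<And>s. l < s \<Longrightarrow> s < u \<Longrightarrow> integrable M (\<lambda>\<omega>. exp (s * Y \<omega>))"
      "\<And>s. l < s \<Longrightarrow> s < u \<Longrightarrow> F (of_real s) = of_real (\<integral>\<omega>. exp (s * Y \<omega>) \<partial>M)"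
    and \<gamma>: "\<gamma> > 0" and \<gamma>': "\<gamma>' < 0 \<or> (\<gamma>' = 0 \<and> \<kappa> < y)"
  shows "has_pole_sum (fY_pole_term F y) (pos_poles F) (of_real (f y))"
proof -
  interpret prob_space M by fact
  have Ym: "Y \<in> borel_measurable M" using dist by (simp add: distributed_def)
  obtain \<sigma> where \<sigma>: "integrable M (\<lambda>\<omega>. exp (\<sigma> * Y \<omega>))"
    "\<And>t. F (Complex \<sigma> t) = (\<integral>\<omega>. exp (Complex \<sigma> t * of_real (Y \<omega>)) \<partial>M)"
    "\<And>t. \<not> is_pole F (Complex \<sigma> t)"
    "\<And>\<rho>::real. is_pole F (of_real \<rho>) \<Longrightarrow> \<rho> > 0 \<longleftrightarrow> \<rho> > \<sigma>"
    by (rule mgf_line_left_of_positive_poles[OF Ym F_nicely_meromorphic lu], erule (1) mom(1), erule (1) mom(2),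
        rule that, assumption, blast, blast, blast)
  have fy: "of_real (f y) = 1 / (2 * pi) * (CLBINT t. integrand y (Complex \<sigma> t))"
    unfolding integrand_def
    by (rule bilateral_laplace_inversion[OF prob_space_axioms dist f \<sigma>(1), where \<phi> = "\<lambda>t. F (Complex \<sigma> t)"])
       (use \<sigma>(2) line_integrable(2)[OF \<gamma> \<sigma>(3)] in auto)
  show ?thesis unfolding has_pole_sum_def pole_partial_sum_def[symmetric]
  proof (rule tendstoI, unfold eventually_cutoffs_iff, intro allI impI)
    fix e \<delta> :: real assume e: "e > 0" and \<delta>: "\<delta> > 0"
    \<comment> \<open>Here \<epsilon> is chosen in terms of \<delta> alone, so the constants of the
      line estimate are fixed before R varies.\<close>
    obtain \<epsilon> where \<epsilon>: "\<epsilon> > 0"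
      "\<And>R. \<exists>R'. R \<le> R' \<and> R' < R + \<delta> \<and> (\<forall>j\<in>{1..J}. \<forall>n::int. \<epsilon> \<le> \<bar>a j * R' + b j - of_int n\<bar>)"
      by (rule nearby_point_off_lattices[OF _ \<delta>, where J = J and a = a and b = b], erule a_nonzero,
          rule that, assumption, blast)
    have "\<gamma>' \<le> 0" using \<gamma>' by auto
    then obtain M \<sigma>0 I where I: "\<And>R. R \<ge> \<sigma>0 \<Longrightarrow> off_lattices \<epsilon> R \<Longrightarrow> norm (CLBINT t. integrand y (Complex R t)) \<le>
        exp (M * ln R + \<gamma>' * (R * ln R - R) + (\<kappa> - y) * R) * I"
      using far_line_integral_le[OF \<gamma> _ \<epsilon>(1)] by metis
    have "((\<lambda>R. exp (M * ln R + \<gamma>' * (R * ln R - R) + (\<kappa> - y) * R) * I) \<longlongrightarrow> 0 * I) at_top"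
      by (intro tendsto_intros exp_growth_tendsto_0 \<gamma>')
    hence "eventually (\<lambda>R. exp (M * ln R + \<gamma>' * (R * ln R - R) + (\<kappa> - y) * R) * I < e) at_top"
      using e by (intro order_tendstoD(2)) auto
    then obtain N where N: "\<And>R. R \<ge> N \<Longrightarrow> exp (M * ln R + \<gamma>' * (R * ln R - R) + (\<kappa> - y) * R) * I < e"
      unfolding eventually_at_top_linorder by blast
    show "\<exists>N. \<forall>R\<ge>N. (\<forall>\<rho>\<in>pos_poles F. \<delta> \<le> \<bar>R - \<rho>\<bar>) \<longrightarrow> dist (pole_partial_sum y R) (of_real (f y)) < e"
    proof (intro exI[of _ "max N (max (\<bar>\<sigma>\<bar> + 1) \<sigma>0)"] allI impI)
      fix R assume R: "R \<ge> max N (max (\<bar>\<sigma>\<bar> + 1) \<sigma>0)" and sep: "\<forall>\<rho>\<in>pos_poles F. \<delta> \<le> \<bar>R - \<rho>\<bar>"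
      \<comment> \<open>R avoids the actual poles by \<delta>, R' avoids the lattices of all
        candidates by \<epsilon>. As R' - R < \<delta>, no pole lies between them and the partial
        sums agree.\<close>
      obtain R' where R': "R \<le> R'" "R' < R + \<delta>" "off_lattices \<epsilon> R'"
        using \<epsilon>(2) unfolding off_lattices_def by blast
      have R'3: "R' \<ge> \<sigma>0" "R' > \<sigma>" "R' > 0" "R' \<ge> N" using R R' by auto
      have "{\<rho>\<in>pos_poles F. \<rho> \<le> R} = {\<rho>\<in>pos_poles F. \<rho> \<le> R'}"
        using sep R'(1,2) by force
      hence eq: "pole_partial_sum y R = pole_partial_sum y R'" by (simp add: pole_partial_sum_def)
      have np: "\<not> is_pole F (of_real R')"
      proof
        assume "is_pole F (of_real R')"
        from singularity_lattice[OF F_pole_singularity[OF this]]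
        obtain j n where "j \<in> {1..J}" "a j * R' + b j = of_int n" by auto
        with R'(3) have "\<epsilon> \<le> \<bar>of_int n - of_int n\<bar>" unfolding off_lattices_def by metis
        thus False using \<epsilon>(1) by simp
      qed
      have "(CLBINT t. integrand y (Complex \<sigma> t)) = 2 * pi * pole_partial_sum y R' + (CLBINT t. integrand y (Complex R' t))"
        using pole_partial_sum_eq_line_integrals[OF \<gamma> \<sigma>(3,4) R'3(2,3) np, of y] by simp
      hence "pole_partial_sum y R - of_real (f y) = - (1 / (2 * pi) * (CLBINT t. integrand y (Complex R' t)))"
        unfolding fy eq by (simp add: ring_distribs add_divide_distrib)
      hence "dist (pole_partial_sum y R) (of_real (f y)) = 1 / (2 * pi) * norm (CLBINT t. integrand y (Complex R' t))"
        by (simp add: dist_norm norm_mult norm_divide)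
      also have "\<dots> \<le> 1 * norm (CLBINT t. integrand y (Complex R' t))"
        using pi_ge_two by (intro mult_right_mono) auto
      also have "\<dots> < e" using I[OF R'3(1) R'(3)] N[OF R'3(4)] by simp
      finally show "dist (pole_partial_sum y R) (of_real (f y)) < e" .
    qed
  qed
qed

end

section \<open>Divergence of the pole sums\<close>

text \<open>Circles of radius \<open>r n\<close> are rescaled to the unit circle, so that
  convergence on shrinking and moving circles becomes uniform convergence on one fixed set.\<close>

lemma uniform_limit_sphere_at_0:
  fixes f :: "complex \<Rightarrow> complex"
  assumes f: "(f \<longlongrightarrow> c) (at 0)" and r: "\<And>n. r n > 0" "r \<longlonglongrightarrow> 0"
  shows "uniform_limit (sphere 0 1) (\<lambda>n w. f (of_real (r n) * w)) (\<lambda>_. c) sequentially"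
  unfolding uniform_limit_iff
proof (intro allI impI)
  fix e :: real assume "e > 0"
  then obtain d where d: "d > 0" "\<And>x. x \<noteq> 0 \<Longrightarrow> norm x < d \<Longrightarrow> dist (f x) c < e"
    using tendstoD[OF f] unfolding eventually_at by (metis dist_0_norm dist_commute UNIV_I)
  have "eventually (\<lambda>n. r n < d) sequentially" using r(2) d(1) by (rule order_tendstoD(2))
  thus "eventually (\<lambda>n. \<forall>w\<in>sphere 0 1. dist (f (of_real (r n) * w)) c < e) sequentially"
  proof eventually_elim
    case (elim n)
    show ?case
    proof
      fix w :: complex assume "w \<in> sphere 0 1"
      hence "norm (of_real (r n) * w) = r n" using r(1)[of n] by (simp add: norm_mult)
      thus "dist (f (of_real (r n) * w)) c < e"
        using elim r(1)[of n] by (intro d(2)) auto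
    qed
  qed
qed

lemma uniform_limit_1_mult:
  fixes f g :: "'a \<Rightarrow> 'b \<Rightarrow> complex"
  assumes "uniform_limit X f (\<lambda>_. 1) F" "uniform_limit X g (\<lambda>_. 1) F"
  shows "uniform_limit X (\<lambda>n w. f n w * g n w) (\<lambda>_. 1) F"
  using uniform_lim_mult[OF assms] by (auto simp: image_constant_conv)

lemma uniform_limit_1_inverse:
  fixes f :: "'a \<Rightarrow> 'b \<Rightarrow> complex"
  assumes "uniform_limit X f (\<lambda>_. 1) F"
  shows "uniform_limit X (\<lambda>n w. inverse (f n w)) (\<lambda>_. 1) F"
  using uniform_lim_inverse[OF assms, of 1] by (simp add: o_def)

lemma uniform_limit_1_divide:
  fixes f g :: "'a \<Rightarrow> 'b \<Rightarrow> complex"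
  assumes "uniform_limit X f (\<lambda>_. 1) F" "uniform_limit X g (\<lambda>_. 1) F"
  shows "uniform_limit X (\<lambda>n w. f n w / g n w) (\<lambda>_. 1) F"
  unfolding divide_inverse by (intro uniform_limit_1_mult uniform_limit_1_inverse assms)

lemma uniform_limit_1_prod:
  fixes f :: "'i \<Rightarrow> 'a \<Rightarrow> 'b \<Rightarrow> complex"
  assumes "\<And>i. i \<in> I \<Longrightarrow> uniform_limit X (f i) (\<lambda>_. 1) F"
  shows "uniform_limit X (\<lambda>n w. \<Prod>i\<in>I. f i n w) (\<lambda>_. 1) F"
  using assms
proof (induction I rule: infinite_finite_induct)
  case (insert i I)
  have "uniform_limit X (\<lambda>n w. f i n w * (\<Prod>i\<in>I. f i n w)) (\<lambda>_. 1) F"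
    by (intro uniform_limit_1_mult insert) auto
  thus ?case using insert by simp
qed (auto intro: uniform_limit_const)

lemma uniform_limit_1_exp:
  fixes f :: "'a \<Rightarrow> 'b \<Rightarrow> complex"
  assumes ev: "eventually (\<lambda>n. \<forall>w\<in>X. \<exists>e. norm e \<le> \<eta> n \<and> f n w = exp e) F" and \<eta>: "(\<eta> \<longlongrightarrow> 0) F"
  shows "uniform_limit X f (\<lambda>_. 1) F"
  unfolding uniform_limit_iff
proof (intro allI impI)
  fix \<epsilon> :: real assume "\<epsilon> > 0"
  have "isCont exp (0::complex)" by (rule isCont_exp)
  then obtain d where d: "d > 0" "\<And>x::complex. norm x < d \<Longrightarrow> dist (exp x) 1 < \<epsilon>"
    using \<open>\<epsilon> > 0\<close> unfolding continuous_at_eps_delta by (metis dist_0_norm dist_commute exp_zero)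
  have "eventually (\<lambda>n. \<eta> n < d) F" using \<eta> d(1) by (rule order_tendstoD(2))
  with ev show "eventually (\<lambda>n. \<forall>w\<in>X. dist (f n w) 1 < \<epsilon>) F"
    by eventually_elim (metis d(2) order.strict_trans1)
qed

text \<open>
  Shifts \<open>\<tau>\<^sub>n\<close> of polynomial size in \<open>n\<close> that are simultaneously almost periods, with an error of
  order \<open>1/n\<close>, of all trigonometric factors. Circles of radius \<open>r\<^sub>n = n powr (-1/2)\<close> are
  large compared with this error, but so small that the regular factors are nearly constant on them.
\<close>

locale almost_period_seq =
  fixes \<tau> :: "nat \<Rightarrow> real" and m :: nat
  assumes \<tau>_ge: "\<tau> n \<ge> real n + 1" and \<tau>_le: "\<tau> n \<le> (real n + 1) ^ m"
begin

definition r :: "nat \<Rightarrow> real" where "r n = 1 / sqrt (real n + 1)"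

lemma r_pos: "r n > 0" by (simp add: r_def)

lemma r_lim: "r \<longlonglongrightarrow> 0" unfolding r_def by real_asymp

lemma \<tau>_lim: "filterlim \<tau> at_top sequentially"
proof (rule filterlim_at_top_mono)
  show "filterlim (\<lambda>n. real n + 1) at_top sequentially" by real_asymp
qed (use \<tau>_ge in auto)

text \<open>By \<open>Gamma_ratio\<close> the error in the exponent is of order r n ln (x n) + 1 / x
  n, where x n is the unperturbed argument. As \<tau> n is at most polynomial in n, ln (x n) is O(ln
  n), which r n outweighs.\<close>

lemma Gamma_ratio_uniform:
  assumes A: "A > 0"
  shows "uniform_limit (sphere 0 1) (\<lambda>n w. Gamma (of_real (A * (\<rho> + \<tau> n) + B) + of_real (A' * r n) * w) /
           Gamma (of_real (A * (\<rho> + \<tau> n) + B))) (\<lambda>_. 1 :: complex) sequentially"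
proof -
  obtain K where K: "K \<ge> 0" "\<And>(x::real) (v::complex). x \<ge> 3 \<Longrightarrow> norm v \<le> 1 \<Longrightarrow> 
       \<exists>e. norm e \<le> K * (norm v * ln x + 1 / x) \<and> Gamma (of_real x + v) = of_real (Gamma x) * exp e"
    using Gamma_ratio by metis
  define x where "x n = A * (\<rho> + \<tau> n) + B" for n
  have "filterlim (\<lambda>n. (A * \<rho> + B) + A * \<tau> n) at_top sequentially"
    using A by (intro filterlim_tendsto_add_at_top[OF tendsto_const]
        filterlim_tendsto_pos_mult_at_top[OF tendsto_const] \<tau>_lim)
  hence xlim: "filterlim x at_top sequentially"
    unfolding x_def by (simp add: algebra_simps)
  define c where "c = A * (\<bar>\<rho>\<bar> + 1) + \<bar>B\<bar>"
  have c: "c > 0" using A by (simp add: c_def add_pos_nonneg)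
  define \<eta> where "\<eta> n = K * (\<bar>A'\<bar> * (r n * ln (x n)) + 1 / x n)" for n
  have rl: "(\<lambda>n. r n * ln (x n)) \<longlonglongrightarrow> 0"
  proof (rule tendsto_sandwich[of "\<lambda>_. 0" _ _ "\<lambda>n. r n * (ln c + real m * ln (real n + 1))"])
    show "(\<lambda>n. r n * (ln c + real m * ln (real n + 1))) \<longlonglongrightarrow> 0" unfolding r_def by real_asymp
    show "eventually (\<lambda>n. r n * ln (x n) \<le> r n * (ln c + real m * ln (real n + 1))) sequentially"
      using filterlim_at_top[THEN iffD1, OF xlim, rule_format, of 1]
    proof eventually_elim
      case (elim n)
      have p1: "1 \<le> (real n + 1) ^ m" by (rule one_le_power) simp
      have "x n \<le> A * (\<bar>\<rho>\<bar> + \<tau> n) + \<bar>B\<bar>" unfolding x_def using A by (intro add_mono mult_left_mono) auto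
      also have "\<dots> \<le> A * (\<bar>\<rho>\<bar> * (real n + 1) ^ m + (real n + 1) ^ m) + \<bar>B\<bar> * (real n + 1) ^ m"
        using A \<tau>_le[of n] mult_left_mono[OF p1, of "\<bar>\<rho>\<bar>"] mult_left_mono[OF p1, of "\<bar>B\<bar>"]
        by (intro add_mono mult_left_mono) auto
      also have "\<dots> = c * (real n + 1) ^ m" by (simp add: c_def algebra_simps)
      finally have "ln (x n) \<le> ln (c * (real n + 1) ^ m)" using elim by (intro ln_mono) auto
      also have "\<dots> = ln c + real m * ln (real n + 1)" using c by (simp add: ln_mult_pos ln_realpow)
      finally show ?case using r_pos[of n] by (intro mult_left_mono) auto
    qed
    show "eventually (\<lambda>n. 0 \<le> r n * ln (x n)) sequentially"
      using filterlim_at_top[THEN iffD1, OF xlim, rule_format, of 1]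
      by eventually_elim (use r_pos in \<open>auto intro!: mult_nonneg_nonneg simp: less_imp_le\<close>)
  qed auto
  have "(\<lambda>n. 1 / x n) \<longlonglongrightarrow> 0" using xlim by (intro tendsto_divide_0[OF tendsto_const] filterlim_at_top_imp_at_infinity)
  hence "\<eta> \<longlonglongrightarrow> K * (\<bar>A'\<bar> * 0 + 0)" unfolding \<eta>_def by (intro tendsto_intros rl)
  hence \<eta>: "\<eta> \<longlonglongrightarrow> 0" by simp
  have small: "eventually (\<lambda>n. \<bar>A'\<bar> * r n < 1) sequentially"
    using tendsto_mult_right_zero[OF r_lim, of "\<bar>A'\<bar>"] by (rule order_tendstoD(2)) simp
  have "eventually (\<lambda>n. \<forall>w\<in>sphere (0::complex) 1. \<exists>e. norm e \<le> \<eta> n \<and>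
      Gamma (of_real (x n) + of_real (A' * r n) * w) / Gamma (of_real (x n)) = exp e) sequentially"
    using filterlim_at_top[THEN iffD1, OF xlim, rule_format, of 3] small
  proof eventually_elim
    case (elim n)
    show ?case
    proof
      fix w :: complex assume "w \<in> sphere 0 1"
      hence nv: "norm (of_real (A' * r n) * w) = \<bar>A'\<bar> * r n" using r_pos[of n] by (simp add: norm_mult abs_mult)
      then obtain e where e: "norm e \<le> K * ((\<bar>A'\<bar> * r n) * ln (x n) + 1 / x n)"
        "Gamma (of_real (x n) + of_real (A' * r n) * w) = of_real (Gamma (x n)) * exp e"
        using K(2)[of "x n" "of_real (A' * r n) * w"] elim by auto
      have "Gamma (x n) > 0" using elim by (intro Gamma_real_pos) auto
      hence "Gamma (of_real (x n) + of_real (A' * r n) * w) / Gamma (of_real (x n)) = exp e"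
        unfolding e(2) Gamma_complex_of_real by simp
      thus "\<exists>e. norm e \<le> \<eta> n \<and> Gamma (of_real (x n) + of_real (A' * r n) * w) / Gamma (of_real (x n)) = exp e"
        using e(1) by (auto simp: \<eta>_def mult.assoc)
    qed
  qed
  from uniform_limit_1_exp[OF this \<eta>] show ?thesis by (simp add: x_def)
qed

lemma regular_part_ratio_uniform:
  assumes "a \<noteq> 0"
  shows "uniform_limit (sphere 0 1) (\<lambda>n w. regular_part a b (of_real (\<rho> + \<tau> n) + of_real (r n) * w) /
           regular_part a b (of_real (\<rho> + \<tau> n))) (\<lambda>_. 1) sequentially"
proof (cases "a > 0")
  case True
  show ?thesis using Gamma_ratio_uniform[OF True, of \<rho> b a] True
    by (simp add: regular_part_def algebra_simps)
next
  case False
  hence a: "-a > 0" using assms by simp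
  have "regular_part a b (of_real (\<rho> + \<tau> n) + of_real (r n) * w) / regular_part a b (of_real (\<rho> + \<tau> n)) =
    inverse (Gamma (of_real (-a * (\<rho> + \<tau> n) + (1 - b)) + of_real (-a * r n) * w) /
           Gamma (of_real (-a * (\<rho> + \<tau> n) + (1 - b))))" for n w
    using False by (simp add: regular_part_def rGamma_inverse_Gamma algebra_simps divide_inverse)
  thus ?thesis using uniform_limit_1_inverse[OF Gamma_ratio_uniform[OF a, of \<rho> "1 - b" "-a"]] by simp
qed

text \<open>The condition \<open>pos\<close> puts the argument of the Gamma function inside
  \<open>regular_part\<close> into the right half-plane, where Gamma has neither zeros nor poles;
  the rest is continuity at \<rho>.\<close>

lemma regular_part_near_uniform:
  assumes "a \<noteq> 0" and pos: "if a > 0 then a * \<rho> + b > 0 else 1 - (a * \<rho> + b) > 0"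
  shows "uniform_limit (sphere 0 1) (\<lambda>n w. regular_part a b (of_real \<rho> + of_real (r n) * w) /
           regular_part a b (of_real \<rho>)) (\<lambda>_. 1) sequentially"
    and "regular_part a b (of_real \<rho>) \<noteq> 0"
proof -
  have nz: "regular_part a b (of_real \<rho>) \<noteq> 0"
    using pos unfolding regular_part_def
    by (auto simp: Gamma_eq_zero_iff rGamma_eq_zero_iff intro!: Re_pos_not_nonpos_Int)
  thus "regular_part a b (of_real \<rho>) \<noteq> 0" .
  have "complex_of_real a * of_real \<rho> + of_real b \<notin> \<int>\<^sub>\<le>\<^sub>0" if "a > 0"
    using pos that by (intro Re_pos_not_nonpos_Int) auto
  hence "isCont (\<lambda>w. regular_part a b (of_real \<rho> + w)) 0"
    unfolding regular_part_def by (cases "a > 0") (auto intro!: continuous_intros)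
  hence "((\<lambda>w. regular_part a b (of_real \<rho> + w)) \<longlongrightarrow> regular_part a b (of_real \<rho>)) (at 0)"
    by (simp add: isCont_def)
  hence "((\<lambda>w. regular_part a b (of_real \<rho> + w) / regular_part a b (of_real \<rho>)) \<longlongrightarrow> regular_part a b (of_real \<rho>) / regular_part a b (of_real \<rho>)) (at 0)"
    using nz by (intro tendsto_intros)
  hence "((\<lambda>w. regular_part a b (of_real \<rho> + w) / regular_part a b (of_real \<rho>)) \<longlongrightarrow> 1) (at 0)"
    using nz by simp
  from uniform_limit_sphere_at_0[OF this r_pos r_lim]
  show "uniform_limit (sphere 0 1) (\<lambda>n w. regular_part a b (of_real \<rho> + of_real (r n) * w) /
           regular_part a b (of_real \<rho>)) (\<lambda>_. 1) sequentially" .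
qed

text \<open>The zeros of the sine are simple, so a linear lower bound holds even if the centre is a
  zero. It controls the cotangent on small circles by a multiple of the inverse radius.\<close>

lemma sin_pi_lower_near:
  fixes z0 :: complex
  obtains c where "c > 0" "eventually (\<lambda>w. c * norm w \<le> norm (sin (of_real pi * (z0 + w)))) (at 0)"
proof (cases "sin (of_real pi * z0) = 0")
  case False
  have "((\<lambda>w. norm (sin (of_real pi * (z0 + w)))) \<longlongrightarrow> norm (sin (of_real pi * (z0 + 0)))) (at 0)"
    by (intro tendsto_intros)
  hence "eventually (\<lambda>w. norm (sin (of_real pi * (z0 + w))) > norm (sin (of_real pi * z0)) / 2) (at 0)"
    using False by (intro order_tendstoD(1)) auto
  moreover have "eventually (\<lambda>w::complex. norm w < 1) (at 0)"
    unfolding eventually_at by (intro exI[of _ 1]) auto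
  ultimately have "eventually (\<lambda>w. norm (sin (of_real pi * z0)) / 2 * norm w \<le> norm (sin (of_real pi * (z0 + w)))) (at 0)"
  proof eventually_elim
    case (elim w)
    have "norm (sin (of_real pi * z0)) / 2 * norm w \<le> norm (sin (of_real pi * z0)) / 2 * 1"
      using elim by (intro mult_left_mono) auto
    thus ?case using elim by linarith
  qed
  thus ?thesis using that[of "norm (sin (of_real pi * z0)) / 2"] False by simp
next
  case True
  have "((\<lambda>w. sin (of_real pi * (z0 + w))) has_field_derivative of_real pi * cos (of_real pi * z0)) (at 0)"
    by (auto intro!: derivative_eq_intros)
  hence lim: "((\<lambda>w. sin (of_real pi * (z0 + w)) / w) \<longlongrightarrow> of_real pi * cos (of_real pi * z0)) (at 0)"
    using True by (simp add: DERIV_def)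
  have cnz: "cos (of_real pi * z0) \<noteq> 0" using True sin_cos_squared_add[of "of_real pi * z0"] by auto
  have "eventually (\<lambda>w. norm (sin (of_real pi * (z0 + w)) / w) > norm (of_real pi * cos (of_real pi * z0)) / 2) (at 0)"
    by (rule order_tendstoD(1)[OF tendsto_norm[OF lim]]) (use cnz in \<open>auto simp: norm_mult\<close>)
  moreover have "eventually (\<lambda>w::complex. w \<noteq> 0) (at 0)" by (rule eventually_neq_at_within)
  ultimately have "eventually (\<lambda>w. norm (of_real pi * cos (of_real pi * z0)) / 2 * norm w \<le> norm (sin (of_real pi * (z0 + w)))) (at 0)"
    by eventually_elim (simp add: norm_divide field_simps)
  thus ?thesis using that[of "norm (of_real pi * cos (of_real pi * z0)) / 2"] cnz by simp
qed

text \<open>For negative a put e = a \<tau> - 2 p; then sin (Z + pi e) / sin Z = cos (pi e) + cot Z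
  sin (pi e). On the circle cot Z is O(1 / r n) and e is O(1 / n), so the last summand is O(n powr
  (-1/2)). Approximation by even integers gives full periods of the sine, without a change of
  sign.\<close>

lemma trig_part_ratio_uniform:
  assumes a: "a \<noteq> 0" and per: "\<And>n. \<exists>p::int. \<bar>a * \<tau> n - 2 * of_int p\<bar> \<le> 2 / (real n + 1)"
  shows "uniform_limit (sphere 0 1) (\<lambda>n w. trig_part a b (of_real (\<rho> + \<tau> n) + of_real (r n) * w) /
           trig_part a b (of_real \<rho> + of_real (r n) * w)) (\<lambda>_. 1) sequentially"
proof (cases "a > 0")
  case True
  thus ?thesis by (simp add: trig_part_def uniform_limit_const)
next
  case False
  obtain p :: "nat \<Rightarrow> int" where p: "\<And>n. \<bar>a * \<tau> n - 2 * of_int (p n)\<bar> \<le> 2 / (real n + 1)" using per by metis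
  define e where "e n = a * \<tau> n - 2 * of_int (p n)" for n
  have e: "\<bar>e n\<bar> \<le> 2 / (real n + 1)" for n using p by (simp add: e_def)
  have elim0: "e \<longlonglongrightarrow> 0"
    by (rule Lim_null_comparison[of _ "\<lambda>n. 2 / (real n + 1)"]) (use e in auto, real_asymp)
  define z0 where "z0 = complex_of_real (a * \<rho> + b)"
  obtain c where c: "c > 0" "eventually (\<lambda>w. c * norm w \<le> norm (sin (of_real pi * (z0 + w)))) (at 0)"
    using sin_pi_lower_near by blast
  obtain d where d: "d > 0" "\<And>w. w \<noteq> 0 \<Longrightarrow> norm w < d \<Longrightarrow> c * norm w \<le> norm (sin (of_real pi * (z0 + w)))"
    using c(2) unfolding eventually_at by (metis dist_0_norm dist_commute UNIV_I)
  define \<eta> where "\<eta> n = \<bar>cos (pi * e n) - 1\<bar> + exp pi * (pi * \<bar>e n\<bar>) / (c * (\<bar>a\<bar> * r n))" for n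
  have "(\<lambda>n. \<bar>e n\<bar> / r n) \<longlonglongrightarrow> 0"
  proof (rule Lim_null_comparison)
    show "(\<lambda>n. 2 / (real n + 1) / r n) \<longlonglongrightarrow> 0" unfolding r_def by real_asymp
    show "eventually (\<lambda>n. norm (\<bar>e n\<bar> / r n) \<le> 2 / (real n + 1) / r n) sequentially"
    proof (intro always_eventually allI)
      fix n
      have "\<bar>e n\<bar> / r n \<le> 2 / (real n + 1) / r n"
        using e[of n] r_pos[of n] by (intro divide_right_mono) auto
      thus "norm (\<bar>e n\<bar> / r n) \<le> 2 / (real n + 1) / r n" using r_pos[of n] by simp
    qed
  qed
  hence "(\<lambda>n. \<bar>cos (pi * e n) - 1\<bar> + exp pi * pi / (c * \<bar>a\<bar>) * (\<bar>e n\<bar> / r n)) \<longlonglongrightarrow> \<bar>cos (pi * 0) - 1\<bar> + exp pi * pi / (c * \<bar>a\<bar>) * 0"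
    by (intro tendsto_intros elim0)
  hence lim: "(\<lambda>n. \<bar>cos (pi * e n) - 1\<bar> + exp pi * pi / (c * \<bar>a\<bar>) * (\<bar>e n\<bar> / r n)) \<longlonglongrightarrow> 0" by simp
  have "\<eta> n = \<bar>cos (pi * e n) - 1\<bar> + exp pi * pi / (c * \<bar>a\<bar>) * (\<bar>e n\<bar> / r n)" for n
    unfolding \<eta>_def by (simp add: field_simps)
  with lim have \<eta>: "\<eta> \<longlonglongrightarrow> 0" by presburger
  have small: "eventually (\<lambda>n. \<bar>a\<bar> * r n < min d 1) sequentially"
    using tendsto_mult_right_zero[OF r_lim, of "\<bar>a\<bar>"] d(1) by (intro order_tendstoD(2)) auto
  show ?thesis unfolding uniform_limit_iff
  proof (intro allI impI)
    fix \<epsilon> :: real assume "\<epsilon> > 0"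
    have "eventually (\<lambda>n. \<eta> n < \<epsilon>) sequentially" using \<eta> \<open>\<epsilon> > 0\<close> by (rule order_tendstoD(2))
    with small show "eventually (\<lambda>n. \<forall>w\<in>sphere 0 1. dist (trig_part a b (of_real (\<rho> + \<tau> n) + of_real (r n) * w) /
           trig_part a b (of_real \<rho> + of_real (r n) * w)) 1 < \<epsilon>) sequentially"
    proof eventually_elim
      case (elim n)
      show ?case
      proof
        fix w :: complex assume w: "w \<in> sphere 0 1"
        define v where "v = of_real (a * r n) * w"
        have nv: "norm v = \<bar>a\<bar> * r n" using w r_pos[of n] by (simp add: v_def norm_mult abs_mult)
        have v0: "v \<noteq> 0" using nv a r_pos[of n] by auto
        define Z where "Z = of_real pi * (z0 + v)"
        have s: "c * (\<bar>a\<bar> * r n) \<le> norm (sin Z)" using d(2)[OF v0] elim nv by (simp add: Z_def)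
        moreover have "c * (\<bar>a\<bar> * r n) > 0" using c a r_pos[of n] by simp
        ultimately have s0: "sin Z \<noteq> 0" by auto
        have "norm (cos Z) = norm (sin (of_real pi / 2 - Z))" by (simp add: cos_sin_eq)
        also have "\<dots> \<le> exp \<bar>Im (of_real pi / 2 - Z)\<bar>" by (rule norm_sin_le)
        also have "\<bar>Im (of_real pi / 2 - Z)\<bar> = pi * \<bar>Im v\<bar>" by (simp add: Z_def z0_def abs_mult)
        also have "\<dots> \<le> pi * 1" using abs_Im_le_cmod[of v] nv elim by (intro mult_left_mono) auto
        finally have cosZ: "norm (cos Z) \<le> exp pi" by simp
        have arg: "of_real pi * (of_real a * (of_real (\<rho> + \<tau> n) + of_real (r n) * w) + of_real b) =
             (Z + of_real (pi * e n)) + of_int (p n) * (2 * of_real pi)"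
          by (simp add: Z_def z0_def v_def e_def algebra_simps)
        have "trig_part a b (of_real (\<rho> + \<tau> n) + of_real (r n) * w) = sin (Z + of_real (pi * e n)) / of_real pi"
          unfolding trig_part_def arg using False sin.plus_of_int[of "Z + of_real (pi * e n)" "p n"] by simp
        moreover have "trig_part a b (of_real \<rho> + of_real (r n) * w) = sin Z / of_real pi"
          using False by (simp add: trig_part_def Z_def z0_def v_def algebra_simps)
        ultimately have "trig_part a b (of_real (\<rho> + \<tau> n) + of_real (r n) * w) / trig_part a b (of_real \<rho> + of_real (r n) * w)
           = sin (Z + of_real (pi * e n)) / sin Z" by simp
        also have "\<dots> = of_real (cos (pi * e n)) + cos Z * of_real (sin (pi * e n)) / sin Z"
          using s0 by (simp add: sin_add add_divide_distrib cos_of_real[symmetric] sin_of_real[symmetric] del: of_real_mult)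
        finally have "dist (trig_part a b (of_real (\<rho> + \<tau> n) + of_real (r n) * w) / trig_part a b (of_real \<rho> + of_real (r n) * w)) 1
          = norm (of_real (cos (pi * e n) - 1) + cos Z * of_real (sin (pi * e n)) / sin Z)"
          by (simp add: dist_norm algebra_simps)
        also have "\<dots> \<le> norm (complex_of_real (cos (pi * e n) - 1)) + norm (cos Z * of_real (sin (pi * e n)) / sin Z)"
          by (rule norm_triangle_ineq)
        also have "\<dots> = \<bar>cos (pi * e n) - 1\<bar> + norm (cos Z) * \<bar>sin (pi * e n)\<bar> / norm (sin Z)"
          unfolding norm_of_real norm_divide norm_mult ..
        also have "\<dots> \<le> \<eta> n" unfolding \<eta>_def
        proof (intro add_left_mono frac_le mult_mono cosZ s)
          show "\<bar>sin (pi * e n)\<bar> \<le> pi * \<bar>e n\<bar>" using abs_sin_x_le_abs_x[of "pi * e n"] by (simp add: abs_mult)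
        qed (use c a r_pos[of n] in auto)
        also have "\<dots> < \<epsilon>" by (rule elim)
        finally show "dist (trig_part a b (of_real (\<rho> + \<tau> n) + of_real (r n) * w) /
           trig_part a b (of_real \<rho> + of_real (r n) * w)) 1 < \<epsilon>" .
      qed
    qed
  qed
qed

text \<open>The share of one Gamma factor in the growth from H(\<rho>) to H(\<rho> + \<tau> n) of
  the regular part H.\<close>

definition shift_factor :: "real \<Rightarrow> real \<Rightarrow> real \<Rightarrow> nat \<Rightarrow> complex" where
  "shift_factor \<rho> a b n = regular_part a b (of_real (\<rho> + \<tau> n)) / regular_part a b (of_real \<rho>)"

text \<open>The ratio of the reciprocals is the ratio of the trigonometric parts divided by that of
  the regular parts. The latter equals \<open>shift_factor\<close> up to two factors tending to 1,
  one for leaving the centre \<rho> + \<tau> n and one for leaving \<rho>.\<close>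

lemma rGamma_ratio_uniform:
  assumes a: "a \<noteq> 0" and pos: "if a > 0 then a * \<rho> + b > 0 else 1 - (a * \<rho> + b) > 0"
    and per: "\<And>n. \<exists>p::int. \<bar>a * \<tau> n - 2 * of_int p\<bar> \<le> 2 / (real n + 1)"
  shows "uniform_limit (sphere 0 1) (\<lambda>n w.
           rGamma (of_real a * (of_real (\<rho> + \<tau> n) + of_real (r n) * w) + of_real b) /
           rGamma (of_real a * (of_real \<rho> + of_real (r n) * w) + of_real b) * shift_factor \<rho> a b n) (\<lambda>_. 1) sequentially"
proof -
  let ?R1 = "\<lambda>n w. regular_part a b (of_real (\<rho> + \<tau> n) + of_real (r n) * w)"
  let ?R0 = "\<lambda>n w. regular_part a b (of_real \<rho> + of_real (r n) * w)"
  let ?T1 = "\<lambda>n w. trig_part a b (of_real (\<rho> + \<tau> n) + of_real (r n) * w)"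
  let ?T0 = "\<lambda>n w. trig_part a b (of_real \<rho> + of_real (r n) * w)"
  let ?u = "\<lambda>n w. ?R1 n w / regular_part a b (of_real (\<rho> + \<tau> n))"
  let ?v = "\<lambda>n w. ?R0 n w / regular_part a b (of_real \<rho>)"
  note u = regular_part_ratio_uniform[OF a, of b \<rho>]
  note v = regular_part_near_uniform(1)[OF a pos]
  have lim: "uniform_limit (sphere 0 1) (\<lambda>n w. ?T1 n w / ?T0 n w * (?v n w / ?u n w)) (\<lambda>_. 1) sequentially"
    by (intro uniform_limit_1_mult uniform_limit_1_divide trig_part_ratio_uniform[OF a per] u v)
  \<comment> \<open>Closeness to 1 keeps the regular parts from vanishing, so for large n the
    factorisation of \<open>rGamma\<close> is available on both circles.\<close>
  have "eventually (\<lambda>n. \<forall>w\<in>sphere 0 1. dist (?u n w) 1 < 1) sequentially"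
    using u unfolding uniform_limit_iff by (meson zero_less_one)
  moreover have "eventually (\<lambda>n. \<forall>w\<in>sphere 0 1. dist (?v n w) 1 < 1) sequentially"
    using v unfolding uniform_limit_iff by (meson zero_less_one)
  ultimately have "eventually (\<lambda>n. \<forall>w\<in>sphere 0 1. ?T1 n w / ?T0 n w * (?v n w / ?u n w) =
        rGamma (of_real a * (of_real (\<rho> + \<tau> n) + of_real (r n) * w) + of_real b) /
           rGamma (of_real a * (of_real \<rho> + of_real (r n) * w) + of_real b) * shift_factor \<rho> a b n) sequentially"
  proof eventually_elim
    case (elim n)
    show ?case
    proof
      fix w :: complex assume w: "w \<in> sphere 0 1"
      have nz: "?R1 n w \<noteq> 0" "?R0 n w \<noteq> 0" using elim w by (force simp: dist_norm)+
      show "?T1 n w / ?T0 n w * (?v n w / ?u n w) =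
        rGamma (of_real a * (of_real (\<rho> + \<tau> n) + of_real (r n) * w) + of_real b) /
           rGamma (of_real a * (of_real \<rho> + of_real (r n) * w) + of_real b) * shift_factor \<rho> a b n"
        unfolding rGamma_eq_trig_over_regular[OF nz(1)] rGamma_eq_trig_over_regular[OF nz(2)] shift_factor_def
        by (simp add: mult_ac)
    qed
  qed
  thus ?thesis using lim by (subst (asm) uniform_limit_cong) auto
qed

lemma shift_factor_nonzero:
  assumes "a \<noteq> 0" and pos: "if a > 0 then a * \<rho> + b > 0 else 1 - (a * \<rho> + b) > 0"
  shows "eventually (\<lambda>n. shift_factor \<rho> a b n \<noteq> 0) sequentially"
proof -
  obtain K \<sigma> where K: "\<sigma> \<ge> 3" "K \<ge> 0" "\<And>s. Re s \<ge> \<sigma> \<Longrightarrow> regular_part a b s \<noteq> 0"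
    "\<And>s. Re s \<ge> \<sigma> \<Longrightarrow> \<bar>ln (norm (regular_part a b s)) - gamma_size a s\<bar> \<le> K * ln (norm s)"
    by (rule regular_part_size[OF assms(1), of b]; rule that; blast)
  have "eventually (\<lambda>n. \<tau> n \<ge> \<sigma> - \<rho>) sequentially"
    using \<tau>_lim by (simp add: filterlim_at_top)
  thus ?thesis
  proof eventually_elim
    case (elim n)
    have "regular_part a b (of_real (\<rho> + \<tau> n)) \<noteq> 0" using elim by (intro K(3)) auto
    thus ?case using regular_part_near_uniform(2)[OF assms] by (simp add: shift_factor_def)
  qed
qed

lemma shift_factor_size:
  assumes "a \<noteq> 0" and pos: "if a > 0 then a * \<rho> + b > 0 else 1 - (a * \<rho> + b) > 0"
  obtains K where "K \<ge> 0" "eventually (\<lambda>n. shift_factor \<rho> a b n \<noteq> 0 \<and>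
     \<bar>ln (norm (shift_factor \<rho> a b n)) - gamma_size a (of_real (\<rho> + \<tau> n))\<bar> \<le> K * ln (\<rho> + \<tau> n)) sequentially"
proof -
  obtain K \<sigma> where K: "\<sigma> \<ge> 3" "K \<ge> 0" "\<And>s. Re s \<ge> \<sigma> \<Longrightarrow> regular_part a b s \<noteq> 0"
    "\<And>s. Re s \<ge> \<sigma> \<Longrightarrow> \<bar>ln (norm (regular_part a b s)) - gamma_size a s\<bar> \<le> K * ln (norm s)"
    by (rule regular_part_size[OF assms(1), of b]; rule that; blast)
  define k where "k = \<bar>ln (norm (regular_part a b (of_real \<rho>)))\<bar>"
  have "eventually (\<lambda>n. \<tau> n \<ge> \<sigma> - \<rho>) sequentially"
    using \<tau>_lim by (simp add: filterlim_at_top)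
  with shift_factor_nonzero[OF assms]
  have "eventually (\<lambda>n. shift_factor \<rho> a b n \<noteq> 0 \<and>
     \<bar>ln (norm (shift_factor \<rho> a b n)) - gamma_size a (of_real (\<rho> + \<tau> n))\<bar> \<le> (K + k) * ln (\<rho> + \<tau> n)) sequentially"
  proof eventually_elim
    case (elim n)
    define s where "s = complex_of_real (\<rho> + \<tau> n)"
    have s: "Re s \<ge> \<sigma>" "norm s = \<rho> + \<tau> n" using elim K(1) by (auto simp: s_def simp flip: of_real_add)
    have l1: "1 \<le> ln (norm s)" using norm_Ln_le_ln(2)[of s] s K(1) by simp
    have nz: "regular_part a b s \<noteq> 0" "regular_part a b (of_real \<rho>) \<noteq> 0"
      using K(3)[OF s(1)] regular_part_near_uniform(2)[OF assms] by auto
    have "ln (norm (shift_factor \<rho> a b n)) = ln (norm (regular_part a b s)) - ln (norm (regular_part a b (of_real \<rho>)))"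
      using nz by (simp add: shift_factor_def s_def norm_divide ln_div)
    hence "\<bar>ln (norm (shift_factor \<rho> a b n)) - gamma_size a s\<bar> \<le> K * ln (norm s) + k"
      using K(4)[OF s(1)] unfolding k_def by linarith
    also have "\<dots> \<le> K * ln (norm s) + k * ln (norm s)"
      using mult_left_mono[OF l1, of k] by (simp add: k_def)
    also have "\<dots> = (K + k) * ln (\<rho> + \<tau> n)" by (simp add: s algebra_simps)
    finally show ?case using elim by (simp add: s_def)
  qed
  thus ?thesis using K(2) by (intro that[of "K + k"]) (auto simp: k_def)
qed

text \<open>If a x + b is an integer and x is near \<rho> + \<tau> n, then a \<rho> + b is close to
  an integer, and for small \<delta> it must be that integer. Hence |a| times the distance of x from
  \<rho> + \<tau> n is only the error of the almost period, which is below |a| r n. Candidate poles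
  near \<rho> + \<tau> n therefore form a cluster inside the circle, with an empty annulus around
  it. Validity for all small \<delta> lets one \<delta> serve all factors.\<close>

lemma affine_ints_near:
  assumes a: "a \<noteq> 0" and per: "\<And>n. \<exists>p::int. \<bar>a * \<tau> n - 2 * of_int p\<bar> \<le> 2 / (real n + 1)"
  shows "eventually (\<lambda>\<delta>. eventually (\<lambda>n. \<forall>x. \<bar>x - (\<rho> + \<tau> n)\<bar> \<le> 2 * \<delta> \<longrightarrow> a * x + b \<in> \<int> \<longrightarrow>
            \<bar>x - (\<rho> + \<tau> n)\<bar> < r n) sequentially) (at_right 0)"
proof -
  obtain p :: "nat \<Rightarrow> int" where p: "\<And>n. \<bar>a * \<tau> n - 2 * of_int (p n)\<bar> \<le> 2 / (real n + 1)" using per by metis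
  define e where "e n = a * \<tau> n - 2 * of_int (p n)" for n
  have e: "\<bar>e n\<bar> \<le> 2 / (real n + 1)" for n using p by (simp add: e_def)
  define z0 where "z0 = a * \<rho> + b"
  \<comment> \<open>The distance from z0 to the nearest integer different from z0.\<close>
  define d where "d = (if z0 \<in> \<int> then 1 else min (z0 - of_int \<lfloor>z0\<rfloor>) (of_int \<lfloor>z0\<rfloor> + 1 - z0))"
  have d: "d > 0"
  proof (cases "z0 \<in> \<int>")
    case False
    have "z0 \<noteq> of_int \<lfloor>z0\<rfloor>" using False by (metis Ints_of_int)
    hence "of_int \<lfloor>z0\<rfloor> < z0" using of_int_floor_le[of z0] by (metis less_le)
    moreover have "z0 < of_int \<lfloor>z0\<rfloor> + 1" using floor_correct[of z0] by simp
    ultimately have "0 < min (z0 - of_int \<lfloor>z0\<rfloor>) (of_int \<lfloor>z0\<rfloor> + 1 - z0)" by simp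
    thus ?thesis using False unfolding d_def by (simp only: if_False)
  qed (simp add: d_def)
  have dist: "z0 = of_int k \<or> d \<le> \<bar>z0 - of_int k\<bar>" for k :: int
  proof (cases "z0 \<in> \<int>")
    case True
    then obtain i where i: "z0 = of_int i" by (auto elim: Ints_cases)
    show ?thesis using True unfolding i d_def by (cases "i = k") auto
  next
    case False
    have "k \<le> \<lfloor>z0\<rfloor> \<or> k \<ge> \<lfloor>z0\<rfloor> + 1" by linarith
    hence "of_int k \<le> (of_int \<lfloor>z0\<rfloor> :: real) \<or> of_int k \<ge> (of_int \<lfloor>z0\<rfloor> + 1 :: real)"
      by (metis of_int_1 of_int_add of_int_le_iff)
    thus ?thesis using False by (auto simp: d_def)
  qed
  have ev1: "eventually (\<lambda>n. 2 / (real n + 1) < d / 2) sequentially"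
    by (rule order_tendstoD(2)[of _ 0]) (use d in \<open>auto, real_asymp\<close>)
  have ev2: "eventually (\<lambda>n. 2 / (real n + 1) < \<bar>a\<bar> * r n) sequentially"
  proof -
    have "(\<lambda>n. 2 / (real n + 1) / r n) \<longlonglongrightarrow> 0" unfolding r_def by real_asymp
    hence "eventually (\<lambda>n. 2 / (real n + 1) / r n < \<bar>a\<bar>) sequentially" using a by (intro order_tendstoD(2)) auto
    thus ?thesis by eventually_elim (metis pos_divide_less_eq r_pos)
  qed
  have "eventually (\<lambda>\<delta>. \<delta> < d / (4 * \<bar>a\<bar>)) (at_right (0::real))"
    unfolding eventually_at_right_field using a d by (intro exI[of _ "d / (4 * \<bar>a\<bar>)"]) auto
  thus ?thesis
  proof eventually_elim
    case (elim \<delta>)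
    have \<delta>: "\<bar>a\<bar> * (2 * \<delta>) < d / 2" using elim a by (simp add: field_simps)
    show ?case using ev1 ev2
    proof eventually_elim
      case (elim n)
      show ?case
      proof (intro allI impI)
        fix x assume x: "\<bar>x - (\<rho> + \<tau> n)\<bar> \<le> 2 * \<delta>" "a * x + b \<in> \<int>"
        define u where "u = x - (\<rho> + \<tau> n)"
        obtain i :: int where i: "a * x + b = of_int i" using x(2) by (auto elim: Ints_cases)
        have eq: "z0 - of_int (i - 2 * p n) = - (a * u + e n)"
          using i by (simp add: z0_def u_def e_def algebra_simps)
        have "\<bar>a * u\<bar> \<le> \<bar>a\<bar> * (2 * \<delta>)" unfolding abs_mult using x(1) by (intro mult_left_mono) (auto simp: u_def)
        hence "\<bar>z0 - of_int (i - 2 * p n)\<bar> < d" unfolding eq using \<delta> e[of n] elim by linarith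
        hence "z0 = of_int (i - 2 * p n)" using dist[of "i - 2 * p n"] by linarith
        hence "a * u = - e n" using eq by linarith
        hence "\<bar>a\<bar> * \<bar>u\<bar> = \<bar>e n\<bar>" by (metis abs_minus_cancel abs_mult)
        hence "\<bar>a\<bar> * \<bar>u\<bar> < \<bar>a\<bar> * r n" using e[of n] elim by linarith
        thus "\<bar>x - (\<rho> + \<tau> n)\<bar> < r n" using a by (simp add: u_def)
      qed
    qed
  qed
qed

end

section \<open>Existence of simultaneous almost periods\<close>

text \<open>Dirichlet's theorem is applied to the numbers c i / 2 times n + 1, and \<tau> n is the
  resulting q multiplied by n + 1. The multiplication forces \<tau> n to infinity, since q by itself
  could stay bounded, and accounts for the last unit in the exponent J + K + 1. Halving the
  coefficients produces even integers.\<close>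

lemma simultaneous_almost_periods:
  fixes a a' :: "nat \<Rightarrow> real" and J K :: nat
  obtains \<tau> :: "nat \<Rightarrow> real" where "almost_period_seq \<tau> (J + K + 1)"
    "\<And>j n. j \<in> {1..J} \<Longrightarrow> \<exists>p::int. \<bar>a j * \<tau> n - 2 * of_int p\<bar> \<le> 2 / (real n + 1)"
    "\<And>k n. k \<in> {1..K} \<Longrightarrow> \<exists>p::int. \<bar>a' k * \<tau> n - 2 * of_int p\<bar> \<le> 2 / (real n + 1)"
proof -
  define c where "c i = (if i < J then a (i + 1) else a' (i - J + 1))" for i
  have ex: "\<exists>t. t \<ge> real n + 1 \<and> t \<le> (real n + 1) ^ (J + K + 1) \<and>
      (\<forall>i<J+K. \<exists>p::int. \<bar>c i * t - 2 * of_int p\<bar> \<le> 2 / (real n + 1))" for n :: nat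
  proof -
    obtain q :: int and p where qp: "0 < q" "q \<le> int ((Suc n) ^ (J + K))"
      "\<And>i. i < J + K \<Longrightarrow> \<bar>of_int q * (c i / 2 * (real n + 1)) - of_int (p i)\<bar> < 1 / real (Suc n)"
      by (rule Dirichlet_approx_simult[of "Suc n" "J + K" "\<lambda>i. c i / 2 * (real n + 1)"]) auto
    have "1 * (real n + 1) \<le> of_int q * (real n + 1)" using qp(1) by (intro mult_right_mono) auto
    moreover have "real_of_int q \<le> real ((Suc n) ^ (J + K))"
      using qp(2) by (metis of_int_le_iff of_int_of_nat_eq)
    hence "of_int q * (real n + 1) \<le> (real n + 1) ^ (J + K) * (real n + 1)"
      by (intro mult_right_mono) (auto simp: add.commute)
    moreover have "\<bar>c i * (of_int q * (real n + 1)) - 2 * of_int (p i)\<bar> \<le> 2 / (real n + 1)" if "i < J + K" for i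
    proof -
      have "\<bar>c i * (of_int q * (real n + 1)) - 2 * of_int (p i)\<bar> = 2 * \<bar>of_int q * (c i / 2 * (real n + 1)) - of_int (p i)\<bar>"
        by (simp add: abs_if field_simps)
      also have "\<dots> \<le> 2 * (1 / real (Suc n))" using qp(3)[OF that] by simp
      finally show ?thesis by (simp add: add.commute)
    qed
    ultimately show ?thesis by (intro exI[of _ "of_int q * (real n + 1)"]) auto
  qed
  then obtain \<tau> where \<tau>: "\<And>n. \<tau> n \<ge> real n + 1" "\<And>n. \<tau> n \<le> (real n + 1) ^ (J + K + 1)"
     "\<And>n i. i < J + K \<Longrightarrow> \<exists>p::int. \<bar>c i * \<tau> n - 2 * of_int p\<bar> \<le> 2 / (real n + 1)"
    by metis
  show ?thesis
  proof (rule that[of \<tau>])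
    show "almost_period_seq \<tau> (J + K + 1)" by unfold_locales (use \<tau> in auto)
    show "\<exists>p::int. \<bar>a j * \<tau> n - 2 * of_int p\<bar> \<le> 2 / (real n + 1)" if "j \<in> {1..J}" for j n
    proof -
      have "c (j - 1) = a j" "j - 1 < J + K" using that by (cases j; simp add: c_def)+
      thus ?thesis using \<tau>(3)[of "j - 1" n] by simp
    qed
    show "\<exists>p::int. \<bar>a' k * \<tau> n - 2 * of_int p\<bar> \<le> 2 / (real n + 1)" if "k \<in> {1..K}" for k n
    proof -
      have "c (J + (k - 1)) = a' k" "J + (k - 1) < J + K" using that by (cases k; simp add: c_def)+
      thus ?thesis using \<tau>(3)[of "J + (k - 1)" n] by simp
    qed
  qed
qed

section \<open>Growth of the size, simple poles and small circles\<close>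

lemma exp_growth_at_top:
  fixes M g \<kappa> y c :: real
  assumes "g > 0 \<or> (g = 0 \<and> y < \<kappa>)"
  shows "filterlim (\<lambda>x. g * (x * ln x - x) + (\<kappa> - y) * x - M * ln x - c) at_top at_top"
proof (cases "g = 0")
  case True
  hence "\<kappa> - y > 0" using assms by simp
  hence "filterlim (\<lambda>x. (\<kappa> - y) * x - M * ln x - c) at_top at_top" by real_asymp
  thus ?thesis using True by simp
next
  case False
  hence "g > 0" using assms by simp
  thus ?thesis by real_asymp
qed

lemma simple_pole_tendsto:
  assumes iso: "isolated_singularity_at F z" and pole: "is_pole F z" and ord: "pole_order F z = 1"
  obtains c where "c \<noteq> 0" "((\<lambda>w. w * F (z + w)) \<longlongrightarrow> c) (at 0)"
proof -
  define L where "L = laurent_expansion F z"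
  have L: "(\<lambda>w. F (z + w)) has_laurent_expansion L"
    unfolding L_def using iso pole by (intro not_essential_has_laurent_expansion) (auto simp: not_essential_def)
  have neg: "fls_subdegree L < 0" using is_pole_imp_neg_fls_subdegree[OF L pole] .
  hence L0: "L \<noteq> 0" by auto
  have sub: "fls_subdegree L = -1"
    using has_laurent_expansion_zorder[OF L L0] neg ord by (simp add: pole_order_def)
  have "(\<lambda>w. w * F (z + w)) has_laurent_expansion fls_X * L" by (intro laurent_expansion_intros L)
  moreover have "fls_subdegree (fls_X * L) \<ge> 0" using L0 sub by simp
  ultimately have "((\<lambda>w. w * F (z + w)) \<longlongrightarrow> fls_nth (fls_X * L) 0) (at 0)"
    by (rule has_laurent_expansion_imp_tendsto_0)
  moreover have "fls_nth (fls_X * L) 0 = fls_nth L (-1)" by (simp add: fls_X_times_conv_shift)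
  moreover have "fls_nth L (-1) \<noteq> 0" using nth_fls_subdegree_nonzero[OF L0] sub by simp
  ultimately show ?thesis using that by metis
qed

text \<open>The integrand is compared with c / (s - z), whose integral over the circle is 2 pi i c.
  The error has a factor 1 / r, which the length 2 pi r of the circle cancels, so shrinking radii do
  no harm.\<close>

lemma contour_integral_circlepath_near:
  assumes r: "r > 0" and cont: "continuous_on (sphere z r) h" and \<epsilon>: "\<epsilon> \<ge> 0"
    and near: "\<And>w. w \<in> sphere 0 1 \<Longrightarrow> norm (of_real r * w * h (z + of_real r * w) / Q - c) \<le> \<epsilon>"
  shows "norm (contour_integral (circlepath z r) h / Q - 2 * pi * \<i> * c) \<le> 2 * pi * \<epsilon>"
proof -
  have 1: "(h has_contour_integral contour_integral (circlepath z r) h) (circlepath z r)"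
    using cont r by (intro has_contour_integral_integral contour_integrable_continuous_circlepath) (simp add: sphere_def dist_commute)
  have 2: "((\<lambda>s. c / (s - z)) has_contour_integral 2 * pi * \<i> * c) (circlepath z r)"
    using Cauchy_integral_circlepath_simple[of "\<lambda>_. c" z r z] r by simp
  have "((\<lambda>s. h s / Q - c / (s - z)) has_contour_integral contour_integral (circlepath z r) h / Q - 2 * pi * \<i> * c) (circlepath z r)"
    by (intro has_contour_integral_diff has_contour_integral_div 1 2)
  hence "norm (contour_integral (circlepath z r) h / Q - 2 * pi * \<i> * c) \<le> \<epsilon> / r * (2 * pi * r)"
  proof (rule has_contour_integral_bound_circlepath)
    fix s assume s: "norm (s - z) = r"
    define w where "w = (s - z) / of_real r"
    have w: "w \<in> sphere 0 1" "s = z + of_real r * w" using s r by (auto simp: w_def norm_divide)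
    have "h s / Q - c / (s - z) = (of_real r * w * h (z + of_real r * w) / Q - c) / (s - z)"
    proof -
      have "s - z = of_real r * w" "of_real r * w \<noteq> 0" using s r w by auto
      thus ?thesis unfolding w(2)[symmetric] by (simp add: diff_divide_distrib)
    qed
    hence "norm (h s / Q - c / (s - z)) = norm (of_real r * w * h (z + of_real r * w) / Q - c) / r"
      using s by (simp add: norm_divide)
    thus "norm (h s / Q - c / (s - z)) \<le> \<epsilon> / r" using near[OF w(1)] r by (simp add: divide_right_mono)
  qed (use r \<epsilon> in auto)
  thus ?thesis using r by (simp add: mult_ac)
qed

section \<open>Growth of the residue clusters\<close>

context gamma_type
begin

lemma pole_sum_divergence:
  assumes inf: "infinite (pos_poles F)" and simple: "\<And>\<rho>. \<rho> \<in> pos_poles F \<Longrightarrow> pole_order F (of_real \<rho>) = 1"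
    and \<gamma>': "\<gamma>' > 0 \<or> (\<gamma>' = 0 \<and> y < \<kappa>)"
  shows "pole_sum_diverges (fY_residue_term F y) (pos_poles F)"
proof -
  have term_eq: "fY_residue_term F y \<rho> = - residue (integrand y) (of_real \<rho>)" if "\<rho> \<in> pos_poles F" for \<rho>
    using that fY_residue_term_eq_pole_term[OF F_isolated_singularity _ simple[OF that]] fY_pole_term_eq
    by (simp add: pos_poles_def)

  \<comment> \<open>Beyond \<open>B\<close> the product |a j| \<rho> exceeds |b j| + 1 for all j,
    and likewise in the denominator, so at \<rho> the Gamma arguments of all regular parts are
    positive. Infinitely many poles guarantee one there.\<close>
  define B where "B = (\<Sum>j=1..J. (\<bar>b j\<bar> + 1) / \<bar>a j\<bar>) + (\<Sum>k=1..K. (\<bar>b' k\<bar> + 1) / \<bar>a' k\<bar>)"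
  have "finite {\<rho>\<in>pos_poles F. \<rho> \<le> B}" by (rule finite_pos_poles_le[OF D_pos a_nonzero])
  hence "\<not> pos_poles F \<subseteq> {\<rho>\<in>pos_poles F. \<rho> \<le> B}" using inf finite_subset by blast
  then obtain \<rho> where \<rho>: "\<rho> \<in> pos_poles F" "\<rho> > B" by force
  have \<rho>0: "\<rho> > 0" "is_pole F (of_real \<rho>)" using \<rho>(1) by (auto simp: pos_poles_def)
  have regular: "if x > 0 then x * \<rho> + z > 0 else 1 - (x * \<rho> + z) > 0" if x: "x \<noteq> 0" "(\<bar>z\<bar> + 1) / \<bar>x\<bar> \<le> B" for x z :: real
  proof -
    have "(\<bar>z\<bar> + 1) / \<bar>x\<bar> < \<rho>" using x \<rho>(2) by linarith
    hence "\<bar>z\<bar> + 1 < \<bar>x\<bar> * \<rho>" using x(1) by (simp add: pos_divide_less_eq mult.commute)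
    thus ?thesis using x(1) by (cases "x > 0") auto
  qed
  have regj: "if a j > 0 then a j * \<rho> + b j > 0 else 1 - (a j * \<rho> + b j) > 0" if j: "j \<in> {1..J}" for j
  proof (rule regular)
    have "(\<bar>b j\<bar> + 1) / \<bar>a j\<bar> \<le> (\<Sum>j=1..J. (\<bar>b j\<bar> + 1) / \<bar>a j\<bar>)"
      using j by (intro member_le_sum) auto
    moreover have "0 \<le> (\<Sum>k=1..K. (\<bar>b' k\<bar> + 1) / \<bar>a' k\<bar>)" by (intro sum_nonneg) auto
    ultimately show "(\<bar>b j\<bar> + 1) / \<bar>a j\<bar> \<le> B" by (simp add: B_def)
  qed (use a_nonzero j in auto)
  have regk: "if a' k > 0 then a' k * \<rho> + b' k > 0 else 1 - (a' k * \<rho> + b' k) > 0" if k: "k \<in> {1..K}" for k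
  proof (rule regular)
    have "(\<bar>b' k\<bar> + 1) / \<bar>a' k\<bar> \<le> (\<Sum>k=1..K. (\<bar>b' k\<bar> + 1) / \<bar>a' k\<bar>)"
      using k by (intro member_le_sum) auto
    moreover have "0 \<le> (\<Sum>j=1..J. (\<bar>b j\<bar> + 1) / \<bar>a j\<bar>)" by (intro sum_nonneg) auto
    ultimately show "(\<bar>b' k\<bar> + 1) / \<bar>a' k\<bar> \<le> B" by (simp add: B_def)
  qed (use a'_nonzero k in auto)

  obtain \<tau> where "almost_period_seq \<tau> (J + K + 1)" and
    per: "\<And>j n. j \<in> {1..J} \<Longrightarrow> \<exists>p::int. \<bar>a j * \<tau> n - 2 * of_int p\<bar> \<le> 2 / (real n + 1)"
    "\<And>k n. k \<in> {1..K} \<Longrightarrow> \<exists>p::int. \<bar>a' k * \<tau> n - 2 * of_int p\<bar> \<le> 2 / (real n + 1)"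
    using simultaneous_almost_periods[of J K a a'] by metis
  then interpret almost_period_seq \<tau> "J + K + 1" by simp
  define sf where "sf j n = shift_factor \<rho> (a j) (b j) n" for j n
  define sf' where "sf' k n = shift_factor \<rho> (a' k) (b' k) n" for k n
  \<comment> \<open>This is H(\<rho> + \<tau> n) exp (-\<tau> n y) / H(\<rho>), with the power of D
    counted as part of H.\<close>
  define Q where "Q n = (\<Prod>j=1..J. sf j n) / (\<Prod>k=1..K. sf' k n) * of_real (exp ((ln D - y) * \<tau> n))" for n
  define s0 where "s0 n w = of_real \<rho> + of_real (r n) * w" for n and w :: complex
  define s1 where "s1 n w = of_real (\<rho> + \<tau> n) + of_real (r n) * w" for n and w :: complex
  define num where "num j n w = rGamma (of_real (a j) * s1 n w + of_real (b j)) / rGamma (of_real (a j) * s0 n w + of_real (b j)) * sf j n" for j n w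
  define den where "den k n w = rGamma (of_real (a' k) * s1 n w + of_real (b' k)) / rGamma (of_real (a' k) * s0 n w + of_real (b' k)) * sf' k n" for k n w
  have num: "uniform_limit (sphere 0 1) (num j) (\<lambda>_. 1) sequentially" if "j \<in> {1..J}" for j
    unfolding num_def[abs_def] s0_def s1_def sf_def
    by (rule rGamma_ratio_uniform[OF a_nonzero regj per(1)]) (use that in auto)
  have den: "uniform_limit (sphere 0 1) (den k) (\<lambda>_. 1) sequentially" if "k \<in> {1..K}" for k
    unfolding den_def[abs_def] s0_def s1_def sf'_def
    by (rule rGamma_ratio_uniform[OF a'_nonzero regk per(2)]) (use that in auto)
  define U where "U n w = (\<Prod>j=1..J. inverse (num j n w)) * (\<Prod>k=1..K. den k n w)" for n w
  have U: "uniform_limit (sphere 0 1) U (\<lambda>_. 1) sequentially"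
    unfolding U_def[abs_def] by (intro uniform_limit_1_mult uniform_limit_1_prod uniform_limit_1_inverse num den)

  have ev_num: "eventually (\<lambda>n. \<forall>j\<in>{1..J}. \<forall>w\<in>sphere 0 1. dist (num j n w) 1 < 1) sequentially"
  proof (rule eventually_ball_finite[OF finite_atLeastAtMost], rule ballI)
    fix j assume "j \<in> {1..J}"
    from num[OF this] show "eventually (\<lambda>n. \<forall>w\<in>sphere 0 1. dist (num j n w) 1 < 1) sequentially"
      unfolding uniform_limit_iff by (meson zero_less_one)
  qed
  have ev_den: "eventually (\<lambda>n. \<forall>k\<in>{1..K}. \<forall>w\<in>sphere 0 1. dist (den k n w) 1 < 1) sequentially"
  proof (rule eventually_ball_finite[OF finite_atLeastAtMost], rule ballI)
    fix k assume "k \<in> {1..K}"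
    from den[OF this] show "eventually (\<lambda>n. \<forall>w\<in>sphere 0 1. dist (den k n w) 1 < 1) sequentially"
      unfolding uniform_limit_iff by (meson zero_less_one)
  qed
  have shift_h: "eventually (\<lambda>n. \<forall>w\<in>sphere 0 1. integrand y (s1 n w) = Q n * integrand y (s0 n w) * U n w) sequentially"
    using ev_num ev_den
  proof eventually_elim
    case (elim n)
    show ?case
    proof
      fix w :: complex assume w: "w \<in> sphere 0 1"
      have nz: "num j n w \<noteq> 0" if "j \<in> {1..J}" for j using elim w that by force
      have dz: "den k n w \<noteq> 0" if "k \<in> {1..K}" for k using elim w that by force
      \<comment> \<open>A quotient with denominator 0 is 0, so a nonzero \<open>num j n w\<close>
        excludes zeros of the reciprocal Gammas at both points: neither circle meets a candidate
        pole.\<close>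
      have nosing: "s1 n w \<notin> singularities" "s0 n w \<notin> singularities"
        using nz by (auto simp: singularities_def num_def rGamma_eq_zero_iff)
      have 1: "Gamma (of_real (a j) * s1 n w + of_real (b j)) = inverse (num j n w) * sf j n * Gamma (of_real (a j) * s0 n w + of_real (b j))"
        if "j \<in> {1..J}" for j
        using nz[OF that] by (simp add: num_def Gamma_def field_simps)
      have 2: "rGamma (of_real (a' k) * s1 n w + of_real (b' k)) = den k n w * inverse (sf' k n) * rGamma (of_real (a' k) * s0 n w + of_real (b' k))"
        if "k \<in> {1..K}" for k
        using dz[OF that] by (simp add: den_def)
      have "s1 n w = s0 n w + of_real (\<tau> n)" by (simp add: s1_def s0_def)
      hence 3: "of_real D powr s1 n w = of_real D powr s0 n w * of_real (exp (ln D * \<tau> n))"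
        and 4: "exp (- (s1 n w * of_real y)) = exp (- (s0 n w * of_real y)) * of_real (exp (- y * \<tau> n))"
        using D_pos by (simp_all add: powr_add powr_of_real exp_add[symmetric] exp_of_real[symmetric] algebra_simps powr_def Ln_of_real)
      have 5: "exp ((ln D - y) * \<tau> n) = exp (ln D * \<tau> n) * exp (- y * \<tau> n)"
        by (simp add: exp_add[symmetric] algebra_simps)
      show "integrand y (s1 n w) = Q n * integrand y (s0 n w) * U n w"
        unfolding integrand_def F_eq_G[OF nosing(1)] F_eq_G[OF nosing(2)] G_def 3 4 Q_def U_def 5
        by (simp add: 1 2 prod.distrib prod_inversef[unfolded o_def] divide_inverse mult_ac cong: prod.cong_simp)
    qed
  qed

  \<comment> \<open>The limit is the residue of the integrand at \<rho>, nonzero because the pole is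
    simple.\<close>
  obtain c where c: "c \<noteq> 0" "((\<lambda>w. w * integrand y (of_real \<rho> + w)) \<longlongrightarrow> c) (at 0)"
  proof -
    obtain c0 where c0: "c0 \<noteq> 0" "((\<lambda>w. w * F (of_real \<rho> + w)) \<longlongrightarrow> c0) (at 0)"
      using simple_pole_tendsto[OF F_isolated_singularity \<rho>0(2) simple[OF \<rho>(1)]] by metis
    have "((\<lambda>w. exp (- ((of_real \<rho> + w) * of_real y)) * (w * F (of_real \<rho> + w))) \<longlongrightarrow> exp (- ((of_real \<rho> + 0) * of_real y)) * c0) (at 0)"
      by (intro tendsto_intros c0(2))
    thus ?thesis using c0(1) by (intro that[of "exp (- ((of_real \<rho> + 0) * of_real y)) * c0"]) (auto simp: integrand_def mult_ac)
  qed
  have "uniform_limit (sphere 0 1) (\<lambda>n w. of_real (r n) * w * integrand y (s0 n w)) (\<lambda>_. c) sequentially"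
    using uniform_limit_sphere_at_0[OF c(2) r_pos r_lim] by (simp add: s0_def)
  from uniform_lim_mult[OF this U]
  have V: "uniform_limit (sphere 0 1) (\<lambda>n w. of_real (r n) * w * integrand y (s0 n w) * U n w) (\<lambda>_. c) sequentially"
    by (auto simp: image_constant_conv)

  have sf_size: "\<exists>M. M \<ge> 0 \<and> eventually (\<lambda>n. sf j n \<noteq> 0 \<and>
     \<bar>ln (norm (sf j n)) - gamma_size (a j) (of_real (\<rho> + \<tau> n))\<bar> \<le> M * ln (\<rho> + \<tau> n)) sequentially" if "j \<in> {1..J}" for j
    unfolding sf_def by (rule shift_factor_size[OF a_nonzero[OF that] regj[OF that]]) blast
  have sf'_size: "\<exists>M. M \<ge> 0 \<and> eventually (\<lambda>n. sf' k n \<noteq> 0 \<and>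
     \<bar>ln (norm (sf' k n)) - gamma_size (a' k) (of_real (\<rho> + \<tau> n))\<bar> \<le> M * ln (\<rho> + \<tau> n)) sequentially" if "k \<in> {1..K}" for k
    unfolding sf'_def by (rule shift_factor_size[OF a'_nonzero[OF that] regk[OF that]]) blast
  have "\<forall>j\<in>{1..J}. \<exists>M. M \<ge> 0 \<and> eventually (\<lambda>n. sf j n \<noteq> 0 \<and>
     \<bar>ln (norm (sf j n)) - gamma_size (a j) (of_real (\<rho> + \<tau> n))\<bar> \<le> M * ln (\<rho> + \<tau> n)) sequentially"
    by (rule ballI) (rule sf_size)
  from bchoice[OF this] obtain M1 where M1: "\<forall>j\<in>{1..J}. M1 j \<ge> 0 \<and> eventually (\<lambda>n. sf j n \<noteq> 0 \<and>
     \<bar>ln (norm (sf j n)) - gamma_size (a j) (of_real (\<rho> + \<tau> n))\<bar> \<le> M1 j * ln (\<rho> + \<tau> n)) sequentially" by (elim exE)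
  have "\<forall>k\<in>{1..K}. \<exists>M. M \<ge> 0 \<and> eventually (\<lambda>n. sf' k n \<noteq> 0 \<and>
     \<bar>ln (norm (sf' k n)) - gamma_size (a' k) (of_real (\<rho> + \<tau> n))\<bar> \<le> M * ln (\<rho> + \<tau> n)) sequentially"
    by (rule ballI) (rule sf'_size)
  from bchoice[OF this] obtain M2 where M2: "\<forall>k\<in>{1..K}. M2 k \<ge> 0 \<and> eventually (\<lambda>n. sf' k n \<noteq> 0 \<and>
     \<bar>ln (norm (sf' k n)) - gamma_size (a' k) (of_real (\<rho> + \<tau> n))\<bar> \<le> M2 k * ln (\<rho> + \<tau> n)) sequentially" by (elim exE)
  have ev1: "eventually (\<lambda>n. \<forall>j\<in>{1..J}. sf j n \<noteq> 0 \<and>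
     \<bar>ln (norm (sf j n)) - gamma_size (a j) (of_real (\<rho> + \<tau> n))\<bar> \<le> M1 j * ln (\<rho> + \<tau> n)) sequentially"
    using M1 by (intro eventually_ball_finite) auto
  have ev2: "eventually (\<lambda>n. \<forall>k\<in>{1..K}. sf' k n \<noteq> 0 \<and>
     \<bar>ln (norm (sf' k n)) - gamma_size (a' k) (of_real (\<rho> + \<tau> n))\<bar> \<le> M2 k * ln (\<rho> + \<tau> n)) sequentially"
    using M2 by (intro eventually_ball_finite) auto
  define M where "M = (\<Sum>j=1..J. M1 j) + (\<Sum>k=1..K. M2 k)"
  \<comment> \<open>A lower bound for ln |Q n| at x = \<rho> + \<tau> n; the last term compensates
    for writing x instead of \<tau> n in the exponential factor of \<open>Q n\<close>.\<close>
  define gr where "gr x = \<gamma>' * (x * ln x - x) + (\<kappa> - y) * x - M * ln x - (ln D - y) * \<rho>" for x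
  have "filterlim (\<lambda>n. \<rho> + \<tau> n) at_top sequentially"
    by (intro filterlim_tendsto_add_at_top[OF tendsto_const] \<tau>_lim)
  hence grlim: "filterlim (\<lambda>n. gr (\<rho> + \<tau> n)) at_top sequentially"
    unfolding gr_def by (rule filterlim_compose[OF exp_growth_at_top[OF \<gamma>']])
  have evQ: "eventually (\<lambda>n. Q n \<noteq> 0 \<and> gr (\<rho> + \<tau> n) \<le> ln (norm (Q n))) sequentially"
    using ev1 ev2
  proof eventually_elim
    case (elim n)
    define x where "x = \<rho> + \<tau> n"
    have x0: "x > 0" using \<rho>0 \<tau>_ge[of n] by (simp add: x_def)
    have nz: "(\<Prod>j=1..J. sf j n) \<noteq> 0" "(\<Prod>k=1..K. sf' k n) \<noteq> 0" using elim by auto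
    hence Q0: "Q n \<noteq> 0" by (simp add: Q_def)
    have "ln (norm (Q n)) = ln (norm (\<Prod>j=1..J. sf j n)) - ln (norm (\<Prod>k=1..K. sf' k n)) + (ln D - y) * \<tau> n"
      unfolding Q_def norm_mult norm_divide norm_of_real using nz by (simp add: ln_mult ln_div)
    also have "ln (norm (\<Prod>j=1..J. sf j n)) = (\<Sum>j=1..J. ln (norm (sf j n)))"
      by (subst prod_norm[symmetric], subst ln_prod) (use elim in auto)
    also have "ln (norm (\<Prod>k=1..K. sf' k n)) = (\<Sum>k=1..K. ln (norm (sf' k n)))"
      by (subst prod_norm[symmetric], subst ln_prod) (use elim in auto)
    finally have lnQ: "ln (norm (Q n)) = (\<Sum>j=1..J. ln (norm (sf j n))) - (\<Sum>k=1..K. ln (norm (sf' k n))) + (ln D - y) * \<tau> n" .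
    have "(\<Sum>j=1..J. gamma_size (a j) (of_real x) - M1 j * ln x) \<le> (\<Sum>j=1..J. ln (norm (sf j n)))"
      using elim(1) unfolding x_def by (intro sum_mono) (force simp: abs_le_iff)
    hence l1: "(\<Sum>j=1..J. gamma_size (a j) (of_real x)) - (\<Sum>j=1..J. M1 j) * ln x \<le> (\<Sum>j=1..J. ln (norm (sf j n)))"
      by (simp add: sum_subtractf sum_distrib_right)
    have "(\<Sum>k=1..K. ln (norm (sf' k n))) \<le> (\<Sum>k=1..K. gamma_size (a' k) (of_real x) + M2 k * ln x)"
      using elim(2) unfolding x_def by (intro sum_mono) (force simp: abs_le_iff)
    hence l2: "(\<Sum>k=1..K. ln (norm (sf' k n))) \<le> (\<Sum>k=1..K. gamma_size (a' k) (of_real x)) + (\<Sum>k=1..K. M2 k) * ln x"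
      by (simp add: sum.distrib sum_distrib_right)
    have "Re (complex_of_real x * Ln (of_real x)) = x * ln x" using x0 by (simp add: Ln_of_real)
    hence sz: "(\<Sum>j=1..J. gamma_size (a j) (of_real x)) - (\<Sum>k=1..K. gamma_size (a' k) (of_real x)) =
      \<gamma>' * (x * ln x - x) + (\<kappa> - ln D) * x"
      using sum_gamma_size[where J = J and a = a and s = "of_real x" and K = K and a' = a' and D = D] by simp
    have "gr x = \<gamma>' * (x * ln x - x) + (\<kappa> - ln D) * x
        - ((\<Sum>j=1..J. M1 j) * ln x + (\<Sum>k=1..K. M2 k) * ln x) + (ln D - y) * \<tau> n"
      by (simp add: gr_def M_def x_def algebra_simps)
    also have "\<dots> \<le> ln (norm (Q n))" unfolding lnQ using l1 l2 sz by linarith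
    finally show ?case using Q0 by (simp add: x_def)
  qed

  obtain \<delta> where \<delta>: "\<delta> > 0" and near: "eventually (\<lambda>n. \<forall>j\<in>{1..J}. \<forall>x. \<bar>x - (\<rho> + \<tau> n)\<bar> \<le> 2 * \<delta> \<longrightarrow> a j * x + b j \<in> \<int> \<longrightarrow>
            \<bar>x - (\<rho> + \<tau> n)\<bar> < r n) sequentially"
  proof -
    have "eventually (\<lambda>\<delta>. \<forall>j\<in>{1..J}. eventually (\<lambda>n. \<forall>x. \<bar>x - (\<rho> + \<tau> n)\<bar> \<le> 2 * \<delta> \<longrightarrow> a j * x + b j \<in> \<int> \<longrightarrow>
            \<bar>x - (\<rho> + \<tau> n)\<bar> < r n) sequentially) (at_right 0)"
      by (intro eventually_ball_finite ballI affine_ints_near a_nonzero per(1)) auto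
    moreover have "eventually (\<lambda>\<delta>. \<delta> > 0) (at_right (0::real))" by (rule eventually_at_right_less)
    ultimately have "eventually (\<lambda>\<delta>. \<delta> > 0 \<and> (\<forall>j\<in>{1..J}. eventually (\<lambda>n. \<forall>x. \<bar>x - (\<rho> + \<tau> n)\<bar> \<le> 2 * \<delta> \<longrightarrow> a j * x + b j \<in> \<int> \<longrightarrow>
            \<bar>x - (\<rho> + \<tau> n)\<bar> < r n) sequentially)) (at_right 0)" by eventually_elim simp
    from eventually_happens'[OF _ this] obtain \<delta> where "\<delta> > 0" "\<forall>j\<in>{1..J}. eventually (\<lambda>n. \<forall>x. \<bar>x - (\<rho> + \<tau> n)\<bar> \<le> 2 * \<delta> \<longrightarrow> a j * x + b j \<in> \<int> \<longrightarrow>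
            \<bar>x - (\<rho> + \<tau> n)\<bar> < r n) sequentially" by auto
    thus ?thesis by (intro that[of \<delta>] eventually_ball_finite) auto
  qed
  have near_pole: "eventually (\<lambda>n. r n < \<delta> / 2 \<and> (\<forall>x. is_pole F (of_real x) \<longrightarrow> \<bar>x - (\<rho> + \<tau> n)\<bar> \<le> 2 * \<delta> \<longrightarrow> \<bar>x - (\<rho> + \<tau> n)\<bar> < r n)) sequentially"
  proof -
    have "eventually (\<lambda>n. r n < \<delta> / 2) sequentially" using r_lim \<delta> by (intro order_tendstoD(2)) auto
    with near show ?thesis
    proof eventually_elim
      case (elim n)
      have "\<exists>j\<in>{1..J}. a j * x + b j \<in> \<int>" if "is_pole F (of_real x)" for x
        using singularity_lattice[OF F_pole_singularity[OF that]] by (metis Ints_of_int Re_complex_of_real)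
      thus ?case using elim by blast
    qed
  qed

  define Sm where "Sm R = (\<Sum>x\<in>{x\<in>pos_poles F. x \<le> R}. fY_residue_term F y x)" for R
  \<comment> \<open>Poles within 2 \<delta> of the centre lie within r n < \<delta> / 2 of it, and
    all others are more than 2 \<delta> away. Both truncation points therefore keep distance
    \<delta> / 2 from every pole and run through the filter \<open>cutoffs\<close>.\<close>
  define Rp where "Rp n = \<rho> + \<tau> n + \<delta>" for n
  define Rm where "Rm n = \<rho> + \<tau> n - \<delta>" for n
  have cut: "filterlim Rp (cutoffs (pos_poles F)) sequentially" "filterlim Rm (cutoffs (pos_poles F)) sequentially"
  proof -
    have "eventually (\<lambda>n. P (Rp n) \<and> P (Rm n)) sequentially" if P: "eventually P (cutoffs (pos_poles F))" for P
    proof -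
      have "\<delta> / 2 > 0" using \<delta> by simp
      then obtain N where N: "\<And>R. R \<ge> N \<Longrightarrow> (\<forall>\<rho>\<in>pos_poles F. \<delta> / 2 \<le> \<bar>R - \<rho>\<bar>) \<Longrightarrow> P R"
        using P unfolding eventually_cutoffs_iff by metis
      have "eventually (\<lambda>n. \<tau> n \<ge> N + \<delta> - \<rho>) sequentially" using \<tau>_lim by (simp add: filterlim_at_top)
      with near_pole show ?thesis
      proof eventually_elim
        case (elim n)
        have far: "\<delta> / 2 \<le> \<bar>Rp n - x\<bar> \<and> \<delta> / 2 \<le> \<bar>Rm n - x\<bar>" if "x \<in> pos_poles F" for x
        proof (cases "\<bar>x - (\<rho> + \<tau> n)\<bar> \<le> 2 * \<delta>")
          case True
          hence "\<bar>x - (\<rho> + \<tau> n)\<bar> < \<delta> / 2" using elim that by (force simp: pos_poles_def)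
          thus ?thesis unfolding Rp_def Rm_def by linarith
        next
          case False
          thus ?thesis using \<delta> unfolding Rp_def Rm_def by linarith
        qed
        hence "\<forall>x\<in>pos_poles F. \<delta> / 2 \<le> \<bar>Rp n - x\<bar>" "\<forall>x\<in>pos_poles F. \<delta> / 2 \<le> \<bar>Rm n - x\<bar>"
          by blast+
        moreover have "Rp n \<ge> N" "Rm n \<ge> N" using elim \<delta> by (auto simp: Rp_def Rm_def)
        ultimately show ?case using N by blast
      qed
    qed
    thus "filterlim Rp (cutoffs (pos_poles F)) sequentially" "filterlim Rm (cutoffs (pos_poles F)) sequentially"
      unfolding filterlim_iff by (simp_all add: eventually_conj_iff)
  qed
  define I where "I n = contour_integral (circlepath (of_real (\<rho> + \<tau> n)) (r n)) (integrand y)" for n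
  \<comment> \<open>The two partial sums differ exactly by the cluster of poles inside the circle.
    The condition \<tau> n \<ge> 2 \<delta> keeps the disc of radius 2 \<delta> in the right
    half-plane, so that every pole in it is a positive one.\<close>
  have block: "eventually (\<lambda>n. 2 * pi * \<i> * (Sm (Rp n) - Sm (Rm n)) = - I n \<and> continuous_on (sphere (of_real (\<rho> + \<tau> n)) (r n)) (integrand y)) sequentially"
  proof -
    have "eventually (\<lambda>n. \<tau> n \<ge> 2 * \<delta>) sequentially" using \<tau>_lim by (simp add: filterlim_at_top)
    with near_pole show ?thesis
    proof eventually_elim
      case (elim n)
      define z where "z = complex_of_real (\<rho> + \<tau> n)"
      define P where "P = {x\<in>pos_poles F. Rm n < x \<and> x \<le> Rp n}"
      have fin: "finite {x\<in>pos_poles F. x \<le> R}" for R by (rule finite_pos_poles_le[OF D_pos a_nonzero])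
      have finP: "finite P" by (rule finite_subset[OF _ fin[of "Rp n"]]) (auto simp: P_def)
      have "{x\<in>pos_poles F. x \<le> Rp n} = {x\<in>pos_poles F. x \<le> Rm n} \<union> P" using \<delta> by (auto simp: P_def Rp_def Rm_def)
      hence "Sm (Rp n) = Sm (Rm n) + (\<Sum>x\<in>P. fY_residue_term F y x)"
        unfolding Sm_def using fin finP by (simp add: sum.union_disjoint P_def disjoint_iff)
      hence 1: "Sm (Rp n) - Sm (Rm n) = - (\<Sum>x\<in>P. residue (integrand y) (of_real x))"
        using term_eq by (simp add: P_def sum_negf)
      have small: "\<bar>x - (\<rho> + \<tau> n)\<bar> < r n" if "x \<in> P" for x
        using elim that \<delta> by (auto simp: P_def Rp_def Rm_def pos_poles_def abs_le_iff)
      have dist_z: "dist z (of_real x) = \<bar>x - (\<rho> + \<tau> n)\<bar>" for x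
        unfolding z_def dist_of_real by (simp add: dist_real_def abs_minus_commute)
      have sub: "of_real ` P \<subseteq> ball z (r n)" using small by (auto simp: dist_z)
      have np: "\<not> is_pole F s" if s: "s \<in> ball z (2 * \<delta>) - of_real ` P" for s
      proof
        assume p: "is_pole F s"
        define x where "x = Re s"
        have sx: "s = of_real x" using F_pole_real[OF p] by (simp add: x_def)
        have "\<bar>x - (\<rho> + \<tau> n)\<bar> < 2 * \<delta>" using s unfolding sx by (auto simp: dist_z)
        hence "\<bar>x - (\<rho> + \<tau> n)\<bar> < \<delta> / 2" using elim p unfolding sx by force
        hence "x \<in> P" using elim \<delta> \<rho>0 p unfolding sx by (auto simp: P_def pos_poles_def Rp_def Rm_def abs_if split: if_splits)
        thus False using s sx by blast
      qed
      have hol: "integrand y holomorphic_on ball z (2 * \<delta>) - of_real ` P"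
        by (rule analytic_imp_holomorphic, subst analytic_on_analytic_at, intro ballI integrand_analytic np)
      have "I n = 2 * pi * \<i> * (\<Sum>s\<in>of_real ` P. residue (integrand y) s)"
        unfolding I_def z_def[symmetric]
        by (rule circlepath_sum_residues[OF r_pos _ _ sub hol]) (use elim finP \<delta> in auto)
      also have "(\<Sum>s\<in>of_real ` P. residue (integrand y) s) = (\<Sum>x\<in>P. residue (integrand y) (of_real x))"
        by (subst sum.reindex) (auto simp: inj_on_def)
      finally have 2: "I n = 2 * pi * \<i> * (\<Sum>x\<in>P. residue (integrand y) (of_real x))" .
      have "sphere z (r n) \<subseteq> ball z (2 * \<delta>) - of_real ` P" using elim \<delta> sub by auto
      hence "continuous_on (sphere z (r n)) (integrand y)"
        using hol holomorphic_on_imp_continuous_on continuous_on_subset by blast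
      thus ?case using 1 2 by (simp add: z_def)
    qed
  qed
  have Ilim: "(\<lambda>n. I n / Q n) \<longlonglongrightarrow> 2 * pi * \<i> * c"
  proof (rule tendstoI)
    fix e :: real assume e: "e > 0"
    define \<epsilon> where "\<epsilon> = e / (4 * pi)"
    have \<epsilon>: "\<epsilon> > 0" "2 * pi * \<epsilon> < e" using e by (auto simp: \<epsilon>_def)
    have "eventually (\<lambda>n. \<forall>w\<in>sphere 0 1. dist (of_real (r n) * w * integrand y (s0 n w) * U n w) c < \<epsilon>) sequentially"
      using V \<epsilon>(1) unfolding uniform_limit_iff by blast
    with block shift_h evQ show "eventually (\<lambda>n. dist (I n / Q n) (2 * pi * \<i> * c) < e) sequentially"
    proof eventually_elim
      case (elim n)
      have "norm (I n / Q n - 2 * pi * \<i> * c) \<le> 2 * pi * \<epsilon>" unfolding I_def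
      proof (rule contour_integral_circlepath_near[OF r_pos])
        fix w :: complex assume w: "w \<in> sphere 0 1"
        have "integrand y (of_real (\<rho> + \<tau> n) + of_real (r n) * w) = Q n * integrand y (s0 n w) * U n w"
          using elim w by (simp add: s1_def)
        hence "of_real (r n) * w * integrand y (of_real (\<rho> + \<tau> n) + of_real (r n) * w) / Q n = of_real (r n) * w * integrand y (s0 n w) * U n w"
          using elim by simp
        thus "norm (of_real (r n) * w * integrand y (of_real (\<rho> + \<tau> n) + of_real (r n) * w) / Q n - c) \<le> \<epsilon>"
          using elim(4) w by (simp only:) (auto simp: dist_norm intro!: less_imp_le)
      qed (use elim \<epsilon> in auto)
      thus ?case using \<epsilon>(2) by (simp add: dist_norm)
    qed
  qed
  \<comment> \<open>Convergence would force the differences of the partial sums, and with them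
    \<open>I n\<close>, to tend to 0. As |Q n| is eventually at least 1, the quotient I n / Q n
    would tend to 0 too, contrary to its nonzero limit.\<close>
  show ?thesis unfolding pole_sum_diverges_def
  proof
    assume "\<exists>S. has_pole_sum (fY_residue_term F y) (pos_poles F) S"
    then obtain S where "(Sm \<longlongrightarrow> S) (cutoffs (pos_poles F))" unfolding has_pole_sum_def Sm_def[abs_def] by blast
    hence "(\<lambda>n. Sm (Rp n) - Sm (Rm n)) \<longlonglongrightarrow> S - S"
      by (intro tendsto_diff filterlim_compose[OF _ cut(1)] filterlim_compose[OF _ cut(2)])
    hence "(\<lambda>n. Sm (Rp n) - Sm (Rm n)) \<longlonglongrightarrow> 0" by simp
    from tendsto_mult_right_zero[OF this, of "- (2 * pi * \<i>)"]
    have "(\<lambda>n. - (2 * pi * \<i> * (Sm (Rp n) - Sm (Rm n)))) \<longlonglongrightarrow> 0" by simp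
    moreover have "eventually (\<lambda>n. - (2 * pi * \<i> * (Sm (Rp n) - Sm (Rm n))) = I n) sequentially"
      using block by eventually_elim simp
    ultimately have I0: "I \<longlonglongrightarrow> 0" by (rule Lim_transform_eventually)
    have "eventually (\<lambda>n. gr (\<rho> + \<tau> n) \<ge> 0) sequentially" using grlim by (simp add: filterlim_at_top)
    hence "eventually (\<lambda>n. norm (I n / Q n) \<le> norm (I n)) sequentially"
      using evQ
    proof eventually_elim
      case (elim n)
      hence "0 \<le> ln (norm (Q n))" by linarith
      moreover have "norm (Q n) > 0" using elim by simp
      ultimately have "norm (Q n) \<ge> 1" using ln_less_zero_iff[of "norm (Q n)"] by linarith
      thus ?case using divide_left_mono[of 1 "norm (Q n)" "norm (I n)"]
        by (cases "Q n = 0") (auto simp: norm_divide)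
    qed
    hence "(\<lambda>n. I n / Q n) \<longlonglongrightarrow> 0" using tendsto_norm_zero[OF I0] by (rule Lim_null_comparison)
    from LIMSEQ_unique[OF this Ilim] show False using c(1) by simp
  qed
qed

end

section \<open>The densities of X and ln X\<close>

lemma measure_distributed_Ioc:
  fixes Z :: "'a \<Rightarrow> real" and f :: "real \<Rightarrow> real"
  assumes dist: "distributed M lborel Z (\<lambda>x. ennreal (f x))" and f: "\<And>x. 0 \<le> f x"
    and cont: "continuous_on {a..b} f" and ab: "a \<le> b"
  shows "measure M {\<omega>\<in>space M. a < Z \<omega> \<and> Z \<omega> \<le> b} = integral {a..b} f"
proof -
  have fm: "f \<in> borel_measurable borel"
    using distributed_real_measurable[OF _ dist] f by simp
  have Z: "Z \<in> measurable M lborel" using dist by (simp add: distributed_def)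
  have "measure M {\<omega>\<in>space M. a < Z \<omega> \<and> Z \<omega> \<le> b} = measure M (Z -` {a<..b} \<inter> space M)"
    by (rule arg_cong[where f = "measure M"]) auto
  also have "\<dots> = measure (distr M lborel Z) {a<..b}" using Z by (simp add: measure_distr)
  also have "distr M lborel Z = density lborel (\<lambda>x. ennreal (f x))" using dist by (simp add: distributed_def)
  also have "measure \<dots> {a<..b} = integral {a..b} f" by (rule measure_density_Ioc[OF fm f cont ab])
  finally show ?thesis .
qed

text \<open>A distribution fixes its density only up to null sets; continuity makes the change of
  variables pointwise. The masses of (y, v] for ln X and of (exp y, exp v] for X agree, and both are
  differentiated in v at the left end point v = y.\<close>

lemma density_ln_transform:
  fixes X :: "'a \<Rightarrow> real" and f g :: "real \<Rightarrow> real"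
  assumes X: "X \<in> borel_measurable M" and pos: "AE \<omega> in M. 0 < X \<omega>"
    and f: "distributed M lborel X (\<lambda>x. ennreal (f x))" "\<And>x. 0 \<le> f x" "continuous_on {0<..} f"
    and g: "distributed M lborel (\<lambda>\<omega>. ln (X \<omega>)) (\<lambda>x. ennreal (g x))" "\<And>x. 0 \<le> g x" "continuous_on UNIV g"
  shows "f (exp y) * exp y = g y"
proof -
  have eq: "integral {y..v} g = integral {exp y..exp v} f" if v: "v \<in> {y..y+1}" for v
  proof -
    have "measure M {\<omega>\<in>space M. y < ln (X \<omega>) \<and> ln (X \<omega>) \<le> v} = measure M {\<omega>\<in>space M. exp y < X \<omega> \<and> X \<omega> \<le> exp v}"
    proof (rule measure_eq_AE)
      show "AE \<omega> in M. \<omega> \<in> {\<omega>\<in>space M. y < ln (X \<omega>) \<and> ln (X \<omega>) \<le> v} \<longleftrightarrow> \<omega> \<in> {\<omega>\<in>space M. exp y < X \<omega> \<and> X \<omega> \<le> exp v}"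
        using pos
      proof eventually_elim
        case (elim \<omega>)
        have "y < ln (X \<omega>) \<longleftrightarrow> exp y < X \<omega>" "ln (X \<omega>) \<le> v \<longleftrightarrow> X \<omega> \<le> exp v"
          using elim by (metis exp_less_cancel_iff exp_ln, metis exp_le_cancel_iff exp_ln)
        thus ?case by simp
      qed
    qed (use X in measurable)
    moreover have "measure M {\<omega>\<in>space M. y < ln (X \<omega>) \<and> ln (X \<omega>) \<le> v} = integral {y..v} g"
      using v by (intro measure_distributed_Ioc[OF g(1,2)] continuous_on_subset[OF g(3)]) auto
    moreover have "measure M {\<omega>\<in>space M. exp y < X \<omega> \<and> X \<omega> \<le> exp v} = integral {exp y..exp v} f"
    proof (intro measure_distributed_Ioc[OF f(1,2)] continuous_on_subset[OF f(3)])
      show "{exp y..exp v} \<subseteq> {0<..}" by (auto intro: less_le_trans[OF exp_gt_zero])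
    qed (use v in auto)
    ultimately show ?thesis by simp
  qed
  have "((\<lambda>v. integral {y..v} g) has_real_derivative g y) (at y within {y..y+1})"
    by (intro integral_has_real_derivative continuous_on_subset[OF g(3)]) auto
  moreover have "((\<lambda>v. integral {y..v} g) has_real_derivative f (exp y) * exp y) (at y within {y..y+1})"
  proof -
    have "((\<lambda>t. integral {exp y..t} f) has_real_derivative f (exp y)) (at (exp y) within {exp y..exp (y+1)})"
    proof (intro integral_has_real_derivative continuous_on_subset[OF f(3)])
      show "{exp y..exp (y+1)} \<subseteq> {0<..}" by (auto intro: less_le_trans[OF exp_gt_zero])
    qed auto
    hence "((\<lambda>t. integral {exp y..t} f) has_real_derivative f (exp y)) (at (exp y) within exp ` {y..y+1})"
      by (rule DERIV_subset) auto
    moreover have "(exp has_real_derivative exp y) (at y within {y..y+1})"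
      by (rule has_field_derivative_at_within) (rule DERIV_exp)
    ultimately have "((\<lambda>t. integral {exp y..t} f) \<circ> exp has_real_derivative f (exp y) * exp y) (at y within {y..y+1})"
      by (rule DERIV_image_chain)
    thus ?thesis
      by (rule has_field_derivative_transform_within[where d = 1]) (auto simp: eq)
  qed
  ultimately show ?thesis
    unfolding has_real_derivative_iff_has_vector_derivative
    using vector_derivative_unique_within_closed_interval[of y "y + 1" y] by (simp add: box_real) 
qed

section \<open>Transfer of pole sums between the two variables\<close>

lemma has_pole_sum_divide:
  assumes "has_pole_sum t P S"
  shows "has_pole_sum (\<lambda>\<rho>. t \<rho> / c) P (S / c)"
  using tendsto_mult_right[OF assms[unfolded has_pole_sum_def], of "inverse c"]
  by (simp add: has_pole_sum_def divide_inverse sum_distrib_right)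

lemma has_pole_sum_cong:
  assumes "\<And>\<rho>. \<rho> \<in> P \<Longrightarrow> t \<rho> = t' \<rho>"
  shows "has_pole_sum t P S \<longleftrightarrow> has_pole_sum t' P S"
  unfolding has_pole_sum_def by (simp add: assms cong: sum.cong_simp)

lemma has_pole_sum_fX_pole_term:
  assumes "x > 0" "has_pole_sum (fY_pole_term F (ln x)) P S"
  shows "has_pole_sum (fX_pole_term F x) P (S / of_real x)"
  using has_pole_sum_divide[OF assms(2), of "of_real x"] fX_pole_term_eq[OF assms(1)] by (simp cong: has_pole_sum_cong)

lemma pole_sum_diverges_fX_residue_term:
  assumes x: "x > 0" and div: "pole_sum_diverges (fY_residue_term F (ln x)) P"
  shows "pole_sum_diverges (fX_residue_term F x) P"
  unfolding pole_sum_diverges_def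
proof
  assume "\<exists>S. has_pole_sum (fX_residue_term F x) P S"
  then obtain S where S: "has_pole_sum (fX_residue_term F x) P S" by blast
  have "has_pole_sum (\<lambda>\<rho>. fX_residue_term F x \<rho> / (1 / of_real x)) P (S / (1 / of_real x))"
    by (rule has_pole_sum_divide[OF S])
  moreover have "(\<lambda>\<rho>. fX_residue_term F x \<rho> / (1 / of_real x)) = fY_residue_term F (ln x)"
    using x by (simp add: fun_eq_iff fX_residue_term_eq)
  ultimately show False using div unfolding pole_sum_diverges_def by auto
qed

theorem theorem6p5:
  fixes M :: "'w measure" and X :: "'w \<Rightarrow> real"
    and C D :: real and J K :: nat and a b a' b' :: "nat \<Rightarrow> real"
    and f\<^sub>X f\<^sub>Y :: "real \<Rightarrow> real"
  defines "F \<equiv> gamma_type_fun C D J a b K a' b'"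
    and "\<gamma> \<equiv> gamma_param J a K a'"
    and "\<gamma>' \<equiv> gamma'_param J a K a'"
    and "\<kappa> \<equiv> kappa_param D J a K a'"
  assumes "prob_space M"
    and "X \<in> borel_measurable M"
    and "AE \<omega> in M. 0 < X \<omega>"
    and "moments_of_gamma_type M X C D J a b K a' b'"
    and "continuous_density_on M X {0<..} f\<^sub>X"
    and "continuous_density_on M (\<lambda>\<omega>. ln (X \<omega>)) UNIV f\<^sub>Y"
    and "\<gamma> > 0"
  shows
    "(\<gamma>' < 0 \<longrightarrow>
        (\<forall>x>0. has_pole_sum (fX_pole_term F x) (pos_poles F) (of_real (f\<^sub>X x))) \<and>
        (\<forall>y. has_pole_sum (fY_pole_term F y) (pos_poles F) (of_real (f\<^sub>Y y))) \<and>
        ((\<forall>s. is_pole F s \<longrightarrow> pole_order F s = 1) \<longrightarrow>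
           (\<forall>x>0. has_pole_sum (fX_residue_term F x) (pos_poles F) (of_real (f\<^sub>X x))) \<and>
           (\<forall>y. has_pole_sum (fY_residue_term F y) (pos_poles F) (of_real (f\<^sub>Y y))))) \<and>
     (\<gamma>' > 0 \<longrightarrow>
        infinite (pos_poles F) \<and> (\<forall>\<rho>\<in>pos_poles F. pole_order F (of_real \<rho>) = 1) \<longrightarrow>
          (\<forall>x>0. pole_sum_diverges (fX_residue_term F x) (pos_poles F)) \<and>
          (\<forall>y. pole_sum_diverges (fY_residue_term F y) (pos_poles F))) \<and>
     (\<gamma>' = 0 \<longrightarrow>
        (\<forall>x>exp \<kappa>. has_pole_sum (fX_pole_term F x) (pos_poles F) (of_real (f\<^sub>X x))) \<and>
        (\<forall>y>\<kappa>. has_pole_sum (fY_pole_term F y) (pos_poles F) (of_real (f\<^sub>Y y))) \<and>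
        ((\<forall>s. is_pole F s \<longrightarrow> pole_order F s = 1) \<longrightarrow>
           (\<forall>x>exp \<kappa>. has_pole_sum (fX_residue_term F x) (pos_poles F) (of_real (f\<^sub>X x))) \<and>
           (\<forall>y>\<kappa>. has_pole_sum (fY_residue_term F y) (pos_poles F) (of_real (f\<^sub>Y y)))) \<and>
        (infinite (pos_poles F) \<and> (\<forall>\<rho>\<in>pos_poles F. pole_order F (of_real \<rho>) = 1) \<longrightarrow>
           (\<forall>x. 0 < x \<and> x < exp \<kappa> \<longrightarrow> pole_sum_diverges (fX_residue_term F x) (pos_poles F)) \<and>
           (\<forall>y<\<kappa>. pole_sum_diverges (fY_residue_term F y) (pos_poles F))))"
proof -
  define Y where "Y \<omega> = ln (X \<omega>)" for \<omega>
  obtain l u where D: "D > 0" and a: "\<And>j. j \<in> {1..J} \<Longrightarrow> a j \<noteq> 0" "\<And>k. k \<in> {1..K} \<Longrightarrow> a' k \<noteq> 0"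
    and lu: "l < u" and mom: "\<forall>s\<in>{l<..<u}. integrable M (\<lambda>\<omega>. X \<omega> powr s) \<and>
        of_real (integral\<^sup>L M (\<lambda>\<omega>. X \<omega> powr s)) = F (of_real s)"
    using assms(8) unfolding moments_of_gamma_type_def F_def by auto
  interpret gamma_type C D J K a b a' b' by unfold_locales (use D a in auto)
  have fX: "distributed M lborel X (\<lambda>x. ennreal (f\<^sub>X x))" "\<And>x. 0 \<le> f\<^sub>X x" "continuous_on {0<..} f\<^sub>X"
    and fY: "distributed M lborel Y (\<lambda>x. ennreal (f\<^sub>Y x))" "\<And>x. 0 \<le> f\<^sub>Y x" "continuous_on UNIV f\<^sub>Y"
    using assms(9,10) by (auto simp: continuous_density_on_def Y_def[abs_def])
  have Xm [measurable]: "X \<in> borel_measurable M" by fact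
  \<comment> \<open>Where X vanishes the sides differ, as \<open>0 powr s\<close> is 0; hence the
    almost sure form.\<close>
  have powr_eq: "AE \<omega> in M. X \<omega> powr s = exp (s * Y \<omega>)" for s
    using assms(7) by eventually_elim (simp add: powr_def Y_def)
  have momY: "integrable M (\<lambda>\<omega>. exp (s * Y \<omega>))" "F (of_real s) = of_real (\<integral>\<omega>. exp (s * Y \<omega>) \<partial>M)"
    if "l < s" "s < u" for s
  proof -
    have "integrable M (\<lambda>\<omega>. X \<omega> powr s) \<longleftrightarrow> integrable M (\<lambda>\<omega>. exp (s * Y \<omega>))"
      by (rule integrable_cong_AE[OF _ _ powr_eq]) (simp_all add: Y_def)
    moreover have "(\<integral>\<omega>. X \<omega> powr s \<partial>M) = (\<integral>\<omega>. exp (s * Y \<omega>) \<partial>M)"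
      by (rule integral_cong_AE[OF _ _ powr_eq]) (simp_all add: Y_def)
    moreover have "integrable M (\<lambda>\<omega>. X \<omega> powr s)" "F (of_real s) = of_real (\<integral>\<omega>. X \<omega> powr s \<partial>M)"
      using mom that by auto
    ultimately show "integrable M (\<lambda>\<omega>. exp (s * Y \<omega>))" "F (of_real s) = of_real (\<integral>\<omega>. exp (s * Y \<omega>) \<partial>M)"
      by simp_all
  qed
  have fXY: "complex_of_real (f\<^sub>X x) = of_real (f\<^sub>Y (ln x)) / of_real x" if "x > 0" for x
    using density_ln_transform[OF Xm assms(7) fX fY[unfolded Y_def[abs_def]], of "ln x"] that
    by (simp flip: of_real_divide add: field_simps)
  have simple_eq: "fY_residue_term F y \<rho> = fY_pole_term F y \<rho>"
    if "\<forall>s. is_pole F s \<longrightarrow> pole_order F s = 1" "\<rho> \<in> pos_poles F" for y \<rho>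
    using that by (intro fY_residue_term_eq_pole_term[OF F_isolated_singularity[folded F_def]]) (auto simp: pos_poles_def)
  have convY: "has_pole_sum (fY_pole_term F y) (pos_poles F) (of_real (f\<^sub>Y y))"
    if "\<gamma>' < 0 \<or> (\<gamma>' = 0 \<and> \<kappa> < y)" for y
    unfolding F_def
    by (rule pole_sum_expansion[OF \<open>prob_space M\<close> fY lu momY[unfolded F_def]])
       (use that assms(11) in \<open>auto simp: \<gamma>_def \<gamma>'_def \<kappa>_def\<close>)
  have convX: "has_pole_sum (fX_pole_term F x) (pos_poles F) (of_real (f\<^sub>X x))"
    if "x > 0" "\<gamma>' < 0 \<or> (\<gamma>' = 0 \<and> \<kappa> < ln x)" for x
    unfolding fXY[OF that(1)] by (intro has_pole_sum_fX_pole_term convY that)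
  have convY': "has_pole_sum (fY_residue_term F y) (pos_poles F) (of_real (f\<^sub>Y y))"
    if "\<gamma>' < 0 \<or> (\<gamma>' = 0 \<and> \<kappa> < y)" "\<forall>s. is_pole F s \<longrightarrow> pole_order F s = 1" for y
    by (rule has_pole_sum_cong[THEN iffD2, OF simple_eq[OF that(2)] convY[OF that(1)]])
  have convX': "has_pole_sum (fX_residue_term F x) (pos_poles F) (of_real (f\<^sub>X x))"
    if "x > 0" "\<gamma>' < 0 \<or> (\<gamma>' = 0 \<and> \<kappa> < ln x)" "\<forall>s. is_pole F s \<longrightarrow> pole_order F s = 1" for x
  proof -
    have "fX_residue_term F x \<rho> = fX_pole_term F x \<rho>" if "\<rho> \<in> pos_poles F" for \<rho>
      using simple_eq[OF \<open>\<forall>s. is_pole F s \<longrightarrow> pole_order F s = 1\<close> that] \<open>x > 0\<close>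
      by (simp add: fX_residue_term_eq fX_pole_term_eq)
    from has_pole_sum_cong[THEN iffD2, OF this convX[OF that(1,2)]] show ?thesis .
  qed
  have divY: "pole_sum_diverges (fY_residue_term F y) (pos_poles F)"
    if "infinite (pos_poles F)" "\<forall>\<rho>\<in>pos_poles F. pole_order F (of_real \<rho>) = 1" "\<gamma>' > 0 \<or> (\<gamma>' = 0 \<and> y < \<kappa>)" for y
    unfolding F_def by (rule pole_sum_divergence) (use that in \<open>auto simp: F_def \<gamma>'_def \<kappa>_def\<close>)
  have divX: "pole_sum_diverges (fX_residue_term F x) (pos_poles F)"
    if "infinite (pos_poles F)" "\<forall>\<rho>\<in>pos_poles F. pole_order F (of_real \<rho>) = 1" "x > 0" "\<gamma>' > 0 \<or> (\<gamma>' = 0 \<and> ln x < \<kappa>)" for x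
    by (intro pole_sum_diverges_fX_residue_term divY that)
  have ln1: "x > 0 \<and> \<kappa> < ln x" if "x > exp \<kappa>" for x
  proof -
    have "x > 0" using that exp_gt_zero[of \<kappa>] by linarith
    thus ?thesis using that by (metis exp_less_cancel_iff exp_ln)
  qed
  have ln2: "ln x < \<kappa>" if "0 < x" "x < exp \<kappa>" for x
    using that by (metis exp_less_cancel_iff exp_ln)
  show ?thesis
    using convY convX convY' convX' divY divX ln1 ln2 by simp
qed

end
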